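(* Let $W=W_{A_{n-1}}$, $W_{D_n}$, or $W_{B_n}$. Then the quotient of the rational covering double affine Hecke algebra $\ddot{\mathfrak H}^{\sim}_W$ by the ideal $\langle z-1\rangle$ (respectively, by the ideal $\langle z+1\rangle$) is isomorphic to the rational Cherednik algebra $\ddot{\mathfrak H}_W^{t=0}$ (respectively, to the rational spin double affine Hecke algebra $\ddot{\mathfrak H}^-_W$).
   Context: Ground field $\mathbb C$; $[a,b]=ab-ba$ for algebra elements $a,b$. Parameters: $u\in\mathbb C$, and also $v\in\mathbb C$ in type $B_n$; all algebras below are taken with the same parameters. Weyl groups. $W_{A_{n-1}}=S_n$ acts on $\mathbb C^n$ by permuting the standard basis; $W_{B_n}$ ($n\ge2$) is the group of signed permutations of $e_1,\dots,e_n$; $W_{D_n}$ ($n\ge4$) is the subgroup with an even number of sign changes. $s_{ij}$ swaps $e_i,e_j$; $\overline{s}_{ij}$ sends $e_i\mapsto-e_j$, $e_j\mapsto-e_i$; $\tau_i$ sends $e_i\mapsto-e_i$ (other basis vectors fixed). Rational Cherednik algebra at $t=0$. $\ddot{\mathfrak H}_W^{t=0}$ is generated by $x_i,y_i$ ($1\le i\le n$) and $W$ with $x_ix_j=x_jx_i$, $y_iy_j=y_jy_i$, $\sigma x\sigma^{-1}=\sigma(x)$, $\sigma y\sigma^{-1}=\sigma(y)$ for $\sigma\in W$ and $x$, $y$ in the spans of the $x_i$, $y_i$ (on which $W$ acts as on the $e_i$), and type $A_{n-1}$: $[y_j,x_i]=us_{ij}$ ($i\ne j$), $[y_i,x_i]=-u\sum_{k\ne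 i}s_{ki}$; type $D_n$: $[y_j,x_i]=u(s_{ij}-\overline{s}_{ij})$ ($i\ne j$), $[y_i,x_i]=-u\sum_{k\ne i}(s_{ki}+\overline{s}_{ki})$; type $B_n$: $[y_j,x_i]=u(s_{ij}-\overline{s}_{ij})$ ($i\ne j$), $[y_i,x_i]=-u\sum_{k\ne i}(s_{ki}+\overline{s}_{ki})-v\tau_i$. Spin Weyl group algebra $\mathbb CW^-$. Type $A_{n-1}$: generated by $t_1,\dots,t_{n-1}$ with $t_i^2=1$, $t_it_{i+1}t_i=t_{i+1}t_it_{i+1}$, $(t_it_j)^2=-1$ if $|i-j|>1$. Type $B_n$: add $t_n$ with $t_n^2=1$, $(t_it_n)^2=-1$ for $i\ne n-1,n$, $(t_{n-1}t_n)^4=-1$. Type $D_n$: add $t_n$ with $t_n^2=1$, $(t_it_n)^2=-1$ for $i\ne n-2,n$, $t_{n-2}t_nt_{n-2}=t_nt_{n-2}t_n$. Put $t_{i\uparrow j}=t_i\cdots t_j$ (increasing indices) if $i\le j$, $1$ otherwise; $t_{i\downarrow j}=t_it_{i-1}\cdots t_j$ if $i\ge j$, $1$ otherwise. For $i<j$: $[i,j]=(-1)^{j-i-1}t_{j-1}\cdots t_{i+1}t_it_{i+1}\cdots t_{j-1}$, $[j,i]=-[i,j]$; $\overline{[i,j]}=\overline{[j,i]}=(-1)^{j-i-1}t_{j\uparrow n-1}t_{i\uparrow n-2}t_nt_{n-2\downarrow i}t_{n-1\downarrow j}$ in type $D_n$, $=(-1)^{j-i}t_{j\uparrow n-1}t_{i\uparrow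 n-2}t_nt_{n-1}t_nt_{n-2\downarrow i}t_{n-1\downarrow j}$ in type $B_n$; $\overline{[i]}=(-1)^{n-i}t_i\cdots t_{n-1}t_nt_{n-1}\cdots t_i$ in type $B_n$. Rational spin double affine Hecke algebra $\ddot{\mathfrak H}^-_W$. Generated by $\xi_i,y_i$ ($1\le i\le n$) and $\mathbb CW^-$ with $y_iy_j=y_jy_i$; $\xi_i\xi_j=-\xi_j\xi_i$ ($i\ne j$); for $1\le i\le n-1$: $t_iy_i=y_{i+1}t_i$, $t_i\xi_i=-\xi_{i+1}t_i$, $t_iy_j=y_jt_i$, $t_i\xi_j=-\xi_jt_i$ ($j\ne i,i+1$); and type $A_{n-1}$: $[y_j,\xi_i]=-u[i,j]$ ($i\ne j$), $[y_i,\xi_i]=u\sum_{k\ne i}[i,k]$; type $D_n$: $t_ny_n=-y_{n-1}t_n$, $t_n\xi_n=-\xi_{n-1}t_n$, $t_ny_j=y_jt_n$, $t_n\xi_j=-\xi_jt_n$ ($j\ne n-1,n$), $[y_j,\xi_i]=-u[i,j]+u\overline{[i,j]}$ ($i\ne j$), $[y_i,\xi_i]=u\sum_{k\ne i}([i,k]+\overline{[i,k]})$; type $B_n$: $t_ny_n=-y_nt_n$, $t_n\xi_n=-\xi_nt_n$, $t_ny_j=y_jt_n$, $t_n\xi_j=-\xi_jt_n$ ($j\ne n$), $[y_j,\xi_i]=-u[i,j]+u\overline{[i,j]}$ ($i\ne j$), $[y_i,\xi_i]=u\sum_{k\ne i}([i,k]+\overline{[i,k]})+v\overline{[i]}$.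 The double cover $\widetilde W$. Generated by $z$ (central of order $2$) and $\tilde t_i$ with: type $A_{n-1}$ ($1\le i\le n-1$): $\tilde t_i^2=1$, $\tilde t_i\tilde t_{i+1}\tilde t_i=\tilde t_{i+1}\tilde t_i\tilde t_{i+1}$, $\tilde t_i\tilde t_j=z\tilde t_j\tilde t_i$ if $|i-j|>1$; type $B_n$: the type $A_{n-1}$ relations for $\tilde t_1,\dots,\tilde t_{n-1}$, $\tilde t_n^2=1$, $\tilde t_i\tilde t_n=z\tilde t_n\tilde t_i$ ($1\le i\le n-2$), $(\tilde t_{n-1}\tilde t_n)^2=z(\tilde t_n\tilde t_{n-1})^2$; type $D_n$: the type $A_{n-1}$ relations for $\tilde t_1,\dots,\tilde t_{n-1}$, $\tilde t_n^2=1$, $\tilde t_{n-2}\tilde t_n\tilde t_{n-2}=\tilde t_n\tilde t_{n-2}\tilde t_n$, $\tilde t_i\tilde t_n=z\tilde t_n\tilde t_i$ ($i\ne n-2,n$). With $\tilde t_{i\uparrow j},\tilde t_{i\downarrow j}$ defined like $t_{i\uparrow j},t_{i\downarrow j}$, for $i<j$: $\{i,j\}=z^{j-i-1}\tilde t_{j-1}\cdots\tilde t_{i+1}\tilde t_i\tilde t_{i+1}\cdots\tilde t_{j-1}$, $\{j,i\}=z\{i,j\}$; $\overline{\{i,j\}}=\overline{\{j,i\}}=z^{j-i-1}\tilde t_{j\uparrow n-1}\tilde t_{i\uparrow n-2}\tilde t_n\tilde t_{n-2\downarrow i}\tilde t_{n-1\downarrow j}$ in type $D_n$, $=z^{j-i}\tilde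 t_{j\uparrow n-1}\tilde t_{i\uparrow n-2}\tilde t_n\tilde t_{n-1}\tilde t_n\tilde t_{n-2\downarrow i}\tilde t_{n-1\downarrow j}$ in type $B_n$; $\{i\}=z^{n-i}\tilde t_i\cdots\tilde t_{n-1}\tilde t_n\tilde t_{n-1}\cdots\tilde t_i$ in type $B_n$. Rational covering double affine Hecke algebra $\ddot{\mathfrak H}^{\sim}_W$. Generated by $\tilde x_i,\tilde y_i$ ($1\le i\le n$), $z$ and the $\tilde t_i$, subject to the relations of $\widetilde W$, $z$ central, and: $\tilde x_i\tilde x_j=z\tilde x_j\tilde x_i$, $\tilde y_i\tilde y_j=\tilde y_j\tilde y_i$ ($i\ne j$); for $1\le i\le n-1$: $\tilde t_i\tilde x_j=z\tilde x_j\tilde t_i$, $\tilde t_i\tilde y_j=\tilde y_j\tilde t_i$ ($j\ne i,i+1$), $\tilde t_i\tilde x_{i+1}=z\tilde x_i\tilde t_i$, $\tilde t_i\tilde y_{i+1}=\tilde y_i\tilde t_i$; and type $A_{n-1}$: $[\tilde y_j,\tilde x_i]=uz\{i,j\}$ ($j\ne i$), $[\tilde y_i,\tilde x_i]=-uz\sum_{k\ne i}\{i,k\}$; type $D_n$: $\tilde t_n\tilde x_j=z\tilde x_j\tilde t_n$, $\tilde t_n\tilde y_j=\tilde y_j\tilde t_n$ ($j\ne n-1,n$), $\tilde t_n\tilde x_n=-\tilde x_{n-1}\tilde t_n$, $\tilde t_n\tilde y_n=-\tilde y_{n-1}\tilde t_n$, $[\tilde y_j,\tilde x_i]=uz(\{i,j\}-\overline{\{i,j\}})$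 ($j\ne i$), $[\tilde y_i,\tilde x_i]=-uz\sum_{k\ne i}(\{i,k\}+\overline{\{i,k\}})$; type $B_n$: $\tilde t_n\tilde x_i=z\tilde x_i\tilde t_n$, $\tilde t_n\tilde y_i=\tilde y_i\tilde t_n$ ($i\ne n$), $\tilde t_n\tilde x_n=-\tilde x_n\tilde t_n$, $\tilde t_n\tilde y_n=-\tilde y_n\tilde t_n$, $[\tilde y_j,\tilde x_i]=uz(\{i,j\}-\overline{\{i,j\}})$ ($j\ne i$), $[\tilde y_i,\tilde x_i]=-uz\sum_{k\ne i}(\{i,k\}+\overline{\{i,k\}})-vz\{i\}$. *)

theory Defs
  imports
    Complex_Main
    "HOL-Library.Poly_Mapping"
    "HOL-Combinatorics.Permutations"
    "HOL-Algebra.QuotRing"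
    "HOL-Algebra.Module"
begin

section \<open>Complex associative algebras by generators and relations\<close>

text \<open>A unital associative complex algebra is a record of type \<open>(complex, 'b) module\<close>.
  The locale \<open>algebra\<close> of HOL-Algebra demands commutativity and does not apply.\<close>

text \<open>Words are the free monoid, written additively so that finitely supported functions on
  words form the free associative algebra under the convolution product of
  \<^theory>\<open>HOL-Library.Poly_Mapping\<close>.\<close>

datatype 'g fword = FWord (letters: "'g list")

instantiation fword :: (type) monoid_add
begin

definition zero_fword :: "'a fword" where
  "zero_fword = FWord []"

definition plus_fword :: "'a fword \<Rightarrow> 'a fword \<Rightarrow> 'a fword" where
  "plus_fword a b = FWord (letters a @ letters b)"

instance
  by standard (simp_all add: zero_fword_def plus_fword_def)

end

type_synonym 'g ncpoly = "'g fword \<Rightarrow>\<^sub>0 complex"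

definition scal :: "complex \<Rightarrow> 'g ncpoly" where
  "scal c = Poly_Mapping.single 0 c"

definition gen :: "'g \<Rightarrow> 'g ncpoly" where
  "gen g = Poly_Mapping.single (FWord [g]) 1"

definition free_algebra :: "'g set \<Rightarrow> (complex, 'g ncpoly) module" where
  "free_algebra G =
    \<lparr>carrier = {p. \<forall>w \<in> Poly_Mapping.keys p. set (letters w) \<subseteq> G},
     mult = (*), one = 1, zero = 0, add = (+), smult = (\<lambda>c p. scal c * p)\<rparr>"

text \<open>The quotient algebra: the ring \<open>A Quot I\<close> with the induced scalar action on cosets,
  in the style of \<^const>\<open>rcoset_mult\<close>.\<close>

definition quot_algebra :: "(complex, 'b) module \<Rightarrow> 'b set \<Rightarrow> (complex, 'b set) module" where
  "quot_algebra A I = ring.extend (A Quot I)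
    (module.fields (\<lambda>c X. \<Union>a\<in>X. I +>\<^bsub>A\<^esub> (c \<odot>\<^bsub>A\<^esub> a)))"

text \<open>A predicate \<open>R l r\<close> on noncommutative polynomials stands for the relations \<open>l = r\<close>.\<close>

definition relators :: "('g ncpoly \<Rightarrow> 'g ncpoly \<Rightarrow> bool) \<Rightarrow> 'g ncpoly set" where
  "relators R = {l - r | l r. R l r}"

definition presented_algebra ::
    "'g set \<Rightarrow> ('g ncpoly \<Rightarrow> 'g ncpoly \<Rightarrow> bool) \<Rightarrow> (complex, 'g ncpoly set) module" where
  "presented_algebra G R =
    quot_algebra (free_algebra G) (Idl\<^bsub>free_algebra G\<^esub> (relators R))"

definition presented_class ::
    "'g set \<Rightarrow> ('g ncpoly \<Rightarrow> 'g ncpoly \<Rightarrow> bool) \<Rightarrow> 'g ncpoly \<Rightarrow> 'g ncpoly set" where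
  "presented_class G R p = (Idl\<^bsub>free_algebra G\<^esub> (relators R)) +>\<^bsub>free_algebra G\<^esub> p"

definition algebra_isomorphic ::
    "(complex, 'a) module \<Rightarrow> (complex, 'b) module \<Rightarrow> bool" where
  "algebra_isomorphic A B \<longleftrightarrow>
    (\<exists>f \<in> ring_iso A B. \<forall>c. \<forall>a \<in> carrier A. f (c \<odot>\<^bsub>A\<^esub> a) = c \<odot>\<^bsub>B\<^esub> f a)"

definition comm :: "'p::ring_1 \<Rightarrow> 'p \<Rightarrow> 'p" where
  "comm a b = a * b - b * a"

section \<open>Weyl groups\<close>

text \<open>With parameter \<open>n\<close>, \<open>TypeA\<close> stands for the root system \<open>A\<^bsub>n-1\<^esub>\<close>, whereas
  \<open>TypeB\<close> and \<open>TypeD\<close> stand for \<open>B\<^sub>n\<close> and \<open>D\<^sub>n\<close>.\<close>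

datatype weyl_type = TypeA | TypeB | TypeD

fun admissible :: "weyl_type \<Rightarrow> nat \<Rightarrow> bool" where
  "admissible TypeA n \<longleftrightarrow> n \<ge> 1"
| "admissible TypeB n \<longleftrightarrow> n \<ge> 2"
| "admissible TypeD n \<longleftrightarrow> n \<ge> 4"

text \<open>With the convention \<open>e\<^bsub>-k\<^esub> = - e\<^sub>k\<close>, a signed permutation of the basis
  \<open>e\<^sub>1, \<dots>, e\<^sub>n\<close> is encoded as an odd permutation \<open>\<sigma>\<close> of \<open>{\<plusminus>1, \<dots>, \<plusminus>n}\<close> (odd as a function),
  acting by \<open>e\<^sub>k \<mapsto> e\<^bsub>\<sigma> k\<^esub>\<close>; the group multiplication is composition.\<close>

definition signed_perms :: "nat \<Rightarrow> (int \<Rightarrow> int) set" where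
  "signed_perms n =
    {\<sigma>. \<sigma> permutes {k. k \<noteq> 0 \<and> \<bar>k\<bar> \<le> int n} \<and> (\<forall>k. \<sigma> (- k) = - \<sigma> k)}"

fun weyl_group :: "weyl_type \<Rightarrow> nat \<Rightarrow> (int \<Rightarrow> int) set" where
  "weyl_group TypeA n = {\<sigma> \<in> signed_perms n. \<forall>k > 0. \<sigma> k > 0}"
| "weyl_group TypeB n = signed_perms n"
| "weyl_group TypeD n = {\<sigma> \<in> signed_perms n. even (card {k \<in> {1..int n}. \<sigma> k < 0})}"

definition swap_refl :: "nat \<Rightarrow> nat \<Rightarrow> int \<Rightarrow> int" where
  "swap_refl i j = transpose (int i) (int j) \<circ> transpose (- int i) (- int j)"

definition swap_neg_refl :: "nat \<Rightarrow> nat \<Rightarrow> int \<Rightarrow> int" where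
  "swap_neg_refl i j = transpose (int i) (- int j) \<circ> transpose (- int i) (int j)"

definition sign_refl :: "nat \<Rightarrow> int \<Rightarrow> int" where
  "sign_refl i = transpose (int i) (- int i)"

section \<open>The rational Cherednik algebra at \<open>t = 0\<close>\<close>

datatype cherednik_gen = CX nat | CY nat | CW "int \<Rightarrow> int"

definition cherednik_gens :: "weyl_type \<Rightarrow> nat \<Rightarrow> cherednik_gen set" where
  "cherednik_gens T n = CX ` {1..n} \<union> CY ` {1..n} \<union> CW ` weyl_group T n"

abbreviation cx :: "nat \<Rightarrow> cherednik_gen ncpoly" where "cx i \<equiv> gen (CX i)"
abbreviation cy :: "nat \<Rightarrow> cherednik_gen ncpoly" where "cy i \<equiv> gen (CY i)"
abbreviation cw :: "(int \<Rightarrow> int) \<Rightarrow> cherednik_gen ncpoly" where "cw \<sigma> \<equiv> gen (CW \<sigma>)"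

text \<open>Extends a family \<open>f\<close> to negative indices by \<open>f\<^bsub>-k\<^esub> = - f\<^sub>k\<close>.\<close>

definition signed_ext :: "(nat \<Rightarrow> 'p::ring_1) \<Rightarrow> int \<Rightarrow> 'p" where
  "signed_ext f k = (if k < 0 then - f (nat (- k)) else f (nat k))"

text \<open>By linearity, the relations \<open>\<sigma> x \<sigma>\<inverse> = \<sigma>(x)\<close> are imposed on the basis vectors only.\<close>

inductive cherednik_rel ::
    "weyl_type \<Rightarrow> nat \<Rightarrow> complex \<Rightarrow> complex \<Rightarrow>
      cherednik_gen ncpoly \<Rightarrow> cherednik_gen ncpoly \<Rightarrow> bool"
  for T n u v where
  w_one: "cherednik_rel T n u v (cw id) 1"
| w_mult: "\<lbrakk>\<sigma> \<in> weyl_group T n; \<rho> \<in> weyl_group T n\<rbrakk> \<Longrightarrow>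
    cherednik_rel T n u v (cw \<sigma> * cw \<rho>) (cw (\<sigma> \<circ> \<rho>))"
| xx: "\<lbrakk>i \<in> {1..n}; j \<in> {1..n}\<rbrakk> \<Longrightarrow>
    cherednik_rel T n u v (cx i * cx j) (cx j * cx i)"
| yy: "\<lbrakk>i \<in> {1..n}; j \<in> {1..n}\<rbrakk> \<Longrightarrow>
    cherednik_rel T n u v (cy i * cy j) (cy j * cy i)"
| wx: "\<lbrakk>\<sigma> \<in> weyl_group T n; i \<in> {1..n}\<rbrakk> \<Longrightarrow>
    cherednik_rel T n u v (cw \<sigma> * cx i * cw (inv_into UNIV \<sigma>)) (signed_ext cx (\<sigma> (int i)))"
| wy: "\<lbrakk>\<sigma> \<in> weyl_group T n; i \<in> {1..n}\<rbrakk> \<Longrightarrow>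
    cherednik_rel T n u v (cw \<sigma> * cy i * cw (inv_into UNIV \<sigma>)) (signed_ext cy (\<sigma> (int i)))"
| A_off: "\<lbrakk>T = TypeA; i \<in> {1..n}; j \<in> {1..n}; i \<noteq> j\<rbrakk> \<Longrightarrow>
    cherednik_rel T n u v (comm (cy j) (cx i)) (scal u * cw (swap_refl i j))"
| A_diag: "\<lbrakk>T = TypeA; i \<in> {1..n}\<rbrakk> \<Longrightarrow>
    cherednik_rel T n u v (comm (cy i) (cx i))
      (- scal u * (\<Sum>k\<in>{1..n} - {i}. cw (swap_refl k i)))"
| D_off: "\<lbrakk>T = TypeD; i \<in> {1..n}; j \<in> {1..n}; i \<noteq> j\<rbrakk> \<Longrightarrow>
    cherednik_rel T n u v (comm (cy j) (cx i))
      (scal u * (cw (swap_refl i j) - cw (swap_neg_refl i j)))"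
| D_diag: "\<lbrakk>T = TypeD; i \<in> {1..n}\<rbrakk> \<Longrightarrow>
    cherednik_rel T n u v (comm (cy i) (cx i))
      (- scal u * (\<Sum>k\<in>{1..n} - {i}. cw (swap_refl k i) + cw (swap_neg_refl k i)))"
| B_off: "\<lbrakk>T = TypeB; i \<in> {1..n}; j \<in> {1..n}; i \<noteq> j\<rbrakk> \<Longrightarrow>
    cherednik_rel T n u v (comm (cy j) (cx i))
      (scal u * (cw (swap_refl i j) - cw (swap_neg_refl i j)))"
| B_diag: "\<lbrakk>T = TypeB; i \<in> {1..n}\<rbrakk> \<Longrightarrow>
    cherednik_rel T n u v (comm (cy i) (cx i))
      (- scal u * (\<Sum>k\<in>{1..n} - {i}. cw (swap_refl k i) + cw (swap_neg_refl k i))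
       - scal v * cw (sign_refl i))"

definition cherednik_algebra ::
    "weyl_type \<Rightarrow> nat \<Rightarrow> complex \<Rightarrow> complex \<Rightarrow> (complex, cherednik_gen ncpoly set) module" where
  "cherednik_algebra T n u v = presented_algebra (cherednik_gens T n) (cherednik_rel T n u v)"

section \<open>Lifted reflections\<close>

fun nodes :: "weyl_type \<Rightarrow> nat \<Rightarrow> nat set" where
  "nodes TypeA n = {1..<n}"
| "nodes TypeB n = {1..n}"
| "nodes TypeD n = {1..n}"

text \<open>\<open>up t i j\<close> is \<open>t\<^bsub>i\<up>j\<^esub>\<close> and \<open>down t i j\<close> is \<open>t\<^bsub>i\<down>j\<^esub>\<close>; both are \<open>1\<close> on empty ranges.\<close>

definition up :: "(nat \<Rightarrow> 'p::ring_1) \<Rightarrow> nat \<Rightarrow> nat \<Rightarrow> 'p" where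
  "up t i j = prod_list (map t [i..<Suc j])"

definition down :: "(nat \<Rightarrow> 'p::ring_1) \<Rightarrow> nat \<Rightarrow> nat \<Rightarrow> 'p" where
  "down t i j = prod_list (map t (rev [j..<Suc i]))"

text \<open>The following elements are used with \<open>e = -1\<close> for the spin algebras, giving
  \<open>[i,j]\<close>, \<open>\<overline>[i,j]\<close>, \<open>\<overline>[i]\<close>, and with \<open>e = z\<close> for the covering algebras, giving
  \<open>{i,j}\<close>, \<open>\<overline>{i,j}\<close>, \<open>{i}\<close>.\<close>

definition brk :: "'p::ring_1 \<Rightarrow> (nat \<Rightarrow> 'p) \<Rightarrow> nat \<Rightarrow> nat \<Rightarrow> 'p" where
  "brk e t i j =
    (let b = (\<lambda>i j. e ^ (j - i - 1) * down t (j - 1) i * up t (i + 1) (j - 1))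
     in if i < j then b i j else e * b j i)"

definition brk_bar_D :: "'p::ring_1 \<Rightarrow> (nat \<Rightarrow> 'p) \<Rightarrow> nat \<Rightarrow> nat \<Rightarrow> nat \<Rightarrow> 'p" where
  "brk_bar_D e t n k l =
    (let i = min k l; j = max k l
     in e ^ (j - i - 1) * up t j (n - 1) * up t i (n - 2) * t n
        * down t (n - 2) i * down t (n - 1) j)"

definition brk_bar_B :: "'p::ring_1 \<Rightarrow> (nat \<Rightarrow> 'p) \<Rightarrow> nat \<Rightarrow> nat \<Rightarrow> nat \<Rightarrow> 'p" where
  "brk_bar_B e t n k l =
    (let i = min k l; j = max k l
     in e ^ (j - i) * up t j (n - 1) * up t i (n - 2) * t n * t (n - 1) * t n
        * down t (n - 2) i * down t (n - 1) j)"

definition brk_single :: "'p::ring_1 \<Rightarrow> (nat \<Rightarrow> 'p) \<Rightarrow> nat \<Rightarrow> nat \<Rightarrow> 'p" where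
  "brk_single e t n i = e ^ (n - i) * up t i (n - 1) * t n * down t (n - 1) i"

section \<open>The rational spin double affine Hecke algebra\<close>

datatype spin_gen = SXi nat | SY nat | ST nat

definition spin_gens :: "weyl_type \<Rightarrow> nat \<Rightarrow> spin_gen set" where
  "spin_gens T n = SXi ` {1..n} \<union> SY ` {1..n} \<union> ST ` nodes T n"

abbreviation sxi :: "nat \<Rightarrow> spin_gen ncpoly" where "sxi i \<equiv> gen (SXi i)"
abbreviation sy :: "nat \<Rightarrow> spin_gen ncpoly" where "sy i \<equiv> gen (SY i)"
abbreviation st :: "nat \<Rightarrow> spin_gen ncpoly" where "st i \<equiv> gen (ST i)"

inductive spin_weyl_rel ::
    "weyl_type \<Rightarrow> nat \<Rightarrow> spin_gen ncpoly \<Rightarrow> spin_gen ncpoly \<Rightarrow> bool"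
  for T n where
  sq: "i \<in> nodes T n \<Longrightarrow> spin_weyl_rel T n (st i ^ 2) 1"
| braid: "\<lbrakk>1 \<le> i; i + 1 < n\<rbrakk> \<Longrightarrow>
    spin_weyl_rel T n (st i * st (i + 1) * st i) (st (i + 1) * st i * st (i + 1))"
| far: "\<lbrakk>i \<in> {1..<n}; j \<in> {1..<n}; \<bar>int i - int j\<bar> > 1\<rbrakk> \<Longrightarrow>
    spin_weyl_rel T n ((st i * st j) ^ 2) (- 1)"
| B_far: "\<lbrakk>T = TypeB; i \<in> {1..n}; i \<noteq> n - 1; i \<noteq> n\<rbrakk> \<Longrightarrow>
    spin_weyl_rel T n ((st i * st n) ^ 2) (- 1)"
| B_braid: "T = TypeB \<Longrightarrow> spin_weyl_rel T n ((st (n - 1) * st n) ^ 4) (- 1)"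
| D_far: "\<lbrakk>T = TypeD; i \<in> {1..n}; i \<noteq> n - 2; i \<noteq> n\<rbrakk> \<Longrightarrow>
    spin_weyl_rel T n ((st i * st n) ^ 2) (- 1)"
| D_braid: "T = TypeD \<Longrightarrow>
    spin_weyl_rel T n (st (n - 2) * st n * st (n - 2)) (st n * st (n - 2) * st n)"

inductive spin_rel ::
    "weyl_type \<Rightarrow> nat \<Rightarrow> complex \<Rightarrow> complex \<Rightarrow> spin_gen ncpoly \<Rightarrow> spin_gen ncpoly \<Rightarrow> bool"
  for T n u v where
  weyl: "spin_weyl_rel T n l r \<Longrightarrow> spin_rel T n u v l r"
| yy: "\<lbrakk>i \<in> {1..n}; j \<in> {1..n}\<rbrakk> \<Longrightarrow> spin_rel T n u v (sy i * sy j) (sy j * sy i)"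
| xx: "\<lbrakk>i \<in> {1..n}; j \<in> {1..n}; i \<noteq> j\<rbrakk> \<Longrightarrow>
    spin_rel T n u v (sxi i * sxi j) (- sxi j * sxi i)"
| ty: "i \<in> {1..<n} \<Longrightarrow> spin_rel T n u v (st i * sy i) (sy (i + 1) * st i)"
| tx: "i \<in> {1..<n} \<Longrightarrow> spin_rel T n u v (st i * sxi i) (- sxi (i + 1) * st i)"
| ty_far: "\<lbrakk>i \<in> {1..<n}; j \<in> {1..n}; j \<noteq> i; j \<noteq> i + 1\<rbrakk> \<Longrightarrow>
    spin_rel T n u v (st i * sy j) (sy j * st i)"
| tx_far: "\<lbrakk>i \<in> {1..<n}; j \<in> {1..n}; j \<noteq> i; j \<noteq> i + 1\<rbrakk> \<Longrightarrow>
    spin_rel T n u v (st i * sxi j) (- sxi j * st i)"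
| A_off: "\<lbrakk>T = TypeA; i \<in> {1..n}; j \<in> {1..n}; i \<noteq> j\<rbrakk> \<Longrightarrow>
    spin_rel T n u v (comm (sy j) (sxi i)) (- scal u * brk (- 1) st i j)"
| A_diag: "\<lbrakk>T = TypeA; i \<in> {1..n}\<rbrakk> \<Longrightarrow>
    spin_rel T n u v (comm (sy i) (sxi i)) (scal u * (\<Sum>k\<in>{1..n} - {i}. brk (- 1) st i k))"
| D_ty: "T = TypeD \<Longrightarrow> spin_rel T n u v (st n * sy n) (- sy (n - 1) * st n)"
| D_tx: "T = TypeD \<Longrightarrow> spin_rel T n u v (st n * sxi n) (- sxi (n - 1) * st n)"
| D_ty_far: "\<lbrakk>T = TypeD; j \<in> {1..n}; j \<noteq> n - 1; j \<noteq> n\<rbrakk> \<Longrightarrow>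
    spin_rel T n u v (st n * sy j) (sy j * st n)"
| D_tx_far: "\<lbrakk>T = TypeD; j \<in> {1..n}; j \<noteq> n - 1; j \<noteq> n\<rbrakk> \<Longrightarrow>
    spin_rel T n u v (st n * sxi j) (- sxi j * st n)"
| D_off: "\<lbrakk>T = TypeD; i \<in> {1..n}; j \<in> {1..n}; i \<noteq> j\<rbrakk> \<Longrightarrow>
    spin_rel T n u v (comm (sy j) (sxi i))
      (- scal u * brk (- 1) st i j + scal u * brk_bar_D (- 1) st n i j)"
| D_diag: "\<lbrakk>T = TypeD; i \<in> {1..n}\<rbrakk> \<Longrightarrow>
    spin_rel T n u v (comm (sy i) (sxi i))
      (scal u * (\<Sum>k\<in>{1..n} - {i}. brk (- 1) st i k + brk_bar_D (- 1) st n i k))"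
| B_ty: "T = TypeB \<Longrightarrow> spin_rel T n u v (st n * sy n) (- sy n * st n)"
| B_tx: "T = TypeB \<Longrightarrow> spin_rel T n u v (st n * sxi n) (- sxi n * st n)"
| B_ty_far: "\<lbrakk>T = TypeB; j \<in> {1..n}; j \<noteq> n\<rbrakk> \<Longrightarrow>
    spin_rel T n u v (st n * sy j) (sy j * st n)"
| B_tx_far: "\<lbrakk>T = TypeB; j \<in> {1..n}; j \<noteq> n\<rbrakk> \<Longrightarrow>
    spin_rel T n u v (st n * sxi j) (- sxi j * st n)"
| B_off: "\<lbrakk>T = TypeB; i \<in> {1..n}; j \<in> {1..n}; i \<noteq> j\<rbrakk> \<Longrightarrow>
    spin_rel T n u v (comm (sy j) (sxi i))
      (- scal u * brk (- 1) st i j + scal u * brk_bar_B (- 1) st n i j)"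
| B_diag: "\<lbrakk>T = TypeB; i \<in> {1..n}\<rbrakk> \<Longrightarrow>
    spin_rel T n u v (comm (sy i) (sxi i))
      (scal u * (\<Sum>k\<in>{1..n} - {i}. brk (- 1) st i k + brk_bar_B (- 1) st n i k)
       + scal v * brk_single (- 1) st n i)"

definition spin_daha ::
    "weyl_type \<Rightarrow> nat \<Rightarrow> complex \<Rightarrow> complex \<Rightarrow> (complex, spin_gen ncpoly set) module" where
  "spin_daha T n u v = presented_algebra (spin_gens T n) (spin_rel T n u v)"

section \<open>The rational covering double affine Hecke algebra\<close>

datatype cover_gen = VX nat | VY nat | VT nat | VZ

definition cover_gens :: "weyl_type \<Rightarrow> nat \<Rightarrow> cover_gen set" where
  "cover_gens T n = VX ` {1..n} \<union> VY ` {1..n} \<union> VT ` nodes T n \<union> {VZ}"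

abbreviation vx :: "nat \<Rightarrow> cover_gen ncpoly" where "vx i \<equiv> gen (VX i)"
abbreviation vy :: "nat \<Rightarrow> cover_gen ncpoly" where "vy i \<equiv> gen (VY i)"
abbreviation vt :: "nat \<Rightarrow> cover_gen ncpoly" where "vt i \<equiv> gen (VT i)"
abbreviation vz :: "cover_gen ncpoly" where "vz \<equiv> gen VZ"

text \<open>The relations of the double cover of the Weyl group, except for the centrality of \<open>z\<close>,
  which is imposed in the whole algebra below.\<close>

inductive cover_weyl_rel ::
    "weyl_type \<Rightarrow> nat \<Rightarrow> cover_gen ncpoly \<Rightarrow> cover_gen ncpoly \<Rightarrow> bool"
  for T n where
  z_sq: "cover_weyl_rel T n (vz ^ 2) 1"
| sq: "i \<in> nodes T n \<Longrightarrow> cover_weyl_rel T n (vt i ^ 2) 1"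
| braid: "\<lbrakk>1 \<le> i; i + 1 < n\<rbrakk> \<Longrightarrow>
    cover_weyl_rel T n (vt i * vt (i + 1) * vt i) (vt (i + 1) * vt i * vt (i + 1))"
| far: "\<lbrakk>i \<in> {1..<n}; j \<in> {1..<n}; \<bar>int i - int j\<bar> > 1\<rbrakk> \<Longrightarrow>
    cover_weyl_rel T n (vt i * vt j) (vz * vt j * vt i)"
| B_far: "\<lbrakk>T = TypeB; 1 \<le> i; i \<le> n - 2\<rbrakk> \<Longrightarrow>
    cover_weyl_rel T n (vt i * vt n) (vz * vt n * vt i)"
| B_braid: "T = TypeB \<Longrightarrow>
    cover_weyl_rel T n ((vt (n - 1) * vt n) ^ 2) (vz * (vt n * vt (n - 1)) ^ 2)"
| D_braid: "T = TypeD \<Longrightarrow>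
    cover_weyl_rel T n (vt (n - 2) * vt n * vt (n - 2)) (vt n * vt (n - 2) * vt n)"
| D_far: "\<lbrakk>T = TypeD; i \<in> {1..n}; i \<noteq> n - 2; i \<noteq> n\<rbrakk> \<Longrightarrow>
    cover_weyl_rel T n (vt i * vt n) (vz * vt n * vt i)"

inductive cover_rel ::
    "weyl_type \<Rightarrow> nat \<Rightarrow> complex \<Rightarrow> complex \<Rightarrow> cover_gen ncpoly \<Rightarrow> cover_gen ncpoly \<Rightarrow> bool"
  for T n u v where
  weyl: "cover_weyl_rel T n l r \<Longrightarrow> cover_rel T n u v l r"
| z_central: "g \<in> cover_gens T n \<Longrightarrow> cover_rel T n u v (vz * gen g) (gen g * vz)"
| xx: "\<lbrakk>i \<in> {1..n}; j \<in> {1..n}; i \<noteq> j\<rbrakk> \<Longrightarrow>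
    cover_rel T n u v (vx i * vx j) (vz * vx j * vx i)"
| yy: "\<lbrakk>i \<in> {1..n}; j \<in> {1..n}; i \<noteq> j\<rbrakk> \<Longrightarrow>
    cover_rel T n u v (vy i * vy j) (vy j * vy i)"
| tx_far: "\<lbrakk>i \<in> {1..<n}; j \<in> {1..n}; j \<noteq> i; j \<noteq> i + 1\<rbrakk> \<Longrightarrow>
    cover_rel T n u v (vt i * vx j) (vz * vx j * vt i)"
| ty_far: "\<lbrakk>i \<in> {1..<n}; j \<in> {1..n}; j \<noteq> i; j \<noteq> i + 1\<rbrakk> \<Longrightarrow>
    cover_rel T n u v (vt i * vy j) (vy j * vt i)"
| tx: "i \<in> {1..<n} \<Longrightarrow> cover_rel T n u v (vt i * vx (i + 1)) (vz * vx i * vt i)"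
| ty: "i \<in> {1..<n} \<Longrightarrow> cover_rel T n u v (vt i * vy (i + 1)) (vy i * vt i)"
| A_off: "\<lbrakk>T = TypeA; i \<in> {1..n}; j \<in> {1..n}; j \<noteq> i\<rbrakk> \<Longrightarrow>
    cover_rel T n u v (comm (vy j) (vx i)) (scal u * vz * brk vz vt i j)"
| A_diag: "\<lbrakk>T = TypeA; i \<in> {1..n}\<rbrakk> \<Longrightarrow>
    cover_rel T n u v (comm (vy i) (vx i))
      (- scal u * vz * (\<Sum>k\<in>{1..n} - {i}. brk vz vt i k))"
| D_tx_far: "\<lbrakk>T = TypeD; j \<in> {1..n}; j \<noteq> n - 1; j \<noteq> n\<rbrakk> \<Longrightarrow>
    cover_rel T n u v (vt n * vx j) (vz * vx j * vt n)"
| D_ty_far: "\<lbrakk>T = TypeD; j \<in> {1..n}; j \<noteq> n - 1; j \<noteq> n\<rbrakk> \<Longrightarrow>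
    cover_rel T n u v (vt n * vy j) (vy j * vt n)"
| D_tx: "T = TypeD \<Longrightarrow> cover_rel T n u v (vt n * vx n) (- vx (n - 1) * vt n)"
| D_ty: "T = TypeD \<Longrightarrow> cover_rel T n u v (vt n * vy n) (- vy (n - 1) * vt n)"
| D_off: "\<lbrakk>T = TypeD; i \<in> {1..n}; j \<in> {1..n}; j \<noteq> i\<rbrakk> \<Longrightarrow>
    cover_rel T n u v (comm (vy j) (vx i))
      (scal u * vz * (brk vz vt i j - brk_bar_D vz vt n i j))"
| D_diag: "\<lbrakk>T = TypeD; i \<in> {1..n}\<rbrakk> \<Longrightarrow>
    cover_rel T n u v (comm (vy i) (vx i))
      (- scal u * vz * (\<Sum>k\<in>{1..n} - {i}. brk vz vt i k + brk_bar_D vz vt n i k))"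
| B_tx_far: "\<lbrakk>T = TypeB; i \<in> {1..n}; i \<noteq> n\<rbrakk> \<Longrightarrow>
    cover_rel T n u v (vt n * vx i) (vz * vx i * vt n)"
| B_ty_far: "\<lbrakk>T = TypeB; i \<in> {1..n}; i \<noteq> n\<rbrakk> \<Longrightarrow>
    cover_rel T n u v (vt n * vy i) (vy i * vt n)"
| B_tx: "T = TypeB \<Longrightarrow> cover_rel T n u v (vt n * vx n) (- vx n * vt n)"
| B_ty: "T = TypeB \<Longrightarrow> cover_rel T n u v (vt n * vy n) (- vy n * vt n)"
| B_off: "\<lbrakk>T = TypeB; i \<in> {1..n}; j \<in> {1..n}; j \<noteq> i\<rbrakk> \<Longrightarrow>
    cover_rel T n u v (comm (vy j) (vx i))
      (scal u * vz * (brk vz vt i j - brk_bar_B vz vt n i j))"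
| B_diag: "\<lbrakk>T = TypeB; i \<in> {1..n}\<rbrakk> \<Longrightarrow>
    cover_rel T n u v (comm (vy i) (vx i))
      (- scal u * vz * (\<Sum>k\<in>{1..n} - {i}. brk vz vt i k + brk_bar_B vz vt n i k)
       - scal v * vz * brk_single vz vt n i)"

definition covering_daha ::
    "weyl_type \<Rightarrow> nat \<Rightarrow> complex \<Rightarrow> complex \<Rightarrow> (complex, cover_gen ncpoly set) module" where
  "covering_daha T n u v = presented_algebra (cover_gens T n) (cover_rel T n u v)"

definition covering_z :: "weyl_type \<Rightarrow> nat \<Rightarrow> complex \<Rightarrow> complex \<Rightarrow> cover_gen ncpoly set" where
  "covering_z T n u v = presented_class (cover_gens T n) (cover_rel T n u v) vz"

end

theory Submission
  imports Defs
begin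

text \<open>All algebras involved are quotients of free algebras, so an isomorphism amounts to substitutions
  of generators in both directions that respect the relations and are mutually inverse on
  generators. For \<open>z = -1\<close> the generators correspond to each other, and the two systems of relations
  are equivalent because the \<open>t\<^sub>i\<close> are involutions. For \<open>z = 1\<close> the relations among the \<open>t\<^sub>i\<close> become
  the Coxeter relations, and \<open>\<sigma> \<in> W\<close> is sent back to the product of the \<open>t\<^sub>i\<close> along some word for
  \<open>\<sigma>\<close>. This is compatible with the multiplication table of \<open>W\<close> since \<open>W\<close> is presented by the Coxeter
  relations. The latter follows by descending along the pointwise stabilizers of \<open>e\<^sub>1\<close>, of
  \<open>e\<^sub>1, e\<^sub>2\<close>, and so on: the Coxeter relations rewrite every word into a coset representative,
  determined by the image of the next basis vector, followed by a word in the smaller stabilizer.\<close>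

section \<open>Substitution homomorphisms between free algebras\<close>

text \<open>Two obstacles shape the development. First, the algebras live on carriers of words over
  prescribed alphabets. Everything is moved to the free algebra on the whole generator type, where
  the letters outside the alphabet are merely further generators of the ideal; homomorphisms and
  congruences are then total and carry no membership conditions. Second, a word in the generators
  modulo an ideal is not a group element on which the coset argument could be run. The generators
  are therefore made to act on residue classes by left multiplication, and the presentation theorem
  is proved for any action on any type that satisfies the Coxeter relations. The rewriting takes
  place in the product of this action with the action by signed permutations: one computation gives
  a single normal form valid in both components, and the second component identifies it. Since the
  left action of the quotient on itself is faithful, the outcome is again a congruence. Type D is
  exceptional at the end of the chain: its last reflection moves both e_{n-1} and e_n, so the
  stabilizer of e_1, ..., e_{n-1} is already trivial.\<close>

lemma scal_simps:
  "scal 0 = 0" "scal 1 = 1" "scal (c + d) = scal c + scal d" "scal (c * d) = scal c * scal d"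
  by (simp_all add: scal_def single_add mult_single)

lemma scal_commute: "scal c * p = p * (scal c :: 'g ncpoly)"
proof (rule poly_mapping_eqI)
  fix w
  have l: "Poly_Mapping.lookup (scal c * p) w = c * Poly_Mapping.lookup p w"
    unfolding scal_def mult_map_scale_conv_mult[symmetric]
    by (simp add: Poly_Mapping.map.rep_eq when_def)
  have "Poly_Mapping.lookup (p * scal c) w
      = (\<Sum>a. Poly_Mapping.lookup p a * (\<Sum>b. Poly_Mapping.lookup (scal c) b when w = a + b))"
    by (simp add: lookup_mult)
  also have "\<dots> = (\<Sum>a. Poly_Mapping.lookup p a * (c when w = a))"
  proof (rule arg_cong[where f = Sum_any], rule ext)
    fix a
    \<comment> \<open>Only the empty word carries a coefficient of \<open>scal c\<close>, so the
      inner sum reduces to \<open>b = 0\<close>.\<close>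
    have "(\<lambda>b. Poly_Mapping.lookup (scal c) b when w = a + b)
        = (\<lambda>b. (c when w = a) when b = 0)"
      by (auto simp: scal_def lookup_single when_def fun_eq_iff)
    then show "Poly_Mapping.lookup p a * (\<Sum>b. Poly_Mapping.lookup (scal c) b when w = a + b)
        = Poly_Mapping.lookup p a * (c when w = a)"
      by (simp only: Sum_any_when_equal)
  qed
  also have "\<dots> = Poly_Mapping.lookup p w * c"
    by (simp add: mult_when)
  finally show "Poly_Mapping.lookup (scal c * p) w = Poly_Mapping.lookup (p * scal c) w"
    using l by (simp add: mult.commute)
qed

lemma prod_list_gen: "prod_list (map gen xs) = Poly_Mapping.single (FWord xs) 1"
  by (induction xs)
     (simp_all add: gen_def mult_single plus_fword_def flip: zero_fword_def)

lemma single_eq_word: "Poly_Mapping.single w c = scal c * prod_list (map gen (letters w))"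
  by (cases w) (simp add: prod_list_gen scal_def mult_single)

lemma single_induct [case_names single add]:
  fixes p :: "'g ncpoly"
  assumes "\<And>w c. P (Poly_Mapping.single w c)" "\<And>p q. P p \<Longrightarrow> P q \<Longrightarrow> P (p + q)"
  shows "P p"
proof (induction p rule: update_induct)
  case const
  show ?case using assms(1)[of 0 0] by simp
next
  case (update p w c)
  have "Poly_Mapping.update w c p = p + Poly_Mapping.single w c"
    using update(1)
    by (intro poly_mapping_eqI)
       (auto simp: lookup_update lookup_add lookup_single when_def in_keys_iff)
  then show ?case using update(3) assms by simp
qed

lemma ncpoly_induct [case_names scal gen add mult]:
  fixes p :: "'g ncpoly"
  assumes scal: "\<And>c. P (scal c)" and gen: "\<And>g. P (gen g)"
    and add: "\<And>p q. P p \<Longrightarrow> P q \<Longrightarrow> P (p + q)" and mult: "\<And>p q. P p \<Longrightarrow> P q \<Longrightarrow> P (p * q)"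
  shows "P p"
proof -
  have word: "P (prod_list (map gen xs))" for xs :: "'g list"
  proof (induction xs)
    case Nil
    show ?case using scal[of 1] by (simp add: scal_simps)
  qed (simp add: gen mult)
  show ?thesis
    by (induction p rule: single_induct) (simp_all add: single_eq_word scal add mult word)
qed

text \<open>Fixing the scalars replaces linearity and the unit law: both follow from it together
  with multiplicativity.\<close>

definition alg_hom :: "('g ncpoly \<Rightarrow> 'h ncpoly) \<Rightarrow> bool" where
  "alg_hom \<phi> \<longleftrightarrow> (\<forall>p q. \<phi> (p + q) = \<phi> p + \<phi> q) \<and> (\<forall>p q. \<phi> (p * q) = \<phi> p * \<phi> q) \<and>
     (\<forall>c. \<phi> (scal c) = scal c)"

text \<open>The universal property of the free algebra, with images prescribed for all letters of
  the type.\<close>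

definition subst :: "('g \<Rightarrow> 'h ncpoly) \<Rightarrow> 'g ncpoly \<Rightarrow> 'h ncpoly" where
  "subst f p = (\<Sum>w\<in>Poly_Mapping.keys p.
     scal (Poly_Mapping.lookup p w) * prod_list (map f (letters w)))"

text \<open>Cancellation may make the support of a sum smaller than the union of the supports;
  additivity therefore needs one common index set.\<close>

lemma subst_superset:
  assumes "finite S" "Poly_Mapping.keys p \<subseteq> S"
  shows "subst f p = (\<Sum>w\<in>S. scal (Poly_Mapping.lookup p w) * prod_list (map f (letters w)))"
  unfolding subst_def using assms
  by (intro sum.mono_neutral_left) (auto simp: in_keys_iff scal_simps)

lemma subst_add: "subst f (p + q) = subst f p + subst f q"
proof -
  let ?S = "Poly_Mapping.keys p \<union> Poly_Mapping.keys q"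
  have "finite ?S" "Poly_Mapping.keys (p + q) \<subseteq> ?S"
    using keys_add[of p q] by auto
  then show ?thesis
    by (simp add: subst_superset[of ?S] lookup_add scal_simps distrib_right sum.distrib)
qed

lemma subst_single: "subst f (Poly_Mapping.single w c) = scal c * prod_list (map f (letters w))"
  by (subst subst_superset[of "{w}"]) auto

lemma subst_gen [simp]: "subst f (gen g) = f g"
  by (simp add: gen_def subst_single scal_simps)

lemma subst_scal [simp]: "subst f (scal c) = scal c"
  by (simp add: scal_def subst_single) (simp add: scal_def zero_fword_def)

lemma subst_mult: "subst f (p * q) = subst f p * subst f q"
proof (induction p rule: single_induct)
  case (single w c)
  show ?case
  proof (induction q rule: single_induct)
    case (single w' d)
    have "scal c * A * (scal d * B) = scal (c * d) * (A * B)" for A B :: "'a ncpoly"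
      by (metis (no_types) mult.assoc scal_commute scal_simps(4))
    then show ?case
      by (simp add: mult_single subst_single plus_fword_def)
  qed (simp add: subst_add distrib_left)
qed (simp add: subst_add distrib_right)

lemma alg_hom_subst: "alg_hom (subst f)"
  by (simp add: alg_hom_def subst_add subst_mult)

lemma alg_hom_comp: "alg_hom \<phi> \<Longrightarrow> alg_hom \<psi> \<Longrightarrow> alg_hom (\<lambda>p. \<psi> (\<phi> p))"
  by (simp add: alg_hom_def)

context
  fixes \<phi> :: "'g ncpoly \<Rightarrow> 'h ncpoly"
  assumes hom: "alg_hom \<phi>"
begin

lemma alg_hom_simps:
  "\<phi> (p + q) = \<phi> p + \<phi> q" "\<phi> (p * q) = \<phi> p * \<phi> q" "\<phi> (scal c) = scal c"
  "\<phi> 0 = 0" "\<phi> 1 = 1" "\<phi> (- p) = - \<phi> p" "\<phi> (p - q) = \<phi> p - \<phi> q"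
proof -
  show *: "\<phi> (p + q) = \<phi> p + \<phi> q" "\<phi> (p * q) = \<phi> p * \<phi> q" "\<phi> (scal c) = scal c" for p q
    using hom by (auto simp: alg_hom_def)
  show "\<phi> 0 = 0" "\<phi> 1 = 1"
    using hom scal_simps(1,2) by (metis alg_hom_def)+
  then show m: "\<phi> (- p) = - \<phi> p" for p
    using *(1)[of p "- p"] by (simp add: eq_neg_iff_add_eq_0 add.commute)
  show "\<phi> (p - q) = \<phi> p - \<phi> q"
    using *(1)[of p "- q"] m by simp
qed

lemma alg_hom_sum: "\<phi> (sum f A) = (\<Sum>a\<in>A. \<phi> (f a))"
  by (induction A rule: infinite_finite_induct) (simp_all add: alg_hom_simps)

lemma alg_hom_power: "\<phi> (p ^ k) = \<phi> p ^ k"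
  by (induction k) (simp_all add: alg_hom_simps)

lemma alg_hom_prod_list: "\<phi> (prod_list xs) = prod_list (map \<phi> xs)"
  by (induction xs) (simp_all add: alg_hom_simps)

lemma alg_hom_comm: "\<phi> (comm p q) = comm (\<phi> p) (\<phi> q)"
  by (simp add: comm_def alg_hom_simps)

lemma alg_hom_signed_ext: "\<phi> (signed_ext f k) = signed_ext (\<lambda>i. \<phi> (f i)) k"
  by (simp add: signed_ext_def alg_hom_simps)

text \<open>The lifted reflections are products of powers of \<open>e\<close> and of values of
  \<open>t\<close>, hence natural under homomorphisms. The next three lemmas have the same
  reason.\<close>

lemma alg_hom_brk: "\<phi> (brk e t i j) = brk (\<phi> e) (\<lambda>i. \<phi> (t i)) i j"
  by (simp add: brk_def Let_def up_def down_def alg_hom_simps alg_hom_power alg_hom_prod_list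
    comp_def)

lemma alg_hom_brk_bar_D: "\<phi> (brk_bar_D e t n i j) = brk_bar_D (\<phi> e) (\<lambda>i. \<phi> (t i)) n i j"
  by (simp add: brk_bar_D_def Let_def up_def down_def alg_hom_simps alg_hom_power
    alg_hom_prod_list comp_def)

lemma alg_hom_brk_bar_B: "\<phi> (brk_bar_B e t n i j) = brk_bar_B (\<phi> e) (\<lambda>i. \<phi> (t i)) n i j"
  by (simp add: brk_bar_B_def Let_def up_def down_def alg_hom_simps alg_hom_power
    alg_hom_prod_list comp_def)

lemma alg_hom_brk_single: "\<phi> (brk_single e t n i) = brk_single (\<phi> e) (\<lambda>i. \<phi> (t i)) n i"
  by (simp add: brk_single_def Let_def up_def down_def alg_hom_simps alg_hom_power
    alg_hom_prod_list comp_def)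

lemmas alg_hom_rules = alg_hom_simps alg_hom_sum alg_hom_power alg_hom_comm alg_hom_signed_ext
  alg_hom_brk alg_hom_brk_bar_D alg_hom_brk_bar_B alg_hom_brk_single

end

section \<open>Congruence modulo a two-sided ideal\<close>

text \<open>A type class counterpart of \<open>Idl\<close>, whose induction rule follows the way
  elements are built from the generators. Negatives come from multiplication by \<open>- 1\<close>.
  The two notions are matched in \<open>realizes_quot\<close>.\<close>

inductive_set two_sided :: "'a::ring_1 set \<Rightarrow> 'a set" for X where
  zero: "0 \<in> two_sided X"
| base: "x \<in> X \<Longrightarrow> x \<in> two_sided X"
| add: "x \<in> two_sided X \<Longrightarrow> y \<in> two_sided X \<Longrightarrow> x + y \<in> two_sided X"
| lmult: "x \<in> two_sided X \<Longrightarrow> a * x \<in> two_sided X"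
| rmult: "x \<in> two_sided X \<Longrightarrow> x * a \<in> two_sided X"

lemma two_sided_uminus: "x \<in> two_sided X \<Longrightarrow> - x \<in> two_sided X"
  using two_sided.lmult[of x X "- 1"] by simp

lemma two_sided_diff: "x \<in> two_sided X \<Longrightarrow> y \<in> two_sided X \<Longrightarrow> x - y \<in> two_sided X"
  using two_sided.add two_sided_uminus by fastforce

definition eqm :: "'a::ring_1 set \<Rightarrow> 'a \<Rightarrow> 'a \<Rightarrow> bool" where
  "eqm X a b \<longleftrightarrow> a - b \<in> two_sided X"

lemma eqm_refl [simp]: "eqm X a a"
  by (simp add: eqm_def two_sided.zero)

lemma eqm_sym: "eqm X a b \<Longrightarrow> eqm X b a"
  using two_sided_uminus unfolding eqm_def by fastforce

lemma eqm_trans [trans]: "eqm X a b \<Longrightarrow> eqm X b c \<Longrightarrow> eqm X a c"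
  using two_sided.add unfolding eqm_def by fastforce

lemma eqm_add: "eqm X a b \<Longrightarrow> eqm X c d \<Longrightarrow> eqm X (a + c) (b + d)"
  using two_sided.add unfolding eqm_def by (fastforce simp: algebra_simps)

lemma eqm_uminus: "eqm X a b \<Longrightarrow> eqm X (- a) (- b)"
  using two_sided_uminus unfolding eqm_def by fastforce

lemma eqm_diff: "eqm X a b \<Longrightarrow> eqm X c d \<Longrightarrow> eqm X (a - c) (b - d)"
  using eqm_add[of X a b "- c" "- d"] eqm_uminus by auto

lemma eqm_mult: "eqm X a b \<Longrightarrow> eqm X c d \<Longrightarrow> eqm X (a * c) (b * d)"
proof -
  assume "eqm X a b" "eqm X c d"
  then have "(a - b) * c + b * (c - d) \<in> two_sided X"
    unfolding eqm_def by (intro two_sided.add two_sided.rmult two_sided.lmult)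
  then show ?thesis by (simp add: eqm_def algebra_simps)
qed

lemma eqm_sum: "(\<And>a. a \<in> A \<Longrightarrow> eqm X (f a) (g a)) \<Longrightarrow> eqm X (sum f A) (sum g A)"
  by (induction A rule: infinite_finite_induct) (simp_all add: eqm_add)

lemma eqm_base: "a - b \<in> X \<Longrightarrow> eqm X a b"
  by (simp add: eqm_def two_sided.base)

lemma eqm_zero_iff: "eqm X a 0 \<longleftrightarrow> a \<in> two_sided X"
  by (simp add: eqm_def)

text \<open>The preimage of a two-sided ideal under a homomorphism is a two-sided ideal, so it is
  enough to test the generators.\<close>

lemma alg_hom_eqm:
  fixes \<phi> :: "'g ncpoly \<Rightarrow> 'h ncpoly"
  assumes "alg_hom \<phi>" "\<And>x. x \<in> X \<Longrightarrow> eqm Y (\<phi> x) 0" "eqm X p q"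
  shows "eqm Y (\<phi> p) (\<phi> q)"
proof -
  have "\<phi> x \<in> two_sided Y" if "x \<in> two_sided X" for x
    using that
    by induction
      (use assms in \<open>auto simp: alg_hom_simps eqm_zero_iff intro: two_sided.intros\<close>)
  then show ?thesis
    using assms(3) by (metis eqm_def alg_hom_simps(7)[OF assms(1)])
qed

text \<open>Used to see that two substitutions are mutually inverse by looking at single
  letters.\<close>

lemma alg_hom_eqm_gen:
  assumes "alg_hom \<phi>" "alg_hom \<psi>" "\<And>g. eqm X (\<phi> (gen g)) (\<psi> (gen g))"
  shows "eqm X (\<phi> p) (\<psi> p)"
  by (induction p rule: ncpoly_induct)
     (use assms in \<open>auto simp: alg_hom_simps intro: eqm_add eqm_mult\<close>)

text \<open>Left multiplication on residue classes turns congruences between monomials into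
  equations between functions, which can be used for rewriting.\<close>

definition residue :: "'a::ring_1 set \<Rightarrow> 'a \<Rightarrow> 'a set" where
  "residue X p = {q. eqm X q p}"

definition lact :: "'a::ring_1 set \<Rightarrow> 'a \<Rightarrow> 'a set \<Rightarrow> 'a set" where
  "lact X a C = (if C \<in> range (residue X) then residue X (a * (SOME p. C = residue X p)) else C)"

lemma residue_eq_iff: "residue X p = residue X q \<longleftrightarrow> eqm X p q"
  unfolding residue_def using eqm_sym eqm_trans eqm_refl by blast

lemma lact_residue: "lact X a (residue X p) = residue X (a * p)"
proof -
  let ?q = "SOME q. residue X p = residue X q"
  have "residue X p = residue X ?q"
    by (rule someI) (rule refl)
  then show ?thesis
    by (simp add: lact_def residue_eq_iff eqm_mult eqm_sym)
qed

text \<open>The default value matters: with all other sets left fixed, \<open>lact\<close> respects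
  products and the unit on the whole type, as \<open>coxeter_action\<close> demands.\<close>

lemma lact_other: "C \<notin> range (residue X) \<Longrightarrow> lact X a C = C"
  by (simp add: lact_def)

lemma lact_mult: "lact X (a * b) C = lact X a (lact X b C)"
  by (cases "C \<in> range (residue X)") (auto simp: lact_residue lact_other mult.assoc)

lemma lact_one [simp]: "lact X 1 C = C"
  by (cases "C \<in> range (residue X)") (auto simp: lact_residue lact_other)

text \<open>The left regular representation of the quotient is faithful: apply both operators to the
  class of 1.\<close>

lemma eqm_iff_lact: "eqm X a b \<longleftrightarrow> (\<forall>C. lact X a C = lact X b C)"
proof
  assume "eqm X a b"
  then show "\<forall>C. lact X a C = lact X b C"
    by (auto simp: lact_def residue_eq_iff intro: eqm_mult)
next
  assume "\<forall>C. lact X a C = lact X b C"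
  then have "lact X a (residue X 1) = lact X b (residue X 1)" by simp
  then show "eqm X a b" by (simp add: lact_residue residue_eq_iff)
qed

section \<open>Algebras realized as quotients of free algebras\<close>

text \<open>Here \<open>\<pi>\<close> is a surjective algebra homomorphism from the free algebra on
  the whole type, and its kernel is the ideal generated by \<open>X\<close>. All later arguments see
  the coset constructions only through this interface.\<close>

definition realizes :: "(complex, 'b) module \<Rightarrow> ('g ncpoly \<Rightarrow> 'b) \<Rightarrow> 'g ncpoly set \<Rightarrow> bool" where
  "realizes A \<pi> X \<longleftrightarrow> range \<pi> = carrier A \<and> \<pi> 0 = \<zero>\<^bsub>A\<^esub> \<and> \<pi> 1 = \<one>\<^bsub>A\<^esub> \<and>
    (\<forall>p q. \<pi> (p + q) = \<pi> p \<oplus>\<^bsub>A\<^esub> \<pi> q) \<and> (\<forall>p q. \<pi> (p * q) = \<pi> p \<otimes>\<^bsub>A\<^esub> \<pi> q) \<and>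
    (\<forall>c p. \<pi> (scal c * p) = c \<odot>\<^bsub>A\<^esub> \<pi> p) \<and> (\<forall>p q. \<pi> p = \<pi> q \<longleftrightarrow> eqm X p q)"

text \<open>Because \<open>\<psi>\<close> undoes \<open>\<phi>\<close> modulo \<open>X\<close>, the
  map \<open>\<phi>\<close> reflects congruence as well as preserving it. This makes the induced map
  well defined and injective; the other composite makes it surjective.\<close>

lemma realizes_iso:
  fixes A :: "(complex, 'a) module" and B :: "(complex, 'b) module"
    and \<phi> :: "'g ncpoly \<Rightarrow> 'h ncpoly"
  assumes A: "realizes A \<pi> X" and B: "realizes B \<pi>' Y"
    and hom: "alg_hom \<phi>" "alg_hom \<psi>"
    and \<phi>: "\<And>x. x \<in> X \<Longrightarrow> eqm Y (\<phi> x) 0" and \<psi>: "\<And>y. y \<in> Y \<Longrightarrow> eqm X (\<psi> y) 0"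
    and \<psi>\<phi>: "\<And>g. eqm X (\<psi> (\<phi> (gen g))) (gen g)" and \<phi>\<psi>: "\<And>h. eqm Y (\<phi> (\<psi> (gen h))) (gen h)"
  shows "algebra_isomorphic A B"
proof -
  have id: "alg_hom (\<lambda>p :: 'k ncpoly. p)" by (simp add: alg_hom_def)
  have \<psi>\<phi>': "eqm X (\<psi> (\<phi> p)) p" for p
    using alg_hom_eqm_gen[OF alg_hom_comp[OF hom] id] \<psi>\<phi> by blast
  have \<phi>\<psi>': "eqm Y (\<phi> (\<psi> p)) p" for p
    using alg_hom_eqm_gen[OF alg_hom_comp[OF hom(2,1)] id] \<phi>\<psi> by blast
  have iff: "eqm X p q \<longleftrightarrow> eqm Y (\<phi> p) (\<phi> q)" for p q
  proof
    assume "eqm Y (\<phi> p) (\<phi> q)"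
    then have "eqm X (\<psi> (\<phi> p)) (\<psi> (\<phi> q))"
      using alg_hom_eqm[OF hom(2), of Y X] \<psi> by blast
    then show "eqm X p q"
      using \<psi>\<phi>' eqm_sym eqm_trans by metis
  qed (use alg_hom_eqm[OF hom(1), of X Y] \<phi> in blast)
  \<comment> \<open>An arbitrary preimage is chosen; by \<open>iff\<close> the value does not depend
    on it.\<close>
  define f where "f a = \<pi>' (\<phi> (SOME p. \<pi> p = a))" for a
  have f: "f (\<pi> p) = \<pi>' (\<phi> p)" for p
  proof -
    have "\<pi> (SOME q. \<pi> q = \<pi> p) = \<pi> p" by (rule someI) (rule refl)
    then show ?thesis using A B iff by (simp add: f_def realizes_def)
  qed
  have carA: "carrier A = range \<pi>" and carB: "carrier B = range \<pi>'"
    using A B by (auto simp: realizes_def)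
  note simps = f alg_hom_simps[OF hom(1)]
  have "f \<in> ring_iso A B"
  proof (rule ring_iso_memI)
    have "inj_on f (carrier A)"
      using A B by (auto simp: inj_on_def carA f realizes_def iff)
    moreover have "f ` carrier A = carrier B"
    proof (intro equalityI subsetI)
      fix b assume "b \<in> carrier B"
      then obtain q where "b = \<pi>' q" by (auto simp: carB)
      then have "b = f (\<pi> (\<psi> q))"
        using \<phi>\<psi>' B by (simp add: f realizes_def eqm_sym)
      then show "b \<in> f ` carrier A" by (simp add: carA)
    qed (auto simp: carA carB f)
    ultimately show "bij_betw f (carrier A) (carrier B)" by (simp add: bij_betw_def)
  next
    fix a b assume "a \<in> carrier A" "b \<in> carrier A"
    then obtain p q where "a = \<pi> p" "b = \<pi> q" by (auto simp: carA)
    moreover have "f (\<pi> p \<otimes>\<^bsub>A\<^esub> \<pi> q) = f (\<pi> p) \<otimes>\<^bsub>B\<^esub> f (\<pi> q)" "f (\<pi> p \<oplus>\<^bsub>A\<^esub> \<pi> q)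
      = f (\<pi> p) \<oplus>\<^bsub>B\<^esub> f (\<pi> q)"
    proof -
      have "\<pi> p \<otimes>\<^bsub>A\<^esub> \<pi> q = \<pi> (p * q)" "\<pi> p \<oplus>\<^bsub>A\<^esub> \<pi> q = \<pi> (p + q)"
        using A by (simp_all add: realizes_def)
      then show "f (\<pi> p \<otimes>\<^bsub>A\<^esub> \<pi> q) = f (\<pi> p) \<otimes>\<^bsub>B\<^esub> f (\<pi> q)" "f (\<pi> p \<oplus>\<^bsub>A\<^esub> \<pi> q) = f (\<pi> p) \<oplus>\<^bsub>B\<^esub> f (\<pi> q)"
        using B by (simp_all only: simps) (simp_all add: realizes_def)
    qed
    ultimately show "f (a \<otimes>\<^bsub>A\<^esub> b) = f a \<otimes>\<^bsub>B\<^esub> f b" "f (a \<oplus>\<^bsub>A\<^esub> b) = f a \<oplus>\<^bsub>B\<^esub> f b" by auto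
  next
    fix a assume "a \<in> carrier A"
    then show "f a \<in> carrier B" by (auto simp: carA carB f)
  next
    have "\<one>\<^bsub>A\<^esub> = \<pi> 1" using A by (simp add: realizes_def)
    then show "f \<one>\<^bsub>A\<^esub> = \<one>\<^bsub>B\<^esub>"
      using B by (simp add: simps) (simp add: realizes_def)
  qed
  moreover have "f (c \<odot>\<^bsub>A\<^esub> a) = c \<odot>\<^bsub>B\<^esub> f a" if "a \<in> carrier A" for c a
  proof -
    obtain p where p: "a = \<pi> p" using \<open>a \<in> carrier A\<close> by (auto simp: carA)
    have "c \<odot>\<^bsub>A\<^esub> \<pi> p = \<pi> (scal c * p)" using A unfolding realizes_def by metis
    then have "f (c \<odot>\<^bsub>A\<^esub> \<pi> p) = \<pi>' (scal c * \<phi> p)" by (simp only: simps)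
    also have "\<dots> = c \<odot>\<^bsub>B\<^esub> \<pi>' (\<phi> p)" using B unfolding realizes_def by metis
    finally show ?thesis by (simp only: p f)
  qed
  ultimately show ?thesis
    unfolding algebra_isomorphic_def by blast
qed

lemma realizes_ring:
  assumes "realizes A \<pi> X"
  shows "ring A"
proof -
  have car: "carrier A = range \<pi>" and
    eqs: "\<And>p q. \<pi> p \<oplus>\<^bsub>A\<^esub> \<pi> q = \<pi> (p + q)" "\<And>p q. \<pi> p \<otimes>\<^bsub>A\<^esub> \<pi> q = \<pi> (p * q)"
    "\<zero>\<^bsub>A\<^esub> = \<pi> 0" "\<one>\<^bsub>A\<^esub> = \<pi> 1"
    using assms by (auto simp: realizes_def)
  show ?thesis
  proof (rule ringI)
    show "abelian_group A"
    proof (rule abelian_groupI)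
      fix x assume "x \<in> carrier A"
      then obtain p where "x = \<pi> p" by (auto simp: car)
      then have "\<pi> (- p) \<oplus>\<^bsub>A\<^esub> x = \<zero>\<^bsub>A\<^esub>" by (simp add: eqs)
      then show "\<exists>y\<in>carrier A. y \<oplus>\<^bsub>A\<^esub> x = \<zero>\<^bsub>A\<^esub>" by (auto simp: car)
    qed (auto simp: car eqs ac_simps)
    show "Group.monoid A"
      by (rule monoidI) (auto simp: car eqs mult.assoc)
  qed (auto simp: car eqs algebra_simps)
qed

lemma realizes_minus:
  assumes "realizes A \<pi> X"
  shows "\<pi> (p - q) = \<pi> p \<ominus>\<^bsub>A\<^esub> \<pi> q"
proof -
  interpret ring A by (rule realizes_ring[OF assms])
  have "\<pi> p \<in> carrier A" for p using assms by (auto simp: realizes_def)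
  moreover have "\<pi> p = \<pi> (p - q) \<oplus>\<^bsub>A\<^esub> \<pi> q"
    using assms unfolding realizes_def by (metis diff_add_cancel)
  ultimately show ?thesis
    by (simp add: a_minus_def a_assoc r_neg)
qed

lemma quot_algebra_simps:
  "carrier (quot_algebra A I) = a_rcosets\<^bsub>A\<^esub> I" "mult (quot_algebra A I) = rcoset_mult A I"
  "one (quot_algebra A I) = I +>\<^bsub>A\<^esub> \<one>\<^bsub>A\<^esub>" "zero (quot_algebra A I) = I"
  "add (quot_algebra A I) = set_add A"
  "smult (quot_algebra A I) = (\<lambda>c C. \<Union>a\<in>C. I +>\<^bsub>A\<^esub> (c \<odot>\<^bsub>A\<^esub> a))"
  by (simp_all add: quot_algebra_def FactRing_def ring.defs module.defs)

text \<open>An iterated quotient is a single quotient by the union of the generators. The lemma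
  serves twice: to impose the defining relations on a free algebra, and to specialize z
  afterwards.\<close>

lemma realizes_quot:
  assumes A: "realizes A \<pi> X"
  shows "realizes (quot_algebra A (Idl\<^bsub>A\<^esub> (\<pi> ` Q))) (\<lambda>p. Idl\<^bsub>A\<^esub> (\<pi> ` Q) +>\<^bsub>A\<^esub> \<pi> p) (X \<union> Q)"
proof -
  interpret ring A by (rule realizes_ring[OF A])
  let ?I = "Idl\<^bsub>A\<^esub> (\<pi> ` Q)"
  have car: "carrier A = range \<pi>" and
    eqs: "\<And>p q. \<pi> (p + q) = \<pi> p \<oplus>\<^bsub>A\<^esub> \<pi> q" "\<And>p q. \<pi> (p * q) = \<pi> p \<otimes>\<^bsub>A\<^esub> \<pi> q"
    "\<pi> 0 = \<zero>\<^bsub>A\<^esub>" "\<pi> 1 = \<one>\<^bsub>A\<^esub>" "\<And>c p. \<pi> (scal c * p) = c \<odot>\<^bsub>A\<^esub> \<pi> p"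
    and ker: "\<And>p q. \<pi> p = \<pi> q \<longleftrightarrow> eqm X p q"
    using A by (auto simp: realizes_def)
  have in_car [simp]: "\<pi> p \<in> carrier A" for p by (simp add: car)
  have Q: "\<pi> ` Q \<subseteq> carrier A" by auto
  interpret I: ideal ?I A by (rule genideal_ideal[OF Q])
  have mono: "two_sided X \<subseteq> two_sided (X \<union> Q)"
    by (rule subsetI, erule two_sided.induct) (auto intro: two_sided.intros)
  have zero_iff: "\<pi> p \<in> ?I \<longleftrightarrow> p \<in> two_sided (X \<union> Q)" for p
  proof
    assume "p \<in> two_sided (X \<union> Q)"
    then show "\<pi> p \<in> ?I"
    proof induction
      case (base x)
      then show ?case
      proof
        assume "x \<in> X"
        then have "\<pi> x = \<pi> 0" using ker eqm_base[of x 0 X] by simp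
        then show ?thesis by (simp add: eqs)
      next
        assume "x \<in> Q"
        then show ?thesis using genideal_self[OF Q] by blast
      qed
    qed (auto simp: eqs I.I_l_closed I.I_r_closed)
  next
    \<comment> \<open>Minimality of \<open>Idl\<close> gives the converse, once the image of the
      concrete ideal is known to be an ideal of \<open>A\<close>.\<close>
    have "ideal (\<pi> ` two_sided (X \<union> Q)) A"
    proof (rule idealI)
      show "subgroup (\<pi> ` two_sided (X \<union> Q)) (add_monoid A)"
      proof (rule add.subgroupI)
        fix a assume "a \<in> \<pi> ` two_sided (X \<union> Q)"
        then obtain p where p: "a = \<pi> p" "p \<in> two_sided (X \<union> Q)" by auto
        have "\<ominus>\<^bsub>A\<^esub> a = \<pi> (- p)"
          using realizes_minus[OF A, of 0 p] by (simp add: p eqs a_minus_def)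
        then show "\<ominus>\<^bsub>A\<^esub> a \<in> \<pi> ` two_sided (X \<union> Q)"
          using p two_sided_uminus by blast
      qed (auto simp: eqs(1)[symmetric] intro: two_sided.intros)
    qed (auto simp: car eqs(2)[symmetric] intro: two_sided.intros realizes_ring[OF A])
    moreover have "\<pi> ` Q \<subseteq> \<pi> ` two_sided (X \<union> Q)" by (auto intro: two_sided.base)
    ultimately have "?I \<subseteq> \<pi> ` two_sided (X \<union> Q)" by (rule genideal_minimal)
    moreover assume "\<pi> p \<in> ?I"
    ultimately obtain q where "\<pi> p = \<pi> q" "q \<in> two_sided (X \<union> Q)" by auto
    then show "p \<in> two_sided (X \<union> Q)"
      using ker mono two_sided.add[of "p - q" "X \<union> Q" q] by (auto simp: eqm_def)
  qed
  have coset_iff: "?I +>\<^bsub>A\<^esub> a = ?I +>\<^bsub>A\<^esub> b \<longleftrightarrow> a \<ominus>\<^bsub>A\<^esub> b \<in> ?I"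
    if "a \<in> carrier A" "b \<in> carrier A" for a b
    using quotient_eq_iff_same_a_r_cos[OF I.ideal_axioms that] by simp
  show ?thesis
    unfolding realizes_def quot_algebra_simps
  proof (intro conjI allI)
    show "range (\<lambda>p. ?I +>\<^bsub>A\<^esub> \<pi> p) = a_rcosets\<^bsub>A\<^esub> ?I"
      by (auto simp: A_RCOSETS_def' car a_r_coset_def')
    show "?I +>\<^bsub>A\<^esub> \<pi> 0 = ?I" by (simp add: eqs I.a_subset)
    show "?I +>\<^bsub>A\<^esub> \<pi> 1 = ?I +>\<^bsub>A\<^esub> \<one>\<^bsub>A\<^esub>" by (simp add: eqs)
    fix p q
    show "?I +>\<^bsub>A\<^esub> \<pi> (p + q) = (?I +>\<^bsub>A\<^esub> \<pi> p) <+>\<^bsub>A\<^esub> (?I +>\<^bsub>A\<^esub> \<pi> q)"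
      by (simp add: eqs I.a_rcos_sum)
    show "?I +>\<^bsub>A\<^esub> \<pi> (p * q) = [mod ?I:] (?I +>\<^bsub>A\<^esub> \<pi> p) \<Otimes>\<^bsub>A\<^esub> (?I +>\<^bsub>A\<^esub> \<pi> q)"
      by (simp add: eqs I.rcoset_mult_add)
    show "(?I +>\<^bsub>A\<^esub> \<pi> p = ?I +>\<^bsub>A\<^esub> \<pi> q) = eqm (X \<union> Q) p q"
      by (simp add: coset_iff eqm_def zero_iff flip: realizes_minus[OF A])
    fix c
    \<comment> \<open>The scalar action on cosets is a union over all representatives; all members
      of this union turn out to be the same coset.\<close>
    have "?I +>\<^bsub>A\<^esub> (c \<odot>\<^bsub>A\<^esub> a) = ?I +>\<^bsub>A\<^esub> (c \<odot>\<^bsub>A\<^esub> \<pi> p)" if a: "a \<in> ?I +>\<^bsub>A\<^esub> \<pi> p" for a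
    proof -
      have "a \<in> carrier A"
        using a I.a_subset a_r_coset_subset_G[of ?I "\<pi> p"] by auto
      then obtain q where q: "a = \<pi> q" by (auto simp: car)
      have "?I +>\<^bsub>A\<^esub> \<pi> p = ?I +>\<^bsub>A\<^esub> \<pi> q"
        using a q a_repr_independence[of a ?I "\<pi> p"] I.a_subgroup by simp
      then have "q - p \<in> two_sided (X \<union> Q)"
        by (simp add: coset_iff zero_iff two_sided_diff eqm_def flip: realizes_minus[OF A])
           (metis minus_diff_eq two_sided_uminus)
      then have "scal c * q - scal c * p \<in> two_sided (X \<union> Q)"
        by (metis right_diff_distrib two_sided.lmult)
      then show ?thesis
        by (simp add: q coset_iff zero_iff flip: eqs(5) realizes_minus[OF A])
    qed
    moreover have "\<pi> p \<in> ?I +>\<^bsub>A\<^esub> \<pi> p" by (simp add: I.a_rcos_self)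
    ultimately have "(\<Union>a\<in>?I +>\<^bsub>A\<^esub> \<pi> p. ?I +>\<^bsub>A\<^esub> (c \<odot>\<^bsub>A\<^esub> a)) = ?I +>\<^bsub>A\<^esub> (c \<odot>\<^bsub>A\<^esub> \<pi> p)"
      by blast
    then show "?I +>\<^bsub>A\<^esub> \<pi> (scal c * p) = (\<Union>a\<in>?I +>\<^bsub>A\<^esub> \<pi> p. ?I +>\<^bsub>A\<^esub> (c \<odot>\<^bsub>A\<^esub> a))"
      by (simp only: eqs(5))
  qed
qed

text \<open>The projection of the full free algebra onto the subalgebra of words over
  \<open>G\<close>.\<close>

definition retract :: "'g set \<Rightarrow> 'g ncpoly \<Rightarrow> 'g ncpoly" where
  "retract G = subst (\<lambda>g. if g \<in> G then gen g else 0)"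

lemma alg_hom_retract: "alg_hom (retract G)"
  by (simp add: retract_def alg_hom_subst)

lemma free_algebra_closed:
  "scal c \<in> carrier (free_algebra G)"
  "0 \<in> carrier (free_algebra G)"
  "1 \<in> carrier (free_algebra G)"
  "g \<in> G \<Longrightarrow> gen g \<in> carrier (free_algebra G)"
  "p \<in> carrier (free_algebra G) \<Longrightarrow> q \<in> carrier (free_algebra G) \<Longrightarrow> p + q \<in> carrier (free_algebra G)"
  "p \<in> carrier (free_algebra G) \<Longrightarrow> - p \<in> carrier (free_algebra G)"
  "p \<in> carrier (free_algebra G) \<Longrightarrow> q \<in> carrier (free_algebra G) \<Longrightarrow> p - q \<in> carrier (free_algebra G)"
  "p \<in> carrier (free_algebra G) \<Longrightarrow> q \<in> carrier (free_algebra G) \<Longrightarrow> p * q \<in> carrier (free_algebra G)"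
proof -
  have keys_uminus: "Poly_Mapping.keys (- r) = Poly_Mapping.keys r" for r :: "'g ncpoly"
    by (auto simp: in_keys_iff)
  show "scal c \<in> carrier (free_algebra G)" "0 \<in> carrier (free_algebra G)" "1 \<in> carrier
    (free_algebra G)"
    "g \<in> G \<Longrightarrow> gen g \<in> carrier (free_algebra G)"
    by (auto simp: free_algebra_def scal_def gen_def zero_fword_def)
  show add: "p + q \<in> carrier (free_algebra G)"
    if "p \<in> carrier (free_algebra G)" "q \<in> carrier (free_algebra G)" for p q
    using that keys_add[of p q] by (auto simp: free_algebra_def)
  show minus: "- p \<in> carrier (free_algebra G)" if "p \<in> carrier (free_algebra G)" for p
    using that by (auto simp: free_algebra_def keys_uminus)
  show "p \<in> carrier (free_algebra G) \<Longrightarrow> q \<in> carrier (free_algebra G) \<Longrightarrow>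
    p - q \<in> carrier (free_algebra G)"
    using add minus by fastforce
  assume p: "p \<in> carrier (free_algebra G)" and q: "q \<in> carrier (free_algebra G)"
  have "set (letters w) \<subseteq> G" if w: "w \<in> Poly_Mapping.keys (p * q)" for w
  proof -
    obtain a b where "w = a + b" "a \<in> Poly_Mapping.keys p" "b \<in> Poly_Mapping.keys q"
      using keys_mult[of p q] w by auto
    then show ?thesis using p q by (auto simp: free_algebra_def plus_fword_def)
  qed
  then show "p * q \<in> carrier (free_algebra G)"
    by (simp add: free_algebra_def)
qed

lemma free_algebra_sum_closed:
  "(\<And>a. a \<in> A \<Longrightarrow> f a \<in> carrier (free_algebra G)) \<Longrightarrow> sum f A \<in> carrier (free_algebra G)"
  by (induction A rule: infinite_finite_induct) (auto intro: free_algebra_closed)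

lemma free_algebra_power_closed:
  "p \<in> carrier (free_algebra G) \<Longrightarrow> p ^ k \<in> carrier (free_algebra G)"
  by (induction k) (auto intro: free_algebra_closed)

lemma retract_in_carrier: "retract G p \<in> carrier (free_algebra G)"
  by (induction p rule: ncpoly_induct)
     (auto simp: alg_hom_simps[OF alg_hom_retract] intro: free_algebra_closed,
      auto simp: retract_def intro: free_algebra_closed)

lemma retract_id:
  assumes "p \<in> carrier (free_algebra G)"
  shows "retract G p = p"
proof -
  have "prod_list (map (\<lambda>g. if g \<in> G then gen g else 0) xs) = prod_list (map gen xs)"
    if "set xs \<subseteq> G" for xs
    using that by (induction xs) auto
  then have "retract G p = subst gen p"
    using assms unfolding retract_def subst_def
    by (intro sum.cong) (auto simp: free_algebra_def)
  also have "\<dots> = p"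
    by (induction p rule: ncpoly_induct) (simp_all add: subst_add subst_mult)
  finally show ?thesis .
qed

text \<open>This is what permits ignoring alphabets: the free algebra on \<open>G\<close> is the
  full free algebra modulo the letters outside \<open>G\<close>.\<close>

lemma realizes_free: "realizes (free_algebra G) (retract G) (gen ` (- G))"
proof -
  note [simp] = alg_hom_simps[OF alg_hom_retract]
  have retract_eqm: "eqm (gen ` (- G)) (retract G p) p" for p
    by (rule alg_hom_eqm_gen[OF alg_hom_retract])
       (auto simp: alg_hom_def retract_def intro!: eqm_sym[OF eqm_base])
  have "retract G p = retract G q" if "eqm (gen ` (- G)) p q" for p q
  proof -
    \<comment> \<open>The letters outside \<open>G\<close> go to zero, so the images are congruent
      modulo the zero ideal, that is, equal.\<close>
    have "eqm {} (retract G p) (retract G q)"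
      by (rule alg_hom_eqm[OF alg_hom_retract _ that]) (auto simp: retract_def)
    moreover have "x = 0" if "x \<in> two_sided {}" for x :: "'a ncpoly"
      using that by induction auto
    ultimately show ?thesis by (metis eq_iff_diff_eq_0 eqm_def)
  qed
  then have "retract G p = retract G q \<longleftrightarrow> eqm (gen ` (- G)) p q" for p q
    by (metis eqm_sym eqm_trans retract_eqm)
  moreover have "range (retract G) = carrier (free_algebra G)"
    using retract_in_carrier retract_id
      by (metis (no_types) UNIV_I image_subsetI image_eqI subsetI subset_antisym)
  ultimately show ?thesis
    by (auto simp: realizes_def free_algebra_def)
qed

lemma realizes_presented:
  assumes "relators R \<subseteq> carrier (free_algebra G)"
  shows "realizes (presented_algebra G R) (\<lambda>p. presented_class G R (retract G p))
           (gen ` (- G) \<union> relators R)"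
proof -
  have "retract G ` relators R = relators R"
    using assms retract_id by (force simp: image_iff)
  then show ?thesis
    using realizes_quot[OF realizes_free[of G], of "relators R"]
    by (simp add: presented_algebra_def presented_class_def)
qed

section \<open>Words in the simple reflections\<close>

definition sref :: "weyl_type \<Rightarrow> nat \<Rightarrow> nat \<Rightarrow> int \<Rightarrow> int" where
  "sref T n i = (if i < n then swap_refl i (i + 1)
     else if T = TypeB then sign_refl n else swap_neg_refl (n - 1) n)"

text \<open>The relations are imposed pointwise on functions over an arbitrary type, so that signed
  permutations, left multiplications on residue classes and pairs of both are all instances.\<close>

definition coxeter_action :: "weyl_type \<Rightarrow> nat \<Rightarrow> (nat \<Rightarrow> 'a \<Rightarrow> 'a) \<Rightarrow> bool" where
  "coxeter_action T n t \<longleftrightarrow>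
    (\<forall>i\<in>nodes T n. \<forall>x. t i (t i x) = x) \<and>
    (\<forall>i x. 1 \<le> i \<and> i + 1 < n \<longrightarrow> t i (t (i + 1) (t i x)) = t (i + 1) (t i (t (i + 1) x))) \<and>
    (\<forall>i j x. 1 \<le> i \<and> i + 1 < j \<and> j < n \<longrightarrow> t i (t j x) = t j (t i x)) \<and>
    (T = TypeB \<longrightarrow> (\<forall>i x. 1 \<le> i \<and> i + 1 < n \<longrightarrow> t i (t n x) = t n (t i x)) \<and>
      (\<forall>x. t (n - 1) (t n (t (n - 1) (t n x))) = t n (t (n - 1) (t n (t (n - 1) x))))) \<and>
    (T = TypeD \<longrightarrow> (\<forall>i x. 1 \<le> i \<and> i < n \<and> i \<noteq> n - 2 \<longrightarrow> t i (t n x) = t n (t i x)) \<and>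
      (\<forall>x. t (n - 2) (t n (t (n - 2) x)) = t n (t (n - 2) (t n x))))"

lemma swap_refl_apply:
  assumes "i \<noteq> j" "1 \<le> i" "1 \<le> j"
  shows "swap_refl i j a = (if a = int i then int j else if a = int j then int i
    else if a = - int i then - int j else if a = - int j then - int i else a)"
proof -
  have "a = int i \<or> a = int j \<or> a = - int i \<or> a = - int j \<or>
    a \<noteq> int i \<and> a \<noteq> int j \<and> a \<noteq> - int i \<and> a \<noteq> - int j" by blast
  then show ?thesis
    by (elim disjE conjE; use assms in \<open>simp add: swap_refl_def transpose_def\<close>)
qed

lemma swap_neg_refl_apply:
  assumes "i \<noteq> j" "1 \<le> i" "1 \<le> j"
  shows "swap_neg_refl i j a = (if a = int i then - int j else if a = int j then - int i
    else if a = - int i then int j else if a = - int j then int i else a)"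
proof -
  have "a = int i \<or> a = int j \<or> a = - int i \<or> a = - int j \<or>
    a \<noteq> int i \<and> a \<noteq> int j \<and> a \<noteq> - int i \<and> a \<noteq> - int j" by blast
  then show ?thesis
    by (elim disjE conjE; use assms in \<open>simp add: swap_neg_refl_def transpose_def\<close>)
qed

lemma sign_refl_apply: "sign_refl i a = (if \<bar>a\<bar> = int i then - a else a)"
  by (auto simp: sign_refl_def transpose_def)

lemma node_if: "Suc 0 \<le> i \<Longrightarrow> i < n \<Longrightarrow> i \<in> nodes T n"
  by (cases T) auto

lemma sref_apply:
  assumes "admissible T n" "i \<in> nodes T n"
  shows "sref T n i a =
    (if i < n then
       if a = int i then int i + 1 else if a = int i + 1 then int i
       else if a = - int i then - int i - 1 else if a = - int i - 1 then - int i else a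
     else if T = TypeB then if \<bar>a\<bar> = int n then - a else a
     else if a = int n then 1 - int n else if a = int n - 1 then - int n
     else if a = - int n then int n - 1 else if a = 1 - int n then int n else a)"
proof -
  have "1 \<le> i" using assms by (cases T) auto
  moreover have "T = TypeD \<and> n \<ge> 4 \<and> i = n" if "\<not> i < n" "T \<noteq> TypeB"
    using that assms by (cases T) auto
  ultimately consider "1 \<le> i" "i < n" | "\<not> i < n" "T = TypeB" | "T = TypeD" "i = n" "n \<ge> 4"
    by blast
  then show ?thesis
  proof cases
    case 3
    then have "int (n - 1) = int n - 1" "n - 1 \<noteq> n" "1 \<le> n - 1" "1 \<le> n" by auto
    then show ?thesis
      using 3 by (simp add: sref_def swap_neg_refl_apply)
  qed (simp_all add: sref_def swap_refl_apply sign_refl_apply add.commute)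
qed

text \<open>Each relation is checked at the few points moved by the reflections that occur in it and
  at one generic fixed point.\<close>

lemma sref_coxeter_action:
  assumes adm: "admissible T n"
  shows "coxeter_action T n (sref T n)"
proof -
  note s = sref_apply[OF adm]
  have n: "T = TypeB \<Longrightarrow> n \<ge> 2" "T = TypeD \<Longrightarrow> n \<ge> 4" using adm by auto
  have nodes: "i \<in> nodes T n" if "1 \<le> i" "i < n" for i using that by (cases T) auto
  have nodes_n: "n \<in> nodes T n" if "T = TypeB \<or> T = TypeD" using that n by auto
  show ?thesis
    unfolding coxeter_action_def
  proof (intro conjI allI impI ballI)
    fix i x assume i: "i \<in> nodes T n"
    have "1 \<le> i" using i by (cases T) auto
    consider "i < n" | "T = TypeB" "i = n" | "T = TypeD" "i = n" "n \<ge> 4"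
      using i adm by (cases T) force+
    then show "sref T n i (sref T n i x) = x"
    proof cases
      case 1
      have "x = int i \<or> x = - int i \<or> x = int i + 1 \<or> x = - int i - 1 \<or>
        x \<notin> {int i, - int i, int i + 1, - int i - 1}" by blast
      then show ?thesis
        by (elim disjE; use 1 \<open>1 \<le> i\<close> in \<open>simp add: s[OF i]\<close>)
    next
      case 2
      then show ?thesis unfolding s[OF i] by simp
    next
      case 3
      have "x = int n \<or> x = - int n \<or> x = int n - 1 \<or> x = 1 - int n \<or>
        x \<notin> {int n, - int n, int n - 1, 1 - int n}" by blast
      moreover have "sref T n i b = (if b = int n then 1 - int n else if b = int n - 1 then - int n
          else if b = - int n then int n - 1 else if b = 1 - int n then int n else b)" for b
        unfolding s[OF i] using 3 by simp
      ultimately show ?thesis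
        by (elim disjE; use 3(3) in simp)
    qed
  next
    fix i x assume i: "1 \<le> i \<and> i + 1 < n"
    then have "i \<in> nodes T n" "i + 1 \<in> nodes T n" using nodes[of i] nodes[of "i + 1"] by auto
    note s = this(1)[THEN s] this(2)[THEN s, simplified]
    have "x = int i \<or> x = - int i \<or> x = int i + 1 \<or> x = - int i - 1 \<or> x = int i + 2 \<or> x
      = - int i - 2 \<or>
      x \<notin> {int i, - int i, int i + 1, - int i - 1, int i + 2, - int i - 2}" by blast
    then show "sref T n i (sref T n (i + 1) (sref T n i x))
      = sref T n (i + 1) (sref T n i (sref T n (i + 1) x))"
      by (elim disjE; use i in \<open>simp add: s\<close>)
  next
    fix i j x assume i: "1 \<le> i \<and> i + 1 < j \<and> j < n"
    then have "i \<in> nodes T n" "j \<in> nodes T n" using nodes by auto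
    note s = this[THEN s]
    have "x = int i \<or> x = - int i \<or> x = int i + 1 \<or> x = - int i - 1 \<or>
      x = int j \<or> x = - int j \<or> x = int j + 1 \<or> x = - int j - 1 \<or>
      x \<notin> {int i, - int i, int i + 1, - int i - 1, int j, - int j, int j + 1, - int j - 1}" by blast
    then show "sref T n i (sref T n j x) = sref T n j (sref T n i x)"
      by (elim disjE; use i in \<open>simp add: s\<close>)
  next
    fix i x assume T: "T = TypeB" and i: "1 \<le> i \<and> i + 1 < n"
    then have "i \<in> nodes T n" "n \<in> nodes T n" using nodes nodes_n by auto
    note s = this[THEN s]
    have "x = int i \<or> x = - int i \<or> x = int i + 1 \<or> x = - int i - 1 \<or> x = int n \<or> x = - int n \<or>
      x \<notin> {int i, - int i, int i + 1, - int i - 1, int n, - int n}" by blast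
    then show "sref T n i (sref T n n x) = sref T n n (sref T n i x)"
      unfolding T by (elim disjE; use i in \<open>simp add: s[unfolded T]\<close>)
  next
    fix x assume T: "T = TypeB"
    \<comment> \<open>Naming \<open>n - 1\<close> keeps truncated subtraction out of the integer
      arithmetic below.\<close>
    define p where "p = n - 1"
    have "p \<in> nodes T n" "n \<in> nodes T n" and i: "int n = int p + 1" "p < n" "1 \<le> p"
      using T n nodes nodes_n by (auto simp: p_def)
    note s = this(1,2)[THEN s]
    have sn: "sref T n n b = (if b = int p + 1 \<or> b = - int p - 1 then - b else b)" for b
      unfolding s using T i(1) by auto
    have sp: "sref T n p b = (if b = int p then int p + 1 else if b = int p + 1 then int p
       else if b = - int p then - int p - 1 else if b = - int p - 1 then - int p else b)" for b
      unfolding s using i(2) by simp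
    have "x = int p + 1 \<or> x = - int p - 1 \<or> x = int p \<or> x = - int p \<or>
      x \<notin> {int p + 1, - int p - 1, int p, - int p}" by blast
    then show "sref T n (n - 1) (sref T n n (sref T n (n - 1) (sref T n n x)))
        = sref T n n (sref T n (n - 1) (sref T n n (sref T n (n - 1) x)))"
      unfolding p_def[symmetric] by (elim disjE; use i(3) in \<open>simp add: sn sp\<close>)
  next
    fix i x assume T: "T = TypeD" and i: "1 \<le> i \<and> i < n \<and> i \<noteq> n - 2"
    then have "i \<in> nodes T n" "n \<in> nodes T n" using nodes nodes_n by auto
    note s = this[THEN s]
    have i2: "int i + 2 \<noteq> int n" using i n(2)[OF T] by linarith
    have "x = int i \<or> x = - int i \<or> x = int i + 1 \<or> x = - int i - 1 \<or>
      x = int n \<or> x = - int n \<or> x = int n - 1 \<or> x = 1 - int n \<or>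
      x \<notin> {int i, - int i, int i + 1, - int i - 1, int n, - int n, int n - 1, 1 - int n}" by blast
    then show "sref T n i (sref T n n x) = sref T n n (sref T n i x)"
      unfolding T by (elim disjE; use i i2 n(2)[OF T] in \<open>simp add: s[unfolded T]\<close>)
  next
    fix x assume T: "T = TypeD"
    then have "n - 2 \<in> nodes T n" "n \<in> nodes T n" and i: "int (n - 2) = int n - 2" "n - 2 < n"
      using n nodes nodes_n by auto
    note s = this(1,2)[THEN s]
    have "x = int n \<or> x = - int n \<or> x = int n - 1 \<or> x = 1 - int n \<or> x = int n - 2 \<or> x = 2 - int n \<or>
      x \<notin> {int n, - int n, int n - 1, 1 - int n, int n - 2, 2 - int n}" by blast
    then show "sref T n (n - 2) (sref T n n (sref T n (n - 2) x))
      = sref T n n (sref T n (n - 2) (sref T n n x))"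
      unfolding T by (elim disjE; use i n(2)[OF T] in \<open>simp add: s[unfolded T]\<close>)
  qed
qed

lemma coxeter_actionD:
  assumes "coxeter_action T n t"
  shows "i \<in> nodes T n \<Longrightarrow> t i (t i x) = x"
    "1 \<le> i \<Longrightarrow> i + 1 < n \<Longrightarrow> t i (t (i + 1) (t i x)) = t (i + 1) (t i (t (i + 1) x))"
    "1 \<le> i \<Longrightarrow> i + 1 < j \<Longrightarrow> j < n \<Longrightarrow> t i (t j x) = t j (t i x)"
    "T = TypeB \<Longrightarrow> 1 \<le> i \<Longrightarrow> i + 1 < n \<Longrightarrow> t i (t n x) = t n (t i x)"
    "T = TypeB \<Longrightarrow> t (n - 1) (t n (t (n - 1) (t n x))) = t n (t (n - 1) (t n (t (n - 1) x)))"
    "T = TypeD \<Longrightarrow> 1 \<le> i \<Longrightarrow> i < n \<Longrightarrow> i \<noteq> n - 2 \<Longrightarrow> t i (t n x) = t n (t i x)"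
    "T = TypeD \<Longrightarrow> t (n - 2) (t n (t (n - 2) x)) = t n (t (n - 2) (t n x))"
  by (use assms[unfolded coxeter_action_def] in blast)+

text \<open>A normal form computed in the product is one word that is correct for both actions at
  once.\<close>

lemma coxeter_action_prod:
  assumes c: "coxeter_action T n t" and c': "coxeter_action T n t'"
  shows "coxeter_action T n (\<lambda>i (x, y). (t i x, t' i y))"
  unfolding coxeter_action_def split_paired_All prod.case prod.inject
  by (intro conjI allI impI ballI; (elim conjE)?;
      intro coxeter_actionD[OF c] coxeter_actionD[OF c']; assumption)

lemma foldr_prod: "foldr (\<lambda>i (x, y). (t i x, t' i y)) w (x, y) = (foldr t w x, foldr t' w y)"
  by (induction w) auto

section \<open>Normal forms\<close>

text \<open>The simple reflections that fix e_1, ..., e_{m-1}. In type D node \<open>n\<close> also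
  moves e_{n-1}, so no node is left from \<open>m = n\<close> on.\<close>

definition par_nodes :: "weyl_type \<Rightarrow> nat \<Rightarrow> nat \<Rightarrow> nat set" where
  "par_nodes T n m = (if T = TypeD \<and> m \<ge> n then {} else {i \<in> nodes T n. m \<le> i})"

text \<open>For \<open>m \<le> n\<close>, the orbit of e_m under the reflections in
  \<open>par_nodes T n m\<close>, a negative index denoting a negated vector. The exception is
  \<open>m = n\<close> in type D, where that group is trivial; it is split off in the
  inductions.\<close>

definition orbit :: "weyl_type \<Rightarrow> nat \<Rightarrow> nat \<Rightarrow> int set" where
  "orbit T n m = {a. int m \<le> \<bar>a\<bar> \<and> \<bar>a\<bar> \<le> int n \<and> (T = TypeA \<longrightarrow> a > 0)}"

text \<open>A word in the nodes from \<open>m\<close> on that sends \<open>e\<^sub>m\<close> to \<open>e\<^sub>a\<close>; these words represent the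
  cosets of the stabilizer of \<open>e\<^sub>m\<close>.\<close>

definition crep :: "weyl_type \<Rightarrow> nat \<Rightarrow> nat \<Rightarrow> int \<Rightarrow> nat list" where
  "crep T n m a = (if a > 0 then rev [m..<nat a]
     else [nat (- a)..<n] @ n # rev [m..<if T = TypeD then n - 1 else n])"

lemma foldr_commute:
  assumes "\<And>j x. j \<in> set w \<Longrightarrow> t i (t j x) = t j (t i x)"
  shows "t i (foldr t w x) = foldr t w (t i x)"
  using assms by (induction w) auto

lemma upt_rev_split:
  "m < k \<Longrightarrow> rev [m..<k] = (k - 1) # rev [m..<k - 1]"
  by (cases k) auto

lemma upt_split_last: "m < k \<Longrightarrow> [m..<k] = [m..<k - 1] @ [k - 1]"
  by (cases k) auto

context
  fixes T :: weyl_type and n :: nat and t :: "nat \<Rightarrow> 'a \<Rightarrow> 'a"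
  assumes adm: "admissible T n" and cox: "coxeter_action T n t"
begin

lemma t_sq: "i \<in> nodes T n \<Longrightarrow> t i (t i x) = x"
  by (rule coxeter_actionD(1)[OF cox])

lemma t_sq': "1 \<le> i \<Longrightarrow> i < n \<Longrightarrow> t i (t i x) = x"
  using t_sq by (cases T) auto

lemma t_braid: "1 \<le> i \<Longrightarrow> i + 1 < n \<Longrightarrow> t i (t (i + 1) (t i x)) = t (i + 1) (t i (t (i + 1) x))"
  by (rule coxeter_actionD(2)[OF cox])

lemma t_far: "1 \<le> i \<Longrightarrow> 1 \<le> j \<Longrightarrow> i + 1 < j \<or> j + 1 < i \<Longrightarrow> i < n \<Longrightarrow> j < n \<Longrightarrow> t i (t j x) = t j (t i x)"
  using coxeter_actionD(3)[OF cox, of i j x] coxeter_actionD(3)[OF cox, of j i x] by auto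

text \<open>The letters above \<open>i + 1\<close> commute with \<open>t i\<close>; at the adjacent
  letters \<open>i + 1\<close>, \<open>i\<close> the braid relation turns \<open>t i\<close> into
  \<open>t (i + 1)\<close>, which commutes with everything that follows.\<close>

lemma rev_shift:
  assumes "1 \<le> m" "m \<le> i" "i + 1 < k" "k \<le> n"
  shows "t i (foldr t (rev [m..<k]) x) = foldr t (rev [m..<k]) (t (i + 1) x)"
proof -
  have "[m..<k] = [m..<i] @ [i, i + 1] @ [i + 2..<k]"
    using assms upt_add_eq_append[of m i "k - i"] by (simp add: upt_rec)
  then have eq: "rev [m..<k] = rev [i + 2..<k] @ [i + 1, i] @ rev [m..<i]" by simp
  have c1: "t i (foldr t (rev [i + 2..<k]) y) = foldr t (rev [i + 2..<k]) (t i y)" for y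
    by (rule foldr_commute) (use assms in \<open>auto intro!: t_far\<close>)
  have c2: "t (i + 1) (foldr t (rev [m..<i]) y) = foldr t (rev [m..<i]) (t (i + 1) y)" for y
    by (rule foldr_commute) (use assms in \<open>auto intro!: t_far\<close>)
  show ?thesis
    using t_braid[of i] assms
      by (simp only: eq foldr_append) (simp only: c1 c2[symmetric] foldr.simps o_apply id_apply)
qed

text \<open>Mirror image of \<open>rev_shift\<close>: past an ascending run the braid relation
  lowers the index.\<close>

lemma up_shift:
  assumes "1 \<le> k" "k < i" "i < l" "l \<le> n"
  shows "t i (foldr t [k..<l] x) = foldr t [k..<l] (t (i - 1) x)"
proof -
  obtain i' where i': "i = i' + 1" using assms by (metis add.commute less_imp_Suc_add plus_1_eq_Suc)
  have eq: "[k..<l] = [k..<i'] @ [i', i' + 1] @ [i' + 2..<l]"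
    using assms upt_add_eq_append[of k i' "l - i'"] by (simp add: upt_rec i')
  have c1: "t (i' + 1) (foldr t [k..<i'] y) = foldr t [k..<i'] (t (i' + 1) y)" for y
    by (rule foldr_commute) (use assms i' in \<open>auto intro!: t_far\<close>)
  have c2: "t i' (foldr t [i' + 2..<l] y) = foldr t [i' + 2..<l] (t i' y)" for y
    by (rule foldr_commute) (use assms i' in \<open>auto intro!: t_far\<close>)
  have "t i' (t (i' + 1) (t i' y)) = t (i' + 1) (t i' (t (i' + 1) y))" for y
    using t_braid[of i'] assms i' by simp
  then show ?thesis
    unfolding i' by (simp only: eq foldr_append c1 c2[symmetric] foldr.simps o_apply id_apply
      add_diff_cancel_right')
qed

text \<open>The letter \<open>i\<close> either extends the descending run, or cancels its first
  letter, or passes through it. In the last case it emerges as \<open>i + 1\<close> or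
  \<open>i\<close>, in any event beyond \<open>m\<close>, hence in the smaller stabilizer.\<close>

lemma step_pos:
  assumes m: "1 \<le> m" "m \<le> i" "i < n" and k: "m \<le> k" "k \<le> n"
  shows "\<exists>h. set h \<subseteq> {m + 1..<n} \<and> (\<forall>x. t i (foldr t (rev [m..<k]) x)
    = foldr t (rev [m..<if k = i then i + 1 else if k = i + 1 then i else k] @ h) x)"
proof -
  consider "k = i" | "k = i + 1" | "i + 1 < k" | "k < i" by linarith
  then show ?thesis
  proof cases
    case 1
    show ?thesis by (rule exI[of _ "[]"]) (use 1 m in simp)
  next
    case 2
    show ?thesis by (rule exI[of _ "[]"]) (use 2 m in \<open>simp add: t_sq'\<close>)
  next
    case 3
    show ?thesis by (rule exI[of _ "[i + 1]"]) (use 3 m k rev_shift in simp)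
  next
    case 4
    have "t i (foldr t (rev [m..<k]) x) = foldr t (rev [m..<k]) (t i x)" for x
      by (rule foldr_commute) (use 4 m in \<open>auto intro!: t_far\<close>)
    then show ?thesis by (intro exI[of _ "[i]"]) (use 4 m k in simp)
  qed
qed

text \<open>Here \<open>R\<close> is \<open>t\<^bsub>n-1\<^esub> \<cdots> t\<^sub>m\<close> in type \<open>B\<close> and \<open>t\<^bsub>n-2\<^esub> \<cdots> t\<^sub>m\<close> in type \<open>D\<close>; moving \<open>t\<^sub>j\<close> to the
  right past \<open>t\<^sub>n R\<close> turns it into another generator \<open>t\<^bsub>d j\<^esub>\<close>.\<close>

lemma step_neg:
  assumes m: "1 \<le> m" "m \<le> i" "i < n" and k: "m \<le> k" "k \<le> n"
    and tail: "\<And>j x. m \<le> j \<Longrightarrow> j + 1 < n \<Longrightarrow> t j (t n (foldr t R x)) = t n (foldr t R (t (d j) x))"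
    and d: "\<And>j. m \<le> j \<Longrightarrow> j + 1 < n \<Longrightarrow> d j \<in> H"
  shows "\<exists>h. set h \<subseteq> H \<and> (\<forall>x. t i (foldr t ([k..<n] @ n # R) x)
    = foldr t (([if k = i then i + 1 else if k = i + 1 then i else k..<n] @ n # R) @ h) x)"
proof -
  consider "k = i" | "k = i + 1" | "i + 1 < k" | "k < i" by linarith
  then show ?thesis
  proof cases
    \<comment> \<open>Compared with \<open>step_pos\<close> the first two cases trade places: the
      ascending run begins with \<open>k\<close>, so \<open>k = i\<close> cancels and
      \<open>k = i + 1\<close> extends.\<close>
    case 1
    then have "[k..<n] = i # [i + 1..<n]" using m by (simp add: upt_rec)
    then show ?thesis by (intro exI[of _ "[]"]) (use 1 m in \<open>simp add: t_sq'\<close>)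
  next
    case 2
    then have "[i..<n] = i # [k..<n]" using m by (simp add: upt_rec)
    then show ?thesis by (intro exI[of _ "[]"]) (use 2 in simp)
  next
    case 3
    have "t i (foldr t [k..<n] x) = foldr t [k..<n] (t i x)" for x
      by (rule foldr_commute) (use 3 m in \<open>auto intro!: t_far\<close>)
    then show ?thesis
      by (intro exI[of _ "[d i]"]) (use 3 m k tail[of i] d[of i] in simp)
  next
    case 4
    then have "t i (foldr t [k..<n] x) = foldr t [k..<n] (t (i - 1) x)" for x
      using m k by (intro up_shift) auto
    then show ?thesis
      by (intro exI[of _ "[d (i - 1)]"]) (use 4 m k tail[of "i - 1"] d[of "i - 1"] in simp)
  qed
qed

text \<open>New compared with the two step lemmas is \<open>i = n\<close>. For \<open>k = n\<close>
  the letter is added or cancelled; for smaller \<open>k\<close> it passes through unchanged. In a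
  negative representative it meets \<open>n - 1\<close>, \<open>n\<close>, \<open>n - 1\<close>, and
  passing these is exactly the relation of length four.\<close>

lemma crep_step_B:
  assumes T: "T = TypeB" and m: "1 \<le> m" and i: "i \<in> par_nodes T n m" and a: "a \<in> orbit T n m"
  shows "\<exists>h. set h \<subseteq> par_nodes T n (m + 1) \<and>
    (\<forall>x. t i (foldr t (crep T n m a) x) = foldr t (crep T n m (sref T n i a) @ h) x)"
proof -
  have n: "n \<ge> 2" using adm T by simp
  have far: "t j (t n x) = t n (t j x)" if "1 \<le> j" "j + 1 < n" for j x
    using coxeter_actionD(4)[OF cox T] that .
  have braid: "t (n - 1) (t n (t (n - 1) (t n x))) = t n (t (n - 1) (t n (t (n - 1) x)))" for x
    by (rule coxeter_actionD(5)[OF cox T])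
  have sqn: "t n (t n x) = x" for x using t_sq[of n] T n by simp
  have par: "par_nodes T n (Suc m) = {Suc m..n}" using T by (auto simp: par_nodes_def)
  have i': "m \<le> i" "i \<le> n" using i T by (auto simp: par_nodes_def)
  have inod: "i \<in> nodes T n" using i by (auto simp: par_nodes_def split: if_splits)
  have s: "sref T n i b = (if i < n then
       if b = int i then int i + 1 else if b = int i + 1 then int i
       else if b = - int i then - int i - 1 else if b = - int i - 1 then - int i else b
     else if \<bar>b\<bar> = int n then - b else b)" for b
    unfolding sref_apply[OF adm inod] using T by simp
  define k where "k = nat \<bar>a\<bar>"
  have k: "m \<le> k" "k \<le> n" "a = int k \<or> a = - int k" "k \<noteq> 0"
    using a m by (auto simp: orbit_def k_def)
  have commn: "t n (foldr t w x) = foldr t w (t n x)" if "set w \<subseteq> {1..<n - 1}" for w x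
    by (rule foldr_commute) (use that in \<open>force intro!: far[symmetric]\<close>)
  consider "i < n" "a = int k" | "i < n" "a = - int k" | "i = n" "a = int k" | "i = n" "a = - int k"
    using i' k by linarith
  then show ?thesis
  proof cases
    case 1
    obtain h where "set h \<subseteq> {m + 1..<n}" "\<And>x. t i (foldr t (rev [m..<k]) x)
      = foldr t (rev [m..<if k = i then i + 1 else if k = i + 1 then i else k] @ h) x"
      using step_pos[OF m i'(1) 1(1) k(1,2)] by blast
    moreover have "sref T n i a = int (if k = i then i + 1 else if k = i + 1 then i else k)"
      using 1 k m i' by (auto simp: s)
    ultimately show ?thesis
      using 1 k m i' by (intro exI[of _ h]) (auto simp: crep_def par)
  next
    case 2
    have "\<exists>h. set h \<subseteq> {m + 1..n} \<and> (\<forall>x. t i (foldr t ([k..<n] @ n # rev [m..<n]) x)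
    = foldr t (([if k = i then i + 1 else if k
      = i + 1 then i else k..<n] @ n # rev [m..<n]) @ h) x)"
    proof (rule step_neg[OF m i'(1) 2(1) k(1,2)])
      fix j x assume "m \<le> j" "j + 1 < n"
      then show "t j (t n (foldr t (rev [m..<n]) x)) = t n (foldr t (rev [m..<n]) (t (j + 1) x))"
        using m far rev_shift[of m j n] by simp
    qed auto
    then obtain h where "set h \<subseteq> {m + 1..n}" "\<And>x. t i (foldr t ([k..<n] @ n # rev [m..<n]) x)
      = foldr t (([if k = i then i + 1 else if k
        = i + 1 then i else k..<n] @ n # rev [m..<n]) @ h) x"
      by blast
    moreover have "sref T n i a = - int (if k = i then i + 1 else if k = i + 1 then i else k)"
      using 2 k m i' by (auto simp: s)
    ultimately show ?thesis
      using 2 k m i' T by (intro exI[of _ h]) (auto simp: crep_def par[unfolded T])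
  next
    case 3
    show ?thesis
    proof (cases "k = n")
      case True
      then show ?thesis unfolding s using 3 k T by (intro exI[of _ "[]"]) (auto simp: crep_def)
    next
      case False
      then have "t n (foldr t (rev [m..<k]) x) = foldr t (rev [m..<k]) (t n x)" for x
        using k m by (intro commn) auto
      then show ?thesis unfolding s
        using False 3 k T m by (intro exI[of _ "[n]"]) (auto simp: crep_def par[unfolded T])
    qed
  next
    case 4
    show ?thesis
    proof (cases "k = n")
      case True
      then show ?thesis unfolding s using 4 k T by (intro exI[of _ "[]"]) (auto simp: crep_def sqn)
    next
      case False
      then have eqs: "[k..<n] = [k..<n - 1] @ [n - 1]" "rev [m..<n] = (n - 1) # rev [m..<n - 1]"
        using k upt_split_last[of k n] upt_split_last[of m n] by auto
      have "t n (foldr t [k..<n - 1] x) = foldr t [k..<n - 1] (t n x)"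
        "t n (foldr t (rev [m..<n - 1]) x) = foldr t (rev [m..<n - 1]) (t n x)" for x
        by (intro commn; use m k in auto)+
      then show ?thesis unfolding s
        using False 4 k T m by (intro exI[of _ "[n]"]) (auto simp: crep_def par[unfolded T] eqs
          braid[symmetric, simplified])
    qed
  qed
qed

text \<open>Node \<open>n\<close> exchanges e_{n-1} and e_n up to sign, so both \<open>k = n\<close>
  and \<open>k = n - 1\<close> change the representative. For smaller \<open>k\<close> the letter
  passes through a positive representative unchanged, and emerges from a negative one as
  \<open>n - 1\<close>.\<close>

lemma crep_step_D:
  assumes T: "T = TypeD" and m: "1 \<le> m" and i: "i \<in> par_nodes T n m" and a: "a \<in> orbit T n m"
  shows "\<exists>h. set h \<subseteq> par_nodes T n (m + 1) \<and>
    (\<forall>x. t i (foldr t (crep T n m a) x) = foldr t (crep T n m (sref T n i a) @ h) x)"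
proof -
  have n: "n \<ge> 4" using adm T by simp
  have far: "t j (t n x) = t n (t j x)" if "1 \<le> j" "j < n" "j \<noteq> n - 2" for j x
    using coxeter_actionD(6)[OF cox T] that .
  have braid: "t (n - 2) (t n (t (n - 2) x)) = t n (t (n - 2) (t n x))" for x
    by (rule coxeter_actionD(7)[OF cox T])
  have braid': "t (n - 2) (t (n - 1) (t (n - 2) x)) = t (n - 1) (t (n - 2) (t (n - 1) x))" for x
    using t_braid[of "n - 2"] n by (simp add: numeral_2_eq_2 Suc_diff_Suc)
  have sqn: "t n (t n x) = x" for x using t_sq[of n] T n by simp
  have mn: "m < n" using i by (auto simp: par_nodes_def T split: if_splits)
  have par: "j \<in> par_nodes T n (Suc m) \<longleftrightarrow> Suc m \<le> j \<and> Suc m < n \<and> j \<le> n" for j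
    using T by (auto simp: par_nodes_def)
  have i': "m \<le> i" "i \<le> n" using i T by (auto simp: par_nodes_def split: if_splits)
  have inod: "i \<in> nodes T n" using i by (auto simp: par_nodes_def split: if_splits)
  have s: "sref T n i b = (if i < n then
       if b = int i then int i + 1 else if b = int i + 1 then int i
       else if b = - int i then - int i - 1 else if b = - int i - 1 then - int i else b
     else if b = int n then 1 - int n else if b = int n - 1 then - int n
     else if b = - int n then int n - 1 else if b = 1 - int n then int n else b)" for b
    unfolding sref_apply[OF adm inod] using T by simp
  define k where "k = nat \<bar>a\<bar>"
  have k: "m \<le> k" "k \<le> n" "a = int k \<or> a = - int k" "k \<noteq> 0"
    using a m by (auto simp: orbit_def k_def)
  have commn: "t n (foldr t w x) = foldr t w (t n x)" if "set w \<subseteq> {1..<n - 2}" for w x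
    by (rule foldr_commute) (use that in \<open>force intro!: far[symmetric]\<close>)
  consider "i < n" "a = int k" | "i < n" "a = - int k" | "i = n" "a = int k" | "i = n" "a = - int k"
    using i' k by linarith
  then show ?thesis
  proof cases
    case 1
    obtain h where "set h \<subseteq> {m + 1..<n}" "\<And>x. t i (foldr t (rev [m..<k]) x)
      = foldr t (rev [m..<if k = i then i + 1 else if k = i + 1 then i else k] @ h) x"
      using step_pos[OF m i'(1) 1(1) k(1,2)] by blast
    moreover have "sref T n i a = int (if k = i then i + 1 else if k = i + 1 then i else k)"
      using 1 k m i' by (auto simp: s)
    moreover have "set h \<subseteq> par_nodes T n (m + 1)" if "set h \<subseteq> {m + 1..<n}" for h
      using that by (force simp: par)
    ultimately show ?thesis
      using 1 k m i' by (intro exI[of _ h]) (auto simp: crep_def)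
  next
    case 2
    let ?R = "rev [m..<n - 1]"
    have "\<exists>h. set h \<subseteq> par_nodes T n (m + 1) \<and> (\<forall>x. t i (foldr t ([k..<n] @ n # ?R) x)
    = foldr t (([if k = i then i + 1 else if k = i + 1 then i else k..<n] @ n # ?R) @ h) x)"
    proof (rule step_neg[OF m i'(1) 2(1) k(1,2)])
      fix j x assume j: "m \<le> j" "j + 1 < n"
      \<comment> \<open>The shift by one stops at \<open>n - 2\<close>: there the braid relation
        with node \<open>n\<close> replaces the one with \<open>n - 1\<close>, and the emerging
        letter is \<open>n\<close>.\<close>
      show "t j (t n (foldr t ?R x)) = t n (foldr t ?R (t (if j = n - 2 then n else j + 1) x))"
      proof (cases "j = n - 2")
        case True
        then have "?R = (n - 2) # rev [m..<n - 2]"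
          using upt_rev_split[of m "n - 1"] j by (simp add: numeral_2_eq_2)
        then show ?thesis
          using True braid commn[of "rev [m..<n - 2]"] m by (auto simp: subset_iff)
      next
        case False
        then show ?thesis
          using m j far[of j] rev_shift[of m j "n - 1"] by simp
      qed
      show "(if j = n - 2 then n else j + 1) \<in> par_nodes T n (m + 1)"
        using j n by (auto simp: par)
    qed
    then obtain h where "set h \<subseteq> par_nodes T n (m + 1)" "\<And>x. t i (foldr t ([k..<n] @ n # ?R) x)
      = foldr t (([if k = i then i + 1 else if k = i + 1 then i else k..<n] @ n # ?R) @ h) x"
      by blast
    moreover have "sref T n i a = - int (if k = i then i + 1 else if k = i + 1 then i else k)"
      using 2 k m i' by (auto simp: s)
    ultimately show ?thesis
      using 2 k m i' T by (intro exI[of _ h]) (auto simp: crep_def)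
  next
    case 3
    consider "k = n" | "k = n - 1" | "k < n - 1" using k by linarith
    then show ?thesis
    proof cases
      case 1
      then have eqs: "rev [m..<n] = (n - 1) # rev [m..<n - 1]" "nat (int n - 1)
        = n - 1" "[n - Suc 0..<n] = [n - 1]"
        using mn n upt_split_last[of "n - 1" n] upt_split_last[of m n] by auto
      show ?thesis unfolding s
        using 1 3 n T far[of "n - 1"] by (intro exI[of _ "[]"]) (auto simp: crep_def eqs)
    next
      case 2
      then show ?thesis unfolding s
        using 3 n T by (intro exI[of _ "[]"]) (auto simp: crep_def of_nat_diff nat_diff_distrib)
    next
      case k': 3
      then have "t n (foldr t (rev [m..<k]) x) = foldr t (rev [m..<k]) (t n x)" for x
        using k m by (intro commn) auto
      then show ?thesis unfolding s
        using k' 3 k T m by (intro exI[of _ "[n]"]) (auto simp: crep_def par[unfolded T])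
    qed
  next
    case 4
    consider "k = n" | "k = n - 1" | "k < n - 1" using k by linarith
    then show ?thesis
    proof cases
      case 1
      then show ?thesis unfolding s
        using 4 n T by (intro exI[of _ "[]"]) (auto simp: crep_def of_nat_diff sqn nat_diff_distrib)
    next
      case 2
      then have eqs: "rev [m..<n] = (n - 1) # rev [m..<n - 1]" "nat (int n - 1)
        = n - 1" "[n - Suc 0..<n] = [n - 1]"
        using mn n upt_split_last[of "n - 1" n] upt_split_last[of m n] by auto
      show ?thesis unfolding s
        using 2 4 n T far[of "n - 1"]
          by (intro exI[of _ "[]"]) (auto simp: crep_def eqs of_nat_diff sqn)
    next
      case 3
      have eqs: "[k..<n] = [k..<n - 2] @ [n - 2, n - 1]" "rev [m..<n - Suc 0]
        = (n - 2) # rev [m..<n - 2]"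
        using upt_split_last[of k n] upt_split_last[of k "n - 1"] upt_rev_split[of m "n - 1"] 3 k
        by (auto simp: numeral_2_eq_2)
      have c1: "t n (foldr t [k..<n - 2] x) = foldr t [k..<n - 2] (t n x)" for x
        by (intro commn) (use m k in auto)
      have c2: "t (n - Suc 0) (foldr t (rev [m..<n - 2]) x)
        = foldr t (rev [m..<n - 2]) (t (n - Suc 0) x)" for x
        by (rule foldr_commute) (use m k n in \<open>auto intro!: t_far\<close>)
      \<comment> \<open>Nodes \<open>n - 1\<close> and \<open>n\<close> commute and both are braided
        with \<open>n - 2\<close>. Hence the block \<open>n - 2\<close>, \<open>n - 1\<close>,
        \<open>n\<close>, \<open>n - 2\<close> turns a \<open>t n\<close> on its left into a
        \<open>t (n - 1)\<close> on its right.\<close>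
      have "t n (t (n - 2) (t (n - 1) (t n (t (n - 2) x))))
          = t (n - 2) (t (n - 1) (t n (t (n - 2) (t (n - 1) x))))" for x
      proof -
        have "t n (t (n - 2) (t (n - 1) (t n (t (n - 2) x))))
          = t n (t (n - 2) (t n (t (n - 1) (t (n - 2) x))))"
          using far[of "n - 1"] n by simp
        also have "\<dots> = t (n - 2) (t n (t (n - 1) (t (n - 2) (t (n - 1) x))))"
          by (simp flip: braid add: braid'[simplified])
        finally show ?thesis
          using far[of "n - 1"] n by simp
      qed
      then show ?thesis unfolding s
        using 3 4 k T m n by (intro exI[of _ "[n - 1]"]) (auto simp: crep_def par[unfolded T] eqs
          c1 c2)
    qed
  qed
qed

text \<open>The word \<open>h\<close> is chosen before \<open>x\<close>: this is an identity between
  words in the generators, so it can be iterated.\<close>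

lemma crep_step:
  assumes m: "1 \<le> m" and i: "i \<in> par_nodes T n m" and a: "a \<in> orbit T n m"
  shows "\<exists>h. set h \<subseteq> par_nodes T n (m + 1) \<and>
    (\<forall>x. t i (foldr t (crep T n m a) x) = foldr t (crep T n m (sref T n i a) @ h) x)"
proof (cases T)
  case TypeA
  define k where "k = nat a"
  have k: "m \<le> k" "k \<le> n" "a = int k" using a TypeA by (auto simp: orbit_def k_def)
  have i': "m \<le> i" "i < n" "i \<in> nodes T n" using i TypeA by (auto simp: par_nodes_def)
  obtain h where "set h \<subseteq> {m + 1..<n}" "\<And>x. t i (foldr t (rev [m..<k]) x)
      = foldr t (rev [m..<if k = i then i + 1 else if k = i + 1 then i else k] @ h) x"
    using step_pos[OF m i'(1,2) k(1,2)] by blast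
  moreover have "sref T n i a = int (if k = i then i + 1 else if k = i + 1 then i else k)"
    using k m i' by (auto simp: sref_apply[OF adm])
  moreover have "par_nodes T n (m + 1) = {m + 1..<n}" using TypeA by (auto simp: par_nodes_def)
  ultimately show ?thesis
    using k m i' by (intro exI[of _ h]) (auto simp: crep_def)
qed (use assms crep_step_B crep_step_D in auto)

lemma sref_orbit:
  assumes m: "1 \<le> m" and i: "i \<in> par_nodes T n m" and a: "a \<in> orbit T n m"
  shows "sref T n i a \<in> orbit T n m"
proof -
  have i': "i \<in> nodes T n" "m \<le> i" "T = TypeD \<Longrightarrow> m < n"
    using i by (auto simp: par_nodes_def split: if_splits)
  then consider "i < n" | "T = TypeB" "i = n" | "T = TypeD" "i = n" "m < n"
    by (cases T) force+
  then show ?thesis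
    using a m i' unfolding sref_apply[OF adm i'(1)] by cases (auto simp: orbit_def)
qed

text \<open>Letters are absorbed from right to left. Each new one moves the representative along the
  orbit and emits a stabilizer word in front of the one collected so far.\<close>

lemma normal_form:
  assumes m: "1 \<le> m" "m \<le> n" and w: "set w \<subseteq> par_nodes T n m"
  shows "\<exists>a h. a \<in> orbit T n m \<and> set h \<subseteq> par_nodes T n (m + 1) \<and>
    (\<forall>x. foldr t w x = foldr t (crep T n m a @ h) x)"
  using w
proof (induction w)
  case Nil
  show ?case
    by (rule exI[of _ "int m"], rule exI[of _ "[]"]) (use m in \<open>auto simp: orbit_def crep_def\<close>)
next
  case (Cons i w)
  then obtain a h where a: "a \<in> orbit T n m" "set h \<subseteq> par_nodes T n (m + 1)"
    "\<And>x. foldr t w x = foldr t (crep T n m a @ h) x" by auto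
  have i: "i \<in> par_nodes T n m" using Cons by simp
  obtain h' where "set h' \<subseteq> par_nodes T n (m + 1)"
    "\<And>x. t i (foldr t (crep T n m a) x) = foldr t (crep T n m (sref T n i a) @ h') x"
    using crep_step[OF m(1) i a(1)] by blast
  then show ?case
    using a sref_orbit[OF m(1) i a(1)]
    by (intro exI[of _ "sref T n i a"] exI[of _ "h' @ h"]) auto
qed

end

section \<open>Completeness of the Coxeter relations\<close>

context
  fixes T :: weyl_type and n :: nat
  assumes adm: "admissible T n"
begin

lemma foldr_sref_par_nodes:
  assumes "1 \<le> m" "set h \<subseteq> par_nodes T n (m + 1)"
  shows "foldr (sref T n) h (int m) = int m"
  using assms(2)
proof (induction h)
  case (Cons i h)
  then have i: "i \<in> nodes T n" "m < i" "T = TypeD \<Longrightarrow> m + 1 < n"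
    by (auto simp: par_nodes_def split: if_splits)
  then consider "i < n" | "T = TypeB" "i = n" | "T = TypeD" "i = n" "m + 1 < n"
    by (cases T) force+
  then have "sref T n i (int m) = int m"
    using assms(1) i(2) unfolding sref_apply[OF adm i(1)] by cases auto
  then show ?case using Cons by simp
qed simp

lemma foldr_sref_desc:
  assumes "1 \<le> m" "m \<le> k" "k \<le> n"
  shows "foldr (sref T n) (rev [m..<k]) (int m) = int k"
  using assms(2,3)
proof (induction k rule: dec_induct)
  case (step k)
  then have "k \<in> nodes T n" using assms by (cases T) auto
  then show ?case using step assms by (simp add: sref_apply[OF adm])
qed simp

lemma sref_uminus: "i \<in> nodes T n \<Longrightarrow> sref T n i (- a) = - sref T n i a"
proof -
  assume i: "i \<in> nodes T n"
  then have "0 < i" by (cases T) auto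
  consider "i < n" | "T = TypeB" "i = n" | "T = TypeD" "i = n" "n \<ge> 4"
    using i adm by (cases T) force+
  then show ?thesis
    unfolding sref_apply[OF adm i] by cases (use \<open>0 < i\<close> in auto)
qed

lemma foldr_sref_uminus: "set w \<subseteq> nodes T n \<Longrightarrow> foldr (sref T n) w (- a) = - foldr (sref T n) w a"
  by (induction w) (auto simp: sref_uminus)

lemma foldr_sref_asc:
  assumes "1 \<le> k" "k \<le> l" "l \<le> n"
  shows "foldr (sref T n) [k..<l] (int l) = int k"
  using assms(2,1)
proof (induction k rule: inc_induct)
  case (step k)
  then have "k \<in> nodes T n" using assms by (cases T) auto
  then show ?case using step assms by (simp add: sref_apply[OF adm] upt_rec)
qed simp

text \<open>For negative \<open>a\<close>, read from the right: the descending run carries e_m to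
  e_n in type B and to e_{n-1} in type D, node \<open>n\<close> turns either into -e_n, and the
  ascending run brings this to its place. For \<open>m = n\<close> in type D the vector e_{n-1} is
  out of reach, which explains the condition.\<close>

lemma foldr_sref_crep:
  assumes m: "1 \<le> m" and a: "a \<in> orbit T n m" and D: "T = TypeD \<longrightarrow> m < n"
  shows "foldr (sref T n) (crep T n m a) (int m) = a"
proof (cases "a > 0")
  case True
  then show ?thesis
    using a foldr_sref_desc[OF m, of "nat a"] by (auto simp: crep_def orbit_def)
next
  case False
  then have T: "T = TypeB \<or> T = TypeD" "a < 0" "m \<le> n" using a m by (cases T; auto simp: orbit_def)+
  then have "n \<in> nodes T n" using m by auto
  note s = sref_apply[OF adm this]
  have "sref T n n (foldr (sref T n) (rev [m..<if T = TypeD then n - 1 else n]) (int m)) = - int n"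
  proof (cases "T = TypeD")
    case True
    then have "foldr (sref T n) (rev [m..<n - 1]) (int m) = int n - 1"
      using foldr_sref_desc[OF m, of "n - 1"] D m by (simp add: of_nat_diff)
    then show ?thesis using True s[of "int n - 1"] by simp
  next
    case False
    then show ?thesis
      using foldr_sref_desc[OF m, of n] T s[of "int n"] by simp
  qed
  then show ?thesis
    using False a foldr_sref_asc[of "nat (- a)" n] m foldr_sref_uminus[of "[nat (- a)..<n]" "int n"]
    by (force simp: crep_def orbit_def node_if)
qed

lemma inj_foldr_sref:
  assumes "set w \<subseteq> nodes T n"
  shows "inj (foldr (sref T n) w)"
  using assms
proof (induction w)
  case (Cons i w)
  then have "inj (sref T n i)"
    using t_sq[OF adm sref_coxeter_action[OF adm], of i]
    by (intro inj_on_inverseI[of UNIV "sref T n i" "sref T n i"]) auto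
  then show ?case
    using Cons inj_compose[of "sref T n i" "foldr (sref T n) w"] by (simp add: comp_def)
qed (simp add: inj_on_def)

text \<open>Both words are normalized in the product action. The stabilizer part fixes e_m, so equal
  permutations have the same representative; it cancels by injectivity, and the induction hypothesis
  compares the remaining words.\<close>

lemma coxeter_presentation_par:
  assumes cox: "coxeter_action T n t" and m: "1 \<le> m"
    and w: "set w \<subseteq> par_nodes T n m" "set w' \<subseteq> par_nodes T n m"
    and eq: "foldr (sref T n) w = foldr (sref T n) w'"
  shows "foldr t w x = foldr t w' x"
  using m w eq
proof (induction "n + 1 - m" arbitrary: m w w' x)
  case 0
  then have "par_nodes T n m = {}" by (cases T) (auto simp: par_nodes_def)
  then show ?case using 0 by simp
next
  case (Suc d)
  show ?case
  \<comment> \<open>In this case \<open>orbit\<close> is too large, but only the empty word is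
    available.\<close>
  proof (cases "T = TypeD \<and> m = n")
    case True
    then have "par_nodes T n m = {}" by (auto simp: par_nodes_def)
    then show ?thesis using Suc by simp
  next
    case False
    have mn: "m \<le> n" using Suc.hyps(2) by simp
    note cox2 = coxeter_action_prod[OF cox sref_coxeter_action[OF adm]]
    have "\<exists>a h. a \<in> orbit T n m \<and> set h \<subseteq> par_nodes T n (m + 1) \<and>
        (\<forall>x. foldr t w x = foldr t (crep T n m a @ h) x) \<and>
        (\<forall>x. foldr (sref T n) w x = foldr (sref T n) (crep T n m a @ h) x)"
      if "set w \<subseteq> par_nodes T n m" for w
      using normal_form[OF adm cox2 Suc.prems(1) mn that] by (simp add: split_paired_All foldr_prod)
    \<comment> \<open>The orbit index is eliminated: evaluating the normal form at e_m shows that it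
      is the image of e_m under \<open>w\<close>.\<close>
    then have nf: "\<exists>h. set h \<subseteq> par_nodes T n (m + 1) \<and>
        (\<forall>x. foldr t w x = foldr t (crep T n m (foldr (sref T n) w (int m)) @ h) x) \<and>
        (\<forall>x. foldr (sref T n) w x
          = foldr (sref T n) (crep T n m (foldr (sref T n) w (int m)) @ h) x) \<and>
        foldr (sref T n) w (int m) \<in> orbit T n m"
      if "set w \<subseteq> par_nodes T n m" for w
      using that foldr_sref_par_nodes[OF Suc.prems(1)] foldr_sref_crep[OF Suc.prems(1)] False mn
      by (metis foldr_append le_neq_implies_less)
    obtain h where h: "set h \<subseteq> par_nodes T n (m + 1)"
        "\<And>x. foldr t w x = foldr t (crep T n m (foldr (sref T n) w (int m)) @ h) x"
        "\<And>x. foldr (sref T n) w x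
          = foldr (sref T n) (crep T n m (foldr (sref T n) w (int m)) @ h) x"
        and orb: "foldr (sref T n) w (int m) \<in> orbit T n m"
      using nf[OF Suc.prems(2)] by blast
    obtain h' where h': "set h' \<subseteq> par_nodes T n (m + 1)"
        "\<And>x. foldr t w' x = foldr t (crep T n m (foldr (sref T n) w' (int m)) @ h') x"
        "\<And>x. foldr (sref T n) w' x
          = foldr (sref T n) (crep T n m (foldr (sref T n) w' (int m)) @ h') x"
      using nf[OF Suc.prems(3)] by blast
    let ?c = "crep T n m (foldr (sref T n) w (int m))"
    have "set ?c \<subseteq> nodes T n"
      using orb Suc.prems(1) mn adm by (cases T) (auto simp: crep_def orbit_def)
    then have inj: "inj (foldr (sref T n) ?c)" by (rule inj_foldr_sref)
    have "foldr (sref T n) ?c (foldr (sref T n) h y)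
      = foldr (sref T n) ?c (foldr (sref T n) h' y)" for y
      using h(3)[of y] h'(3)[of y] Suc.prems(4) by simp
    then have "foldr (sref T n) h = foldr (sref T n) h'"
      using inj by (auto simp: inj_def)
    moreover have "d = n + 1 - (m + 1)" using Suc.hyps(2) by simp
    ultimately have "foldr t h y = foldr t h' y" for y
      using Suc.hyps(1)[of "m + 1" h h' y] h(1) h'(1) by simp
    then show ?thesis
      using h(2) h'(2) Suc.prems(4) by simp
  qed
qed

theorem coxeter_presentation:
  assumes "coxeter_action T n t" "set w \<subseteq> nodes T n" "set w' \<subseteq> nodes T n"
    and "foldr (sref T n) w = foldr (sref T n) w'"
  shows "foldr t w x = foldr t w' x"
proof -
  have "par_nodes T n 1 = nodes T n" using adm by (cases T) (auto simp: par_nodes_def)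
  then show ?thesis using coxeter_presentation_par[of t 1 w w'] assms by simp
qed

end

section \<open>Relational lifting to the lifted reflections\<close>

context
  fixes r :: "'p::ring_1 \<Rightarrow> 'q::ring_1 \<Rightarrow> bool"
  assumes r_one: "r 1 1" and r_mult: "\<And>a b c d. r a b \<Longrightarrow> r c d \<Longrightarrow> r (a * c) (b * d)"
begin

lemma rel_power: "r a b \<Longrightarrow> r (a ^ k) (b ^ k)"
  by (induction k) (simp_all add: r_one r_mult)

lemma rel_prod_list:
  "(\<And>x. x \<in> set xs \<Longrightarrow> r (f x) (g x)) \<Longrightarrow> r (prod_list (map f xs)) (prod_list (map g xs))"
  by (induction xs) (simp_all add: r_one r_mult)

lemma rel_up: "(\<And>k. i \<le> k \<Longrightarrow> k \<le> j \<Longrightarrow> r (t k) (t' k)) \<Longrightarrow> r (up t i j) (up t' i j)"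
  unfolding up_def by (rule rel_prod_list) auto

lemma rel_down: "(\<And>k. j \<le> k \<Longrightarrow> k \<le> i \<Longrightarrow> r (t k) (t' k)) \<Longrightarrow> r (down t i j) (down t' i j)"
  unfolding down_def by (rule rel_prod_list) auto

context
  fixes e :: 'p and e' :: 'q and t :: "nat \<Rightarrow> 'p" and t' :: "nat \<Rightarrow> 'q" and n :: nat
  assumes e: "r e e'"
begin

text \<open>The brackets are built by products alone, so any relation compatible with products
  passes to them. It is applied to membership in a free algebra and to congruence modulo an
  ideal.\<close>

lemma rel_brk:
  assumes t: "\<And>k. 1 \<le> k \<Longrightarrow> k < n \<Longrightarrow> r (t k) (t' k)" and "i \<in> {1..n}" "j \<in> {1..n}"
  shows "r (brk e t i j) (brk e' t' i j)"
  using assms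
  by (auto simp: brk_def Let_def intro!: r_mult rel_power rel_up rel_down e t)

lemma rel_brk_bar_D:
  assumes t: "\<And>k. 1 \<le> k \<Longrightarrow> k \<le> n \<Longrightarrow> r (t k) (t' k)" and "i \<in> {1..n}" "j \<in> {1..n}"
  shows "r (brk_bar_D e t n i j) (brk_bar_D e' t' n i j)"
  using assms
  by (auto simp: brk_bar_D_def Let_def intro!: r_mult rel_power rel_up rel_down e t)

text \<open>The letter \<open>t (n - 1)\<close> stands outside the index ranges;
  \<open>2 \<le> n\<close> keeps its index positive.\<close>

lemma rel_brk_bar_B:
  assumes t: "\<And>k. 1 \<le> k \<Longrightarrow> k \<le> n \<Longrightarrow> r (t k) (t' k)" and "i \<in> {1..n}" "j \<in> {1..n}" "2 \<le> n"
  shows "r (brk_bar_B e t n i j) (brk_bar_B e' t' n i j)"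
  using assms
  by (auto simp: brk_bar_B_def Let_def intro!: r_mult rel_power rel_up rel_down e t)

lemma rel_brk_single:
  assumes t: "\<And>k. 1 \<le> k \<Longrightarrow> k \<le> n \<Longrightarrow> r (t k) (t' k)" and "i \<in> {1..n}"
  shows "r (brk_single e t n i) (brk_single e' t' n i)"
  using assms
  by (auto simp: brk_single_def intro!: r_mult rel_power rel_up rel_down e t)

end

end

section \<open>The relations lie in the free algebras\<close>

lemma cover_gens_iff:
  "VX i \<in> cover_gens T n \<longleftrightarrow> 1 \<le> i \<and> i \<le> n" "VY i \<in> cover_gens T n \<longleftrightarrow> 1 \<le> i \<and> i \<le> n"
  "VT i \<in> cover_gens T n \<longleftrightarrow> i \<in> nodes T n" "VZ \<in> cover_gens T n"
  by (auto simp: cover_gens_def)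

lemma spin_gens_iff:
  "SXi i \<in> spin_gens T n \<longleftrightarrow> 1 \<le> i \<and> i \<le> n" "SY i \<in> spin_gens T n \<longleftrightarrow> 1 \<le> i \<and> i \<le> n"
  "ST i \<in> spin_gens T n \<longleftrightarrow> i \<in> nodes T n"
  by (auto simp: spin_gens_def)



lemma free_algebra_comm_closed:
  "p \<in> carrier (free_algebra G) \<Longrightarrow> q \<in> carrier (free_algebra G) \<Longrightarrow>
    comm p q \<in> carrier (free_algebra G)"
  unfolding comm_def by (intro free_algebra_closed)

context
  fixes G :: "'g set" and e :: "'g ncpoly" and t :: "nat \<Rightarrow> 'g ncpoly" and T n
  assumes e: "e \<in> carrier (free_algebra G)" and adm: "admissible T n"
    and t: "\<And>i. i \<in> nodes T n \<Longrightarrow> t i \<in> carrier (free_algebra G)"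
begin

lemma free_algebra_brk_closed:
  "i \<in> {1..n} \<Longrightarrow> j \<in> {1..n} \<Longrightarrow> brk e t i j \<in> carrier (free_algebra G)"
  \<comment> \<open>Membership is a relation that ignores its second argument, for which
    \<open>int\<close> is an arbitrary type.\<close>
  by (rule rel_brk[where r = "\<lambda>a _ :: int. a \<in> carrier (free_algebra G)" and n = n])
     (auto intro: free_algebra_closed e t node_if)

lemma free_algebra_brk_bar_D_closed:
  "T = TypeD \<Longrightarrow> i \<in> {1..n} \<Longrightarrow> j \<in> {1..n} \<Longrightarrow> brk_bar_D e t n i j \<in> carrier (free_algebra G)"
  by (rule rel_brk_bar_D[where r = "\<lambda>a _ :: int. a \<in> carrier (free_algebra G)"])
     (auto intro: free_algebra_closed e t)

lemma free_algebra_brk_bar_B_closed: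
  "T = TypeB \<Longrightarrow> i \<in> {1..n} \<Longrightarrow> j \<in> {1..n} \<Longrightarrow> brk_bar_B e t n i j \<in> carrier (free_algebra G)"
  by (rule rel_brk_bar_B[where r = "\<lambda>a _ :: int. a \<in> carrier (free_algebra G)"])
     (use adm in \<open>auto intro: free_algebra_closed e t\<close>)

lemma free_algebra_brk_single_closed:
  "T = TypeB \<Longrightarrow> i \<in> {1..n} \<Longrightarrow> brk_single e t n i \<in> carrier (free_algebra G)"
  by (rule rel_brk_single[where r = "\<lambda>a _ :: int. a \<in> carrier (free_algebra G)"])
     (auto intro: free_algebra_closed e t)

lemmas free_algebra_brk_closeds = free_algebra_brk_closed free_algebra_brk_bar_D_closed
  free_algebra_brk_bar_B_closed free_algebra_brk_single_closed

end

lemma relators_subset: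
  assumes "\<And>l r. R l r \<Longrightarrow> l \<in> carrier (free_algebra G) \<and> r \<in> carrier (free_algebra G)"
  shows "relators R \<subseteq> carrier (free_algebra G)"
  using assms by (auto simp: relators_def intro: free_algebra_closed)

lemma cover_rel_closed:
  assumes adm: "admissible T n"
  shows "relators (cover_rel T n u v) \<subseteq> carrier (free_algebra (cover_gens T n))"
proof (rule relators_subset)
  let ?C = "carrier (free_algebra (cover_gens T n))"
  have t: "vt i \<in> ?C" if "i \<in> nodes T n" for i
    using that by (auto simp: cover_gens_iff intro!: free_algebra_closed)
  have z: "vz \<in> ?C"
    by (auto simp: cover_gens_iff intro!: free_algebra_closed)
  note closed = free_algebra_closed free_algebra_power_closed free_algebra_sum_closed
    free_algebra_comm_closed free_algebra_brk_closeds[OF z adm t]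
  have n: "T = TypeB \<Longrightarrow> 2 \<le> n" "T = TypeD \<Longrightarrow> 4 \<le> n" using adm by auto
  have weyl_closed: "l \<in> ?C \<and> r \<in> ?C" if "cover_weyl_rel T n l r" for l r
    using that
    by (induction rule: cover_weyl_rel.induct)
       (intro conjI closed; use n in \<open>auto simp: cover_gens_iff intro: node_if\<close>)+
  show "l \<in> ?C \<and> r \<in> ?C" if "cover_rel T n u v l r" for l r
    using that
  proof (induction rule: cover_rel.induct)
    case (weyl l r)
    then show ?case by (rule weyl_closed)
  qed (intro conjI closed; use n in \<open>auto simp: cover_gens_iff intro: node_if\<close>)+
qed

lemma spin_rel_closed:
  assumes adm: "admissible T n"
  shows "relators (spin_rel T n u v) \<subseteq> carrier (free_algebra (spin_gens T n))"
proof (rule relators_subset)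
  let ?C = "carrier (free_algebra (spin_gens T n))"
  have t: "st i \<in> ?C" if "i \<in> nodes T n" for i
    using that by (auto simp: spin_gens_iff intro!: free_algebra_closed)
  have z: "- 1 \<in> ?C"
    by (auto intro!: free_algebra_closed)
  note closed = free_algebra_closed free_algebra_power_closed free_algebra_sum_closed
    free_algebra_comm_closed free_algebra_brk_closeds[OF z adm t]
  have n: "T = TypeB \<Longrightarrow> 2 \<le> n" "T = TypeD \<Longrightarrow> 4 \<le> n" using adm by auto
  have weyl_closed: "l \<in> ?C \<and> r \<in> ?C" if "spin_weyl_rel T n l r" for l r
    using that
    by (induction rule: spin_weyl_rel.induct)
       (intro conjI closed; use n in \<open>auto simp: spin_gens_iff intro: node_if\<close>)+
  show "l \<in> ?C \<and> r \<in> ?C" if "spin_rel T n u v l r" for l r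
    using that
  proof (induction rule: spin_rel.induct)
    case (weyl l r)
    then show ?case by (rule weyl_closed)
  qed (intro conjI closed; use n in \<open>auto simp: spin_gens_iff intro: node_if\<close>)+
qed

section \<open>Specializing the central element\<close>

definition cover_ideal_gens :: "weyl_type \<Rightarrow> nat \<Rightarrow> complex \<Rightarrow> complex \<Rightarrow> cover_gen ncpoly \<Rightarrow>
  cover_gen ncpoly set" where
  "cover_ideal_gens T n u v \<epsilon> =
    gen ` (- cover_gens T n) \<union> relators (cover_rel T n u v) \<union> {vz - \<epsilon>}"

lemma realizes_covering_quotients:
  fixes u v :: complex
  assumes "admissible T n"
  defines "A \<equiv> covering_daha T n u v"
  shows "\<exists>\<pi>. realizes (quot_algebra A (Idl\<^bsub>A\<^esub> {covering_z T n u v \<ominus>\<^bsub>A\<^esub> \<one>\<^bsub>A\<^esub>})) \<pi>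
    (cover_ideal_gens T n u v 1)"
    and "\<exists>\<pi>. realizes (quot_algebra A (Idl\<^bsub>A\<^esub> {covering_z T n u v \<oplus>\<^bsub>A\<^esub> \<one>\<^bsub>A\<^esub>})) \<pi>
      (cover_ideal_gens T n u v (- 1))"
proof -
  let ?\<pi> = "\<lambda>p. presented_class (cover_gens T n) (cover_rel T n u v) (retract (cover_gens T n) p)"
  have A: "realizes A ?\<pi> (gen ` (- cover_gens T n) \<union> relators (cover_rel T n u v))"
    unfolding A_def covering_daha_def by (rule realizes_presented[OF cover_rel_closed[OF assms(1)]])
  have z: "?\<pi> vz = covering_z T n u v"
    by (simp add: covering_z_def retract_def cover_gens_def)
  have one: "?\<pi> 1 = \<one>\<^bsub>A\<^esub>" and add: "\<And>p q. ?\<pi> (p + q) = ?\<pi> p \<oplus>\<^bsub>A\<^esub> ?\<pi> q"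
    using A unfolding realizes_def by blast+
  show "\<exists>\<pi>. realizes (quot_algebra A (Idl\<^bsub>A\<^esub> {covering_z T n u v \<ominus>\<^bsub>A\<^esub> \<one>\<^bsub>A\<^esub>})) \<pi> (cover_ideal_gens
    T n u v 1)"
    using realizes_quot[OF A, of "{vz - 1}"] realizes_minus[OF A, of vz 1]
    unfolding cover_ideal_gens_def by (auto simp: z one)
  show "\<exists>\<pi>. realizes (quot_algebra A (Idl\<^bsub>A\<^esub> {covering_z T n u v \<oplus>\<^bsub>A\<^esub> \<one>\<^bsub>A\<^esub>})) \<pi> (cover_ideal_gens
    T n u v (- 1))"
    using realizes_quot[OF A, of "{vz + 1}"] add[of vz 1]
    unfolding cover_ideal_gens_def by (auto simp: z one)
qed

lemma eqm_relator: "relators R \<subseteq> X \<Longrightarrow> R l r \<Longrightarrow> eqm X l r"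
  by (rule eqm_base) (auto simp: relators_def)

context
  fixes T :: weyl_type and n :: nat and u v :: complex and \<epsilon> :: "cover_gen ncpoly" and X
  assumes adm: "admissible T n"
  defines "X \<equiv> cover_ideal_gens T n u v \<epsilon>"
begin

lemma cover_eqm: "cover_rel T n u v l r \<Longrightarrow> eqm X l r"
  by (rule eqm_relator[of "cover_rel T n u v"]) (auto simp: X_def cover_ideal_gens_def)

lemma cover_z: "eqm X vz \<epsilon>"
  by (rule eqm_base) (auto simp: X_def cover_ideal_gens_def)

lemma cover_z_mult: "eqm X l (vz * a * b) \<Longrightarrow> eqm X l (\<epsilon> * a * b)"
  by (erule eqm_trans) (intro eqm_mult eqm_refl cover_z)

lemma cover_brk:
  "i \<in> {1..n} \<Longrightarrow> j \<in> {1..n} \<Longrightarrow> eqm X (brk vz vt i j) (brk \<epsilon> vt i j)"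
  by (rule rel_brk[where n = n]) (auto intro: cover_z eqm_mult)

lemma cover_brk_bar_D:
  "i \<in> {1..n} \<Longrightarrow> j \<in> {1..n} \<Longrightarrow> eqm X (brk_bar_D vz vt n i j) (brk_bar_D \<epsilon> vt n i j)"
  by (rule rel_brk_bar_D) (auto intro: cover_z eqm_mult)

lemma cover_brk_bar_B:
  "2 \<le> n \<Longrightarrow> i \<in> {1..n} \<Longrightarrow> j \<in> {1..n} \<Longrightarrow> eqm X (brk_bar_B vz vt n i j) (brk_bar_B \<epsilon> vt n i j)"
  by (rule rel_brk_bar_B) (auto intro: cover_z eqm_mult)

lemma cover_brk_single:
  "i \<in> {1..n} \<Longrightarrow> eqm X (brk_single vz vt n i) (brk_single \<epsilon> vt n i)"
  by (rule rel_brk_single) (auto intro: cover_z eqm_mult)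

text \<open>The specialization also takes place inside the brackets, where \<open>vz\<close> occurs
  in the sign factors.\<close>

lemma cover_off:
  assumes "i \<in> {1..n}" "j \<in> {1..n}" "j \<noteq> i"
  shows "T = TypeA \<Longrightarrow> eqm X (comm (vy j) (vx i)) (scal u * \<epsilon> * brk \<epsilon> vt i j)"
    and "T = TypeD \<Longrightarrow> eqm X (comm (vy j) (vx i)) (scal u * \<epsilon> * (brk \<epsilon> vt i j - brk_bar_D \<epsilon> vt n i
      j))"
    and "T = TypeB \<Longrightarrow> eqm X (comm (vy j) (vx i)) (scal u * \<epsilon> * (brk \<epsilon> vt i j - brk_bar_B \<epsilon> vt n i
      j))"
  by (rule eqm_trans[OF cover_eqm[OF cover_rel.A_off]] eqm_trans[OF cover_eqm[OF cover_rel.D_off]]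
        eqm_trans[OF cover_eqm[OF cover_rel.B_off]];
      use assms adm in \<open>auto intro!: eqm_mult eqm_diff cover_z cover_brk cover_brk_bar_D
        cover_brk_bar_B\<close>)+

lemma cover_diag:
  assumes "i \<in> {1..n}"
  shows "T = TypeA \<Longrightarrow> eqm X (comm (vy i) (vx i)) (- scal u * \<epsilon> * (\<Sum>k\<in>{1..n} - {i}. brk \<epsilon> vt i k))"
    and "T = TypeD \<Longrightarrow> eqm X (comm (vy i) (vx i))
      (- scal u * \<epsilon> * (\<Sum>k\<in>{1..n} - {i}. brk \<epsilon> vt i k + brk_bar_D \<epsilon> vt n i k))"
    and "T = TypeB \<Longrightarrow> eqm X (comm (vy i) (vx i))
      (- scal u * \<epsilon> * (\<Sum>k\<in>{1..n} - {i}. brk \<epsilon> vt i k + brk_bar_B \<epsilon> vt n i k)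
        - scal v * \<epsilon> * brk_single \<epsilon> vt n i)"
  by (rule eqm_trans[OF cover_eqm[OF cover_rel.A_diag]] eqm_trans[OF cover_eqm[OF cover_rel.D_diag]]
        eqm_trans[OF cover_eqm[OF cover_rel.B_diag]];
      use assms adm in \<open>auto intro!: eqm_mult eqm_diff eqm_add eqm_sum eqm_uminus cover_z
        cover_brk cover_brk_bar_D cover_brk_bar_B cover_brk_single\<close>)+

end

text \<open>The covering algebra prescribes how \<open>t i\<close> passes the letters of index
  \<open>i + 1\<close>, the spin algebra those of index \<open>i\<close>. Multiplying by the
  involution on both sides translates one form into the other.\<close>

lemma eqm_involution_swap:
  assumes "eqm X (t ^ 2) 1" "eqm X (t * x) (y * t)"
  shows "eqm X (t * y) (x * t)"
proof -
  have "lact X t (lact X t C) = C" "lact X t (lact X x C) = lact X y (lact X t C)" for C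
    using assms by (simp_all add: eqm_iff_lact lact_mult power2_eq_square)
  then have "lact X t (lact X y C) = lact X x (lact X t C)" for C by metis
  then show ?thesis by (simp add: eqm_iff_lact lact_mult)
qed

lemma eqm_involution_swap_minus:
  assumes "eqm X (t ^ 2) 1" "eqm X (t * x) (- y * t)"
  shows "eqm X (t * y) (- x * t)"
  using eqm_involution_swap[OF assms(1), of "- x" y] eqm_uminus[OF assms(2)] by simp

text \<open>For involutions \<open>b * a\<close> is inverse to \<open>a * b\<close>. The left side
  is the spin relation, the right side the covering relation with \<open>- 1\<close> in the place of
  \<open>vz\<close>.\<close>

lemma eqm_anticommute_iff:
  assumes "eqm X (a ^ 2) 1" "eqm X (b ^ 2) 1"
  shows "eqm X ((a * b) ^ 2) (- 1) \<longleftrightarrow> eqm X (a * b) (- 1 * b * a)"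
proof -
  let ?A = "lact X a" and ?B = "lact X b" and ?N = "lact X (- 1)"
  have inv: "?A (?A C) = C" "?B (?B C) = C" for C
    using assms by (simp_all add: eqm_iff_lact lact_mult power2_eq_square)
  have "(\<forall>C. ?A (?B (?A (?B C))) = ?N C) \<longleftrightarrow> (\<forall>C. ?A (?B C) = ?N (?B (?A C)))"
  proof
    assume *: "\<forall>C. ?A (?B (?A (?B C))) = ?N C"
    show "\<forall>C. ?A (?B C) = ?N (?B (?A C))"
    proof
      fix C
      have "?A (?B (?A (?B (?B (?A C))))) = ?N (?B (?A C))" using * by blast
      then show "?A (?B C) = ?N (?B (?A C))" by (simp add: inv)
    qed
  next
    assume *: "\<forall>C. ?A (?B C) = ?N (?B (?A C))"
    show "\<forall>C. ?A (?B (?A (?B C))) = ?N C"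
    proof
      fix C
      have "?A (?B (?A (?B C))) = ?N (?B (?A (?A (?B C))))" using * by blast
      then show "?A (?B (?A (?B C))) = ?N C" by (simp add: inv)
    qed
  qed
  then show ?thesis
    by (simp only: eqm_iff_lact lact_mult power2_eq_square mult.assoc lact_one)
qed

text \<open>Again \<open>(b * a) ^ 2\<close> is inverse to \<open>(a * b) ^ 2\<close>, which relates
  the two forms of the length four relation.\<close>

lemma eqm_B_braid_iff:
  assumes "eqm X (a ^ 2) 1" "eqm X (b ^ 2) 1"
  shows "eqm X ((a * b) ^ 4) (- 1) \<longleftrightarrow> eqm X ((a * b) ^ 2) (- 1 * (b * a) ^ 2)"
proof -
  have inv: "eqm X ((a * b) ^ 2 * (b * a) ^ 2) 1" "eqm X ((b * a) ^ 2 * (a * b) ^ 2) 1"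
    using assms by (simp_all add: eqm_iff_lact lact_mult power2_eq_square)
  have eq: "(a * b) ^ 4 = (a * b) ^ 2 * (a * b) ^ 2"
    by (simp flip: power_add)
  show ?thesis
  proof
    assume "eqm X ((a * b) ^ 4) (- 1)"
    then have "eqm X ((a * b) ^ 2 * (a * b) ^ 2 * (b * a) ^ 2) (- 1 * (b * a) ^ 2)"
      unfolding eq by (intro eqm_mult eqm_refl)
    moreover have "eqm X ((a * b) ^ 2 * ((a * b) ^ 2 * (b * a) ^ 2)) ((a * b) ^ 2 * 1)"
      by (intro eqm_mult eqm_refl inv)
    ultimately show "eqm X ((a * b) ^ 2) (- 1 * (b * a) ^ 2)"
      using eqm_trans[OF eqm_sym] by (simp add: mult.assoc)
  next
    assume "eqm X ((a * b) ^ 2) (- 1 * (b * a) ^ 2)"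
    then have "eqm X ((a * b) ^ 2 * (a * b) ^ 2) (- 1 * (b * a) ^ 2 * (a * b) ^ 2)"
      by (intro eqm_mult eqm_refl)
    moreover have "eqm X (- 1 * ((b * a) ^ 2 * (a * b) ^ 2)) (- 1 * 1)"
      by (intro eqm_mult eqm_refl inv)
    ultimately show "eqm X ((a * b) ^ 4) (- 1)"
      unfolding eq using eqm_trans by (simp add: mult.assoc)
  qed
qed

section \<open>The specialization \<open>z = -1\<close>\<close>

fun cover_to_spin_gen :: "cover_gen \<Rightarrow> spin_gen ncpoly" where
  "cover_to_spin_gen (VX i) = sxi i"
| "cover_to_spin_gen (VY i) = sy i"
| "cover_to_spin_gen (VT i) = st i"
| "cover_to_spin_gen VZ = - 1"

fun spin_to_cover_gen :: "spin_gen \<Rightarrow> cover_gen ncpoly" where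
  "spin_to_cover_gen (SXi i) = vx i"
| "spin_to_cover_gen (SY i) = vy i"
| "spin_to_cover_gen (ST i) = vt i"

definition spin_ideal_gens :: "weyl_type \<Rightarrow> nat \<Rightarrow> complex \<Rightarrow> complex \<Rightarrow> spin_gen ncpoly set" where
  "spin_ideal_gens T n u v = gen ` (- spin_gens T n) \<union> relators (spin_rel T n u v)"

text \<open>Most relations go to their namesakes. Only three kinds change shape: commutation up to
  sign of distant nodes, the length four relation of type B, and the passage of \<open>t i\<close>
  past the letters of index \<open>i + 1\<close>.\<close>

lemma cover_to_spin_rel:
  assumes adm: "admissible T n" and rel: "cover_rel T n u v l r"
  shows "eqm (spin_ideal_gens T n u v) (subst cover_to_spin_gen l) (subst cover_to_spin_gen r)"
proof -
  let ?Y = "spin_ideal_gens T n u v"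
  note hom = alg_hom_rules[OF alg_hom_subst]
  have eqm: "eqm ?Y l r" if "spin_rel T n u v l r" for l r
    using that by (intro eqm_relator[of "spin_rel T n u v"]) (auto simp: spin_ideal_gens_def)
  note weyl_eqm = eqm[OF spin_rel.weyl]
  have inv: "eqm ?Y (st i ^ 2) 1" if "i \<in> nodes T n" for i
    using that by (intro weyl_eqm spin_weyl_rel.sq)
  have n: "T = TypeB \<Longrightarrow> 2 \<le> n" "T = TypeD \<Longrightarrow> 4 \<le> n" using adm by auto
  from rel show ?thesis
  proof (cases rule: cover_rel.cases)
    case weyl
    then show ?thesis
    proof (cases rule: cover_weyl_rel.cases)
      case (sq i)
      then show ?thesis using inv[of i] by (simp add: hom)
    next
      case (braid i)
      then show ?thesis using weyl_eqm[OF spin_weyl_rel.braid] by (simp add: hom)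
    next
      case (far i j)
      then show ?thesis
        using weyl_eqm[OF spin_weyl_rel.far[of i n j]] eqm_anticommute_iff[OF inv inv, of i j]
        by (auto simp: hom node_if)
    next
      case (B_far i)
      then show ?thesis
        using weyl_eqm[OF spin_weyl_rel.B_far[of T i n]] eqm_anticommute_iff[OF inv inv, of i n] n
        by (auto simp: hom)
    next
      case B_braid
      then show ?thesis
        using weyl_eqm[OF spin_weyl_rel.B_braid[of T n]] eqm_B_braid_iff[OF inv inv, of "n - 1" n] n
        by (auto simp: hom)
    next
      case D_braid
      then show ?thesis using weyl_eqm[OF spin_weyl_rel.D_braid] by (simp add: hom)
    next
      case (D_far i)
      then show ?thesis
        using weyl_eqm[OF spin_weyl_rel.D_far[of T i n]] eqm_anticommute_iff[OF inv inv, of i n] n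
        by (auto simp: hom)
    qed (simp add: hom)
  next
    case (z_central g)
    then show ?thesis by (simp add: hom)
  next
    case (xx i j)
    then show ?thesis using eqm[OF spin_rel.xx[of i n j]] by (simp add: hom)
  next
    case (yy i j)
    then show ?thesis using eqm[OF spin_rel.yy[of i n j]] by (simp add: hom)
  next
    case (tx_far i j)
    then show ?thesis using eqm[OF spin_rel.tx_far[of i n j]] by (simp add: hom)
  next
    case (ty_far i j)
    then show ?thesis using eqm[OF spin_rel.ty_far[of i n j]] by (simp add: hom)
  next
    case (tx i)
    then show ?thesis
      using eqm_involution_swap_minus[OF inv[of i] eqm[OF spin_rel.tx[of i n]]]
        by (simp add: hom node_if)
  next
    case (ty i)
    then show ?thesis
      using eqm_involution_swap[OF inv[of i] eqm[OF spin_rel.ty[of i n]]] by (simp add: hom node_if)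
  next
    case (A_off i j)
    then show ?thesis using eqm[OF spin_rel.A_off[of T i n j]] by (simp add: hom)
  next
    case (A_diag i)
    then show ?thesis using eqm[OF spin_rel.A_diag[of T i n]] by (simp add: hom)
  next
    case (D_tx_far j)
    then show ?thesis using eqm[OF spin_rel.D_tx_far[of T j n]] by (simp add: hom)
  next
    case (D_ty_far j)
    then show ?thesis using eqm[OF spin_rel.D_ty_far[of T j n]] by (simp add: hom)
  next
    case D_tx
    then show ?thesis using eqm[OF spin_rel.D_tx[of T n]] by (simp add: hom)
  next
    case D_ty
    then show ?thesis using eqm[OF spin_rel.D_ty[of T n]] by (simp add: hom)
  next
    case (D_off i j)
    then show ?thesis using eqm[OF spin_rel.D_off[of T i n j]] by (simp add: hom right_diff_distrib)
  next
    case (D_diag i)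
    then show ?thesis using eqm[OF spin_rel.D_diag[of T i n]] by (simp add: hom)
  next
    case (B_tx_far j)
    then show ?thesis using eqm[OF spin_rel.B_tx_far[of T j n]] by (simp add: hom)
  next
    case (B_ty_far j)
    then show ?thesis using eqm[OF spin_rel.B_ty_far[of T j n]] by (simp add: hom)
  next
    case B_tx
    then show ?thesis using eqm[OF spin_rel.B_tx[of T n]] by (simp add: hom)
  next
    case B_ty
    then show ?thesis using eqm[OF spin_rel.B_ty[of T n]] by (simp add: hom)
  next
    case (B_off i j)
    then show ?thesis using eqm[OF spin_rel.B_off[of T i n j]] by (simp add: hom right_diff_distrib)
  next
    case (B_diag i)
    then show ?thesis using eqm[OF spin_rel.B_diag[of T i n]] by (simp add: hom)
  qed
qed

lemma spin_to_cover_rel: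
  assumes adm: "admissible T n" and rel: "spin_rel T n u v l r"
  shows "eqm (cover_ideal_gens T n u v (- 1)) (subst spin_to_cover_gen l) (subst
    spin_to_cover_gen r)"
proof -
  let ?X = "cover_ideal_gens T n u v (- 1)"
  note hom = alg_hom_rules[OF alg_hom_subst]
  note eqm = cover_eqm[OF adm, of u v _ _ "- 1"]
  note z_mult = cover_z_mult[OF adm, of u v "- 1"]
  note weyl_eqm = eqm[OF cover_rel.weyl]
  have inv: "eqm ?X (vt i ^ 2) 1" if "i \<in> nodes T n" for i
    using that by (intro weyl_eqm cover_weyl_rel.sq)
  have n: "T = TypeB \<Longrightarrow> 2 \<le> n" "T = TypeD \<Longrightarrow> 4 \<le> n" using adm by auto
  from rel show ?thesis
  proof (cases rule: spin_rel.cases)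
    case weyl
    then show ?thesis
    proof (cases rule: spin_weyl_rel.cases)
      case (sq i)
      then show ?thesis using inv[of i] by (simp add: hom)
    next
      case (braid i)
      then show ?thesis using weyl_eqm[OF cover_weyl_rel.braid] by (simp add: hom)
    next
      case (far i j)
      then show ?thesis
        using z_mult[OF weyl_eqm[OF cover_weyl_rel.far[of i n j]]] eqm_anticommute_iff[OF inv
          inv, of i j]
        by (auto simp: hom node_if)
    next
      case (B_far i)
      then have "i \<le> n - 2" by auto
      then show ?thesis
        using B_far z_mult[OF weyl_eqm[OF cover_weyl_rel.B_far[OF \<open>T = TypeB\<close>, of i n]]]
          eqm_anticommute_iff[OF inv inv, of i n] n
        by (auto simp: hom)
    next
      case B_braid
      then show ?thesis
        using z_mult[of _ _ 1] weyl_eqm[OF cover_weyl_rel.B_braid[of T n]] eqm_B_braid_iff[OF inv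
          inv, of "n - 1" n] n
        by (auto simp: hom)
    next
      case D_braid
      then show ?thesis using weyl_eqm[OF cover_weyl_rel.D_braid] by (simp add: hom)
    next
      case (D_far i)
      then show ?thesis
        using z_mult[OF weyl_eqm[OF cover_weyl_rel.D_far[of T i n]]] eqm_anticommute_iff[OF inv
          inv, of i n] n
        by (auto simp: hom)
    qed
  next
    case (xx i j)
    then show ?thesis using z_mult[OF eqm[OF cover_rel.xx[of i n j]]] by (simp add: hom)
  next
    case (yy i j)
    \<comment> \<open>The spin relation includes \<open>i = j\<close>, which the covering relation
      excludes.\<close>
    then show ?thesis using eqm[OF cover_rel.yy[of i n j]] by (cases "i = j") (simp_all add: hom)
  next
    case (tx_far i j)
    then show ?thesis using z_mult[OF eqm[OF cover_rel.tx_far[of i n j]]] by (simp add: hom)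
  next
    case (ty_far i j)
    then show ?thesis using eqm[OF cover_rel.ty_far[of i n j]] by (simp add: hom)
  next
    case (tx i)
    then show ?thesis
      using eqm_involution_swap_minus[OF inv[of i], of "vx (i + 1)" "vx i"] z_mult[OF eqm[OF
        cover_rel.tx[of i n]]]
      by (simp add: hom node_if)
  next
    case (ty i)
    then show ?thesis
      using eqm_involution_swap[OF inv[of i] eqm[OF cover_rel.ty[of i n]]]
        by (simp add: hom node_if)
  next
    case (A_off i j)
    then show ?thesis using cover_off(1)[OF adm, of i j u v "- 1"] by (simp add: hom)
  next
    case (A_diag i)
    then show ?thesis using cover_diag(1)[OF adm, of i u v "- 1"] by (simp add: hom)
  next
    case (D_tx_far j)
    then show ?thesis using z_mult[OF eqm[OF cover_rel.D_tx_far[of T j n]]] by (simp add: hom)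
  next
    case (D_ty_far j)
    then show ?thesis using eqm[OF cover_rel.D_ty_far[of T j n]] by (simp add: hom)
  next
    case D_tx
    then show ?thesis using eqm[OF cover_rel.D_tx[of T n]] by (simp add: hom)
  next
    case D_ty
    then show ?thesis using eqm[OF cover_rel.D_ty[of T n]] by (simp add: hom)
  next
    case (D_off i j)
    then show ?thesis using cover_off(2)[OF adm, of i j u v "- 1"]
      by (simp add: hom right_diff_distrib)
  next
    case (D_diag i)
    then show ?thesis using cover_diag(2)[OF adm, of i u v "- 1"] by (simp add: hom)
  next
    case (B_tx_far j)
    then show ?thesis using z_mult[OF eqm[OF cover_rel.B_tx_far[of T j n]]] by (simp add: hom)
  next
    case (B_ty_far j)
    then show ?thesis using eqm[OF cover_rel.B_ty_far[of T j n]] by (simp add: hom)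
  next
    case B_tx
    then show ?thesis using eqm[OF cover_rel.B_tx[of T n]] by (simp add: hom)
  next
    case B_ty
    then show ?thesis using eqm[OF cover_rel.B_ty[of T n]] by (simp add: hom)
  next
    case (B_off i j)
    then show ?thesis using cover_off(3)[OF adm, of i j u v "- 1"]
      by (simp add: hom right_diff_distrib)
  next
    case (B_diag i)
    then show ?thesis using cover_diag(3)[OF adm, of i u v "- 1"] by (simp add: hom)
  qed
qed

theorem covering_minus_one_iso:
  assumes adm: "admissible T n"
  shows "algebra_isomorphic
       (quot_algebra (covering_daha T n u v)
         (Idl\<^bsub>covering_daha T n u v\<^esub>
           {covering_z T n u v \<oplus>\<^bsub>covering_daha T n u v\<^esub> \<one>\<^bsub>covering_daha T n u v\<^esub>}))
       (spin_daha T n u v)"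
proof -
  let ?X = "cover_ideal_gens T n u v (- 1)" and ?Y = "spin_ideal_gens T n u v"
  note hom = alg_hom_rules[OF alg_hom_subst]
  obtain \<pi> where \<pi>: "realizes (quot_algebra (covering_daha T n u v)
         (Idl\<^bsub>covering_daha T n u v\<^esub>
           {covering_z T n u v \<oplus>\<^bsub>covering_daha T n u v\<^esub> \<one>\<^bsub>covering_daha T n u v\<^esub>})) \<pi> ?X"
    using realizes_covering_quotients(2)[OF adm] by blast
  show ?thesis
  proof (rule realizes_iso[OF \<pi> _ alg_hom_subst[of cover_to_spin_gen] alg_hom_subst[of
    spin_to_cover_gen]])
    show "realizes (spin_daha T n u v)
        (\<lambda>p. presented_class (spin_gens T n) (spin_rel T n u v) (retract (spin_gens T n) p)) ?Y"
      unfolding spin_daha_def spin_ideal_gens_def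
      by (rule realizes_presented[OF spin_rel_closed[OF adm]])
  next
    fix x assume "x \<in> ?X"
    then consider g where "x = gen g" "g \<notin> cover_gens T n"
      | l r where "x = l - r" "cover_rel T n u v l r" | "x = vz + 1"
      by (auto simp: cover_ideal_gens_def relators_def)
    then show "eqm ?Y (subst cover_to_spin_gen x) 0"
    proof cases
      \<comment> \<open>Letters outside one alphabet become letters outside the other, and these
        generate part of the ideal.\<close>
      case 1
      then show ?thesis
        by (cases g) (auto intro!: eqm_base simp: cover_gens_def spin_ideal_gens_def spin_gens_def)
    next
      case 2
      then show ?thesis
        using cover_to_spin_rel[OF adm] by (simp add: hom eqm_def)
    next
      case 3
      then show ?thesis by (simp add: hom)
    qed
  next
    fix y assume "y \<in> ?Y"
    then consider g where "y = gen g" "g \<notin> spin_gens T n"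
      | l r where "y = l - r" "spin_rel T n u v l r"
      by (auto simp: spin_ideal_gens_def relators_def)
    then show "eqm ?X (subst spin_to_cover_gen y) 0"
    proof cases
      case 1
      then show ?thesis
        by (cases g) (auto intro!: eqm_base simp: cover_gens_def cover_ideal_gens_def spin_gens_def)
    next
      case 2
      then show ?thesis
        using spin_to_cover_rel[OF adm] by (simp add: hom eqm_def)
    qed
  next
    fix g
    \<comment> \<open>The letter \<open>vz\<close> comes back as \<open>- 1\<close>, to which it is
      congruent by the specialization.\<close>
    show "eqm ?X (subst spin_to_cover_gen (subst cover_to_spin_gen (gen g))) (gen g)"
      using eqm_sym[OF cover_z[OF adm, of u v "- 1"]] by (cases g) (simp_all add: hom)
  next
    fix h
    show "eqm ?Y (subst cover_to_spin_gen (subst spin_to_cover_gen (gen h))) (gen h)"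
      by (cases h) simp_all
  qed
qed

section \<open>Generation of the Weyl groups\<close>

lemma signed_perms_odd: "\<sigma> \<in> signed_perms n \<Longrightarrow> \<sigma> (- k) = - \<sigma> k"
  by (simp add: signed_perms_def)

lemma signed_perms_range:
  assumes "\<sigma> \<in> signed_perms n" "k \<noteq> 0" "\<bar>k\<bar> \<le> int n"
  shows "\<sigma> k \<noteq> 0" "\<bar>\<sigma> k\<bar> \<le> int n"
  using assms permutes_in_image[of \<sigma> "{k. k \<noteq> 0 \<and> \<bar>k\<bar> \<le> int n}" k] by (auto simp: signed_perms_def)

lemma signed_perms_inj: "\<sigma> \<in> signed_perms n \<Longrightarrow> \<sigma> a = \<sigma> b \<longleftrightarrow> a = b"
  by (auto simp: signed_perms_def dest: permutes_inj injD)

lemma weyl_group_signed_perms: "\<sigma> \<in> weyl_group T n \<Longrightarrow> \<sigma> \<in> signed_perms n"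
  by (cases T) auto

section \<open>The sign character of signed permutations\<close>

lemma prod_sgn:
  fixes f :: "int \<Rightarrow> int"
  assumes "finite A" "\<And>k. k \<in> A \<Longrightarrow> f k \<noteq> 0"
  shows "(\<Prod>k\<in>A. sgn (f k)) = (- 1) ^ card {k \<in> A. f k < 0}"
proof -
  have "(\<Prod>k\<in>A. sgn (f k)) = (\<Prod>k\<in>A. if f k < 0 then - 1 else 1)"
    using assms(2) by (intro prod.cong) (auto simp: sgn_if)
  also have "\<dots> = (- 1) ^ card {k \<in> A. f k < 0}"
    using assms(1) by (simp add: prod.If_cases Int_def)
  finally show ?thesis .
qed

lemma signed_perms_comp:
  assumes "\<sigma> \<in> signed_perms n" "\<rho> \<in> signed_perms n"
  shows "\<sigma> \<circ> \<rho> \<in> signed_perms n"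
  using assms by (auto simp: signed_perms_def intro: permutes_compose)

lemma even_negatives_iff:
  assumes "\<sigma> \<in> signed_perms n"
  shows "even (card {k \<in> {1..int n}. \<sigma> k < 0}) \<longleftrightarrow> (\<Prod>k\<in>{1..int n}. sgn (\<sigma> k)) = 1"
  using signed_perms_range(1)[OF assms]
  by (subst prod_sgn) (auto simp: minus_one_power_iff)

text \<open>By oddness the sign of \<open>\<sigma> (\<rho> k)\<close> splits into those of
  \<open>\<sigma> \<bar>\<rho> k\<bar>\<close> and \<open>\<rho> k\<close>, and
  \<open>k \<mapsto> \<bar>\<rho> k\<bar>\<close> permutes the positive indices. Hence the parity of
  the number of sign changes is a character, whose kernel is type D.\<close>

lemma prod_sgn_comp:
  assumes \<sigma>: "\<sigma> \<in> signed_perms n" and \<rho>: "\<rho> \<in> signed_perms n"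
  shows "(\<Prod>k\<in>{1..int n}. sgn (\<sigma> (\<rho> k))) = (\<Prod>k\<in>{1..int n}. sgn (\<sigma> k)) * (\<Prod>k\<in>{1..int n}. sgn (\<rho> k))"
proof -
  have "sgn (\<sigma> (\<rho> k)) = sgn (\<sigma> \<bar>\<rho> k\<bar>) * sgn (\<rho> k)" if "k \<in> {1..int n}" for k
    using signed_perms_range(1)[OF \<rho>, of k] signed_perms_odd[OF \<sigma>, of "\<rho> k"] that
    by (auto simp: abs_if sgn_minus)
  then have "(\<Prod>k\<in>{1..int n}. sgn (\<sigma> (\<rho> k)))
      = (\<Prod>k\<in>{1..int n}. sgn (\<sigma> \<bar>\<rho> k\<bar>)) * (\<Prod>k\<in>{1..int n}. sgn (\<rho> k))"
    by (simp add: prod.distrib)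
  moreover have "bij_betw (\<lambda>k. \<bar>\<rho> k\<bar>) {1..int n} {1..int n}"
  proof -
    have "inj_on (\<lambda>k. \<bar>\<rho> k\<bar>) {1..int n}"
    proof (rule inj_onI)
      fix a b assume ab: "a \<in> {1..int n}" "b \<in> {1..int n}" and "\<bar>\<rho> a\<bar> = \<bar>\<rho> b\<bar>"
      then have "\<rho> a = \<rho> b \<or> \<rho> a = \<rho> (- b)"
        using signed_perms_odd[OF \<rho>, of b] by (auto simp: abs_eq_iff)
      then show "a = b" using ab by (auto simp: signed_perms_inj[OF \<rho>])
    qed
    moreover have "(\<lambda>k. \<bar>\<rho> k\<bar>) ` {1..int n} \<subseteq> {1..int n}"
    proof
      fix y assume "y \<in> (\<lambda>k. \<bar>\<rho> k\<bar>) ` {1..int n}"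
      then obtain k where "k \<in> {1..int n}" "y = \<bar>\<rho> k\<bar>" by auto
      then show "y \<in> {1..int n}" using signed_perms_range[OF \<rho>, of k] by auto
    qed
    ultimately show ?thesis
      by (simp add: bij_betw_def endo_inj_surj)
  qed
  then have "(\<Prod>k\<in>{1..int n}. sgn (\<sigma> \<bar>\<rho> k\<bar>)) = (\<Prod>k\<in>{1..int n}. sgn (\<sigma> k))"
    by (rule prod.reindex_bij_betw)
  ultimately show ?thesis by simp
qed

lemma weyl_group_D_iff:
  "\<sigma> \<in> weyl_group TypeD n \<longleftrightarrow> \<sigma> \<in> signed_perms n \<and> (\<Prod>k\<in>{1..int n}. sgn (\<sigma> k)) = 1"
  using even_negatives_iff by auto

lemma id_weyl_group: "id \<in> weyl_group T n"
proof -
  have "id \<in> signed_perms n" by (auto simp: signed_perms_def permutes_id)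
  moreover have "(\<Prod>k\<in>{1..int n}. sgn (id k)) = 1" by (rule prod.neutral) auto
  ultimately show ?thesis
    using weyl_group_D_iff[of id n] by (cases T) (auto simp del: weyl_group.simps(3))
qed

lemma weyl_group_comp:
  assumes \<sigma>: "\<sigma> \<in> weyl_group T n" and \<rho>: "\<rho> \<in> weyl_group T n"
  shows "\<sigma> \<circ> \<rho> \<in> weyl_group T n"
proof -
  have sp: "\<sigma> \<in> signed_perms n" "\<rho> \<in> signed_perms n" "\<sigma> \<circ> \<rho> \<in> signed_perms n"
    using assms by (auto intro: weyl_group_signed_perms signed_perms_comp)
  show ?thesis
  proof (cases T)
    case TypeD
    then show ?thesis
      using sp \<sigma> \<rho> by (simp add: weyl_group_D_iff prod_sgn_comp del: weyl_group.simps)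
  qed (use sp \<sigma> \<rho> in auto)
qed

section \<open>Membership of the reflections in the Weyl groups\<close>

lemma signed_permsI:
  assumes "\<And>k. \<sigma> (\<sigma> k) = k" "\<And>k. \<sigma> (- k) = - \<sigma> k" "\<And>k. \<bar>k\<bar> > int n \<Longrightarrow> \<sigma> k = k"
  shows "\<sigma> \<in> signed_perms n"
proof -
  have "\<sigma> 0 = 0" using assms(2)[of 0] by simp
  moreover have "bij \<sigma>" using assms(1) by (rule involuntory_imp_bij)
  ultimately show ?thesis
    using assms by (auto simp: signed_perms_def permutes_bij_inv_into bij_iff permutes_def)
qed

lemma swap_refl_weyl_group:
  assumes "i \<in> {1..n}" "j \<in> {1..n}" "i \<noteq> j"
  shows "swap_refl i j \<in> weyl_group T n"
proof -
  have 1: "i \<noteq> j" "1 \<le> i" "1 \<le> j" using assms by auto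
  have k: "k = int i \<or> k = int j \<or> k = - int i \<or> k = - int j \<or>
    k \<notin> {int i, int j, - int i, - int j}" for k by blast
  have "swap_refl i j \<in> signed_perms n"
  proof (rule signed_permsI)
    show "swap_refl i j (swap_refl i j k) = k" "swap_refl i j (- k) = - swap_refl i j k" for k
      using k[of k] by (elim disjE; use 1 in \<open>simp add: swap_refl_apply[OF 1]\<close>)+
    show "swap_refl i j k = k" if "\<bar>k\<bar> > int n" for k
      using that assms by (auto simp: swap_refl_apply[OF 1])
  qed
  moreover have "swap_refl i j k > 0" if "k > 0" for k
    using that 1 by (auto simp: swap_refl_apply[OF 1])
  moreover from this have "(\<Prod>k\<in>{1..int n}. sgn (swap_refl i j k)) = 1"
    by (intro prod.neutral) auto
  ultimately show ?thesis
    using weyl_group_D_iff[of "swap_refl i j" n] by (cases T) (auto simp del: weyl_group.simps(3))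
qed

lemma swap_neg_refl_weyl_group:
  assumes "i \<in> {1..n}" "j \<in> {1..n}" "i \<noteq> j" "T \<noteq> TypeA"
  shows "swap_neg_refl i j \<in> weyl_group T n"
proof -
  have 1: "i \<noteq> j" "1 \<le> i" "1 \<le> j" using assms by auto
  have k: "k = int i \<or> k = int j \<or> k = - int i \<or> k = - int j \<or>
    k \<notin> {int i, int j, - int i, - int j}" for k by blast
  have "swap_neg_refl i j \<in> signed_perms n"
  proof (rule signed_permsI)
    show "swap_neg_refl i j (swap_neg_refl i j k) = k" "swap_neg_refl i j (- k)
      = - swap_neg_refl i j k" for k
      using k[of k] by (elim disjE; use 1 in \<open>simp add: swap_neg_refl_apply[OF 1]\<close>)+
    show "swap_neg_refl i j k = k" if "\<bar>k\<bar> > int n" for k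
      using that assms by (auto simp: swap_neg_refl_apply[OF 1])
  qed
  \<comment> \<open>Exactly two vectors become negative, an even number as type D demands.\<close>
  moreover have "{k \<in> {1..int n}. swap_neg_refl i j k < 0} = {int i, int j}"
    using assms by (auto simp: swap_neg_refl_apply[OF 1] split: if_splits)
  ultimately show ?thesis using assms by (cases T) auto
qed

lemma sign_refl_weyl_group:
  assumes "i \<in> {1..n}" "T = TypeB"
  shows "sign_refl i \<in> weyl_group T n"
  using assms by (auto simp: sign_refl_apply intro!: signed_permsI)

section \<open>Generation by the simple reflections\<close>

context
  fixes T :: weyl_type and n :: nat
  assumes adm: "admissible T n"
begin

lemma sref_weyl_group:
  assumes "i \<in> nodes T n"
  shows "sref T n i \<in> weyl_group T n"
proof -
  have "1 \<le> i" using assms by (cases T) auto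
  consider "i < n" | "T = TypeB" "i = n" | "T = TypeD" "i = n" "n \<ge> 4"
    using assms adm by (cases T) force+
  then show ?thesis
  proof cases
    case 1
    then show ?thesis
      using \<open>1 \<le> i\<close> by (simp add: sref_def swap_refl_weyl_group del: weyl_group.simps)
  next
    case 2
    then show ?thesis
      using \<open>1 \<le> i\<close> sign_refl_weyl_group[of n n T] by (simp add: sref_def del: weyl_group.simps)
  next
    case 3
    then show ?thesis
      using swap_neg_refl_weyl_group[of "n - 1" n n T] by (simp add: sref_def del: weyl_group.simps)
  qed
qed

lemma foldr_sref_weyl_group:
  "set w \<subseteq> nodes T n \<Longrightarrow> foldr (sref T n) w \<in> weyl_group T n"
proof (induction w)
  case (Cons i w)
  then show ?case
    using weyl_group_comp[OF sref_weyl_group[of i], of "foldr (sref T n) w"] by (simp add: comp_def)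
qed (use id_weyl_group in \<open>simp add: id_def\<close>)

lemma foldr_sref_rev:
  "set w \<subseteq> nodes T n \<Longrightarrow> foldr (sref T n) (rev w) (foldr (sref T n) w x) = x"
  by (induction w arbitrary: x) (auto simp: t_sq[OF adm sref_coxeter_action[OF adm]])

lemma foldr_sref_rev':
  "set w \<subseteq> nodes T n \<Longrightarrow> foldr (sref T n) w (foldr (sref T n) (rev w) x) = x"
  using foldr_sref_rev[of "rev w"] by simp

lemma par_nodes_subset: "par_nodes T n m \<subseteq> nodes T n"
  by (auto simp: par_nodes_def)

lemma sref_fixes:
  assumes "i \<in> par_nodes T n m" "\<bar>k\<bar> < int m"
  shows "sref T n i k = k"
proof -
  have i: "i \<in> nodes T n" "m \<le> i" "T = TypeD \<Longrightarrow> m < n"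
    using assms(1) by (auto simp: par_nodes_def split: if_splits)
  then consider "i < n" | "T = TypeB" "i = n" | "T = TypeD" "i = n" "m < n"
    by (cases T) force+
  then show ?thesis
    using assms(2) i(2) unfolding sref_apply[OF adm i(1)] by cases auto
qed

lemma foldr_fixes: "(\<And>i. i \<in> set w \<Longrightarrow> f i x = x) \<Longrightarrow> foldr f w x = x"
  by (induction w) auto

text \<open>The chain of stabilizers used for the relations also gives generation: removing the
  representative for the image of e_m leaves an element that fixes one more basis vector.\<close>

lemma weyl_group_generated_par:
  assumes "1 \<le> m" "\<sigma> \<in> weyl_group T n" "\<And>k. \<bar>k\<bar> < int m \<Longrightarrow> \<sigma> k = k"
  shows "\<exists>w. set w \<subseteq> par_nodes T n m \<and> foldr (sref T n) w = \<sigma>"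
  using assms
proof (induction "n + 1 - m" arbitrary: m \<sigma>)
  case 0
  have "\<sigma> k = k" for k
    using 0 weyl_group_signed_perms[of \<sigma> T n]
    by (cases "\<bar>k\<bar> < int m") (auto simp: signed_perms_def permutes_def)
  then show ?case by (intro exI[of _ "[]"]) (auto simp: fun_eq_iff)
next
  case (Suc d)
  have mn: "m \<le> n" using Suc.hyps(2) by simp
  have sp: "\<sigma> \<in> signed_perms n" using Suc.prems(2) by (rule weyl_group_signed_perms)
  define a where "a = \<sigma> (int m)"
  have a: "a \<noteq> 0" "\<bar>a\<bar> \<le> int n"
    using signed_perms_range[OF sp, of "int m"] mn Suc.prems(1) by (auto simp: a_def)
  \<comment> \<open>Indices below \<open>m\<close> are fixed, hence already taken as values, and
    \<open>\<sigma>\<close> is injective.\<close>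
  have "int m \<le> \<bar>a\<bar>"
  proof (rule ccontr)
    assume *: "\<not> int m \<le> \<bar>a\<bar>"
    then have "\<sigma> a = \<sigma> (int m)" using Suc.prems(3)[of a] by (simp add: a_def)
    then show False using * by (simp add: signed_perms_inj[OF sp])
  qed
  moreover have "a > 0" if "T = TypeA"
    using that Suc.prems(1,2) by (simp add: a_def)
  ultimately have orb: "a \<in> orbit T n m" using a by (auto simp: orbit_def)
  show ?case
  proof (cases "T = TypeD \<and> m = n")
    case True
    have "a = int n \<or> a = - int n" using orb True by (auto simp: orbit_def)
    \<comment> \<open>The only other candidate changes the sign of e_n alone, and parity excludes
      it.\<close>
    moreover have "a \<noteq> - int n"
    proof
      assume "a = - int n"
      then have "\<sigma> k < 0 \<longleftrightarrow> k = int n" if "1 \<le> k" "k \<le> int n" for k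
        using Suc.prems(1) Suc.prems(3)[of k] True that by (cases "k = int n") (auto simp: a_def)
      then have "{k \<in> {1..int n}. \<sigma> k < 0} = {int n}"
        using Suc.prems(1) True by auto
      then have "card {k \<in> {1..int n}. \<sigma> k < 0} = 1" by simp
      then show False using Suc.prems(2) True by auto
    qed
    ultimately have "\<sigma> (int n) = int n" using True by (simp add: a_def)
    moreover from this have "\<sigma> (- int n) = - int n" by (simp add: signed_perms_odd[OF sp])
    moreover have "\<sigma> k = k" if "\<bar>k\<bar> > int n" for k
      using sp that by (auto simp: signed_perms_def permutes_def)
    ultimately have "\<sigma> k = k" for k
    proof -
      consider "\<bar>k\<bar> < int n" | "k = int n" | "k = - int n" | "\<bar>k\<bar> > int n" by linarith
      then show ?thesis
        by cases (use Suc.prems(3)[of k] True \<open>\<sigma> (int n) = int n\<close> \<open>\<sigma> (- int n) = - int n\<close>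
          \<open>\<And>k. \<bar>k\<bar> > int n \<Longrightarrow> \<sigma> k = k\<close> in auto)
    qed
    then show ?thesis by (intro exI[of _ "[]"]) (auto simp: fun_eq_iff)
  next
    case False
    let ?c = "crep T n m a"
    have D: "T = TypeD \<longrightarrow> m < n" using False mn by auto
    have c: "set ?c \<subseteq> par_nodes T n m"
      using orb Suc.prems(1) False mn adm
      by (cases T) (auto simp: crep_def orbit_def par_nodes_def)
    then have c': "set ?c \<subseteq> nodes T n" using par_nodes_subset by blast
    define \<rho> where "\<rho> = foldr (sref T n) (rev ?c) \<circ> \<sigma>"
    have \<rho>: "\<rho> \<in> weyl_group T n"
      unfolding \<rho>_def using c' Suc.prems(2) by (intro weyl_group_comp foldr_sref_weyl_group) auto
    have \<rho>m: "\<rho> (int m) = int m"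
      using foldr_sref_rev[OF c', of "int m"] foldr_sref_crep[OF adm Suc.prems(1) orb D]
      by (simp add: \<rho>_def a_def)
    have "\<rho> k = k" if "\<bar>k\<bar> < int (m + 1)" for k
    proof (cases "\<bar>k\<bar> < int m")
      case True
      then show ?thesis
        unfolding \<rho>_def using c Suc.prems(3)[of k]
        by (auto intro!: foldr_fixes sref_fixes)
    next
      case False
      then have "k = int m \<or> k = - int m" using that by auto
      then show ?thesis
        using \<rho>m signed_perms_odd[OF weyl_group_signed_perms[OF \<rho>], of "int m"] by auto
    qed
    moreover have "d = n + 1 - (m + 1)" using Suc.hyps(2) by simp
    ultimately obtain w where w: "set w \<subseteq> par_nodes T n (m + 1)" "foldr (sref T n) w = \<rho>"
      using Suc.hyps(1)[of "m + 1" \<rho>] \<rho> by auto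
    have "par_nodes T n (m + 1) \<subseteq> par_nodes T n m" by (auto simp: par_nodes_def)
    moreover have "foldr (sref T n) (?c @ w) = \<sigma>"
      using foldr_sref_rev'[OF c'] by (simp add: w(2) \<rho>_def fun_eq_iff)
    ultimately show ?thesis using c w(1) by (intro exI[of _ "?c @ w"]) auto
  qed
qed

lemma weyl_group_generated:
  assumes "\<sigma> \<in> weyl_group T n"
  shows "\<exists>w. set w \<subseteq> nodes T n \<and> foldr (sref T n) w = \<sigma>"
proof -
  have "\<sigma> 0 = 0"
    using signed_perms_odd[OF weyl_group_signed_perms[OF assms], of 0] by simp
  then show ?thesis
    using weyl_group_generated_par[OF _ assms, of 1] par_nodes_subset by fastforce
qed

text \<open>The choice is arbitrary; \<open>cover_one_words\<close> shows that it does not matter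
  modulo the relations.\<close>

definition weyl_word :: "(int \<Rightarrow> int) \<Rightarrow> nat list" where
  "weyl_word \<sigma> = (SOME w. set w \<subseteq> nodes T n \<and> foldr (sref T n) w = \<sigma>)"

lemma weyl_word:
  assumes "\<sigma> \<in> weyl_group T n"
  shows "set (weyl_word \<sigma>) \<subseteq> nodes T n" "foldr (sref T n) (weyl_word \<sigma>) = \<sigma>"
  using someI_ex[OF weyl_group_generated[OF assms]] by (auto simp: weyl_word_def)

lemma weyl_group_inv:
  assumes "\<sigma> \<in> weyl_group T n"
  shows "inv_into UNIV \<sigma> \<in> weyl_group T n"
proof -
  let ?w = "weyl_word \<sigma>"
  have "inv_into UNIV (foldr (sref T n) ?w) = foldr (sref T n) (rev ?w)"
    by (rule inv_unique_comp)
       (use weyl_word(1)[OF assms] foldr_sref_rev foldr_sref_rev' in \<open>auto simp: fun_eq_iff\<close>)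
  then show ?thesis
    using foldr_sref_weyl_group[of "rev ?w"] weyl_word[OF assms] by simp
qed

section \<open>Words for the reflections\<close>

text \<open>Conjugating a reflection by \<open>P\<close> gives the reflection in the transported
  vectors; writing this as an intertwining identity avoids the inverse of \<open>P\<close>.\<close>

lemma conjugate_swap_refl:
  assumes "inj P" "\<And>y. P (- y) = - P y" "P (int a) = int a'" "P (int b) = int b'"
    and "a \<noteq> b" "1 \<le> a" "1 \<le> b" "a' \<noteq> b'" "1 \<le> a'" "1 \<le> b'"
  shows "P (swap_refl a b y) = swap_refl a' b' (P y)"
proof -
  have iff: "P y = int a' \<longleftrightarrow> y = int a" "P y = int b' \<longleftrightarrow> y = int b"
    "P y = - int a' \<longleftrightarrow> y = - int a" "P y = - int b' \<longleftrightarrow> y = - int b"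
    using assms(1-4) by (metis injD)+
  show ?thesis
    using assms(2-4) by (simp add: swap_refl_apply[OF assms(5-7)] swap_refl_apply[OF assms(8-10)]
      iff)
qed

lemma conjugate_swap_neg_refl:
  assumes "inj P" "\<And>y. P (- y) = - P y" "P (int a) = int a'" "P (int b) = int b'"
    and "a \<noteq> b" "1 \<le> a" "1 \<le> b" "a' \<noteq> b'" "1 \<le> a'" "1 \<le> b'"
  shows "P (swap_neg_refl a b y) = swap_neg_refl a' b' (P y)"
proof -
  have iff: "P y = int a' \<longleftrightarrow> y = int a" "P y = int b' \<longleftrightarrow> y = int b"
    "P y = - int a' \<longleftrightarrow> y = - int a" "P y = - int b' \<longleftrightarrow> y = - int b"
    using assms(1-4) by (metis injD)+
  show ?thesis
    using assms(2-4) by (simp add: swap_neg_refl_apply[OF assms(5-7)] swap_neg_refl_apply[OF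
      assms(8-10)] iff)
qed

lemma conjugate_sign_refl:
  assumes "inj P" "\<And>y. P (- y) = - P y" "P (int a) = int a'"
  shows "P (sign_refl a y) = sign_refl a' (P y)"
proof -
  have "P y = int a' \<longleftrightarrow> y = int a" "P y = - int a' \<longleftrightarrow> y = - int a"
    using assms(1-3) by (metis injD)+
  then have "\<bar>P y\<bar> = int a' \<longleftrightarrow> \<bar>y\<bar> = int a" by linarith
  then show ?thesis using assms(2) by (simp add: sign_refl_apply)
qed

text \<open>The generators are involutions, so \<open>rev l\<close> spells the inverse of
  \<open>l\<close>.\<close>

lemma foldr_sref_conjugate:
  assumes "set l \<subseteq> nodes T n" "foldr (sref T n) c = C"
    and "\<And>y. foldr (sref T n) l (C y) = C' (foldr (sref T n) l y)"
  shows "foldr (sref T n) (l @ c @ rev l) = C'"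
  using assms foldr_sref_rev'[OF assms(1)] by (auto simp: fun_eq_iff)

end

text \<open>The letters of the bracket at \<open>e = 1\<close>, arranged as a conjugate
  \<open>l @ c @ rev l\<close>. The next two words have the same shape.\<close>

definition brk_word :: "nat \<Rightarrow> nat \<Rightarrow> nat list" where
  "brk_word i j = (let a = min i j; b = max i j in rev [a + 1..<b] @ [a] @ [a + 1..<b])"

definition brk_bar_word :: "weyl_type \<Rightarrow> nat \<Rightarrow> nat \<Rightarrow> nat \<Rightarrow> nat list" where
  "brk_bar_word T n i j = (let a = min i j; b = max i j; l = [b..<n] @ [a..<n - 1]
     in l @ (if T = TypeD then [n] else [n, n - 1, n]) @ rev l)"

definition brk_single_word :: "nat \<Rightarrow> nat \<Rightarrow> nat list" where
  "brk_single_word n i = [i..<n] @ [n] @ rev [i..<n]"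

lemma brk_eq_word:
  assumes "i \<noteq> j" "1 \<le> i" "1 \<le> j"
  shows "brk 1 t i j = prod_list (map t (brk_word i j))"
proof -
  have "brk 1 t i j = prod_list (map t (rev [i..<j] @ [i + 1..<j]))" if "i < j" for i j
  proof -
    have "Suc (j - 1) = j" using that by simp
    then show ?thesis using that by (simp add: brk_def Let_def up_def down_def del: upt_Suc)
  qed
  moreover have "brk 1 t i j = prod_list (map t (rev [j..<i] @ [j + 1..<i]))" if "j < i" for i j
  proof -
    have "Suc (i - 1) = i" using that by simp
    then show ?thesis using that by (simp add: brk_def Let_def up_def down_def del: upt_Suc)
  qed
  moreover have "rev [a..<b] = rev [a + 1..<b] @ [a]" if "a < b" for a b
    using that by (simp add: upt_conv_Cons)
  ultimately show ?thesis
    using assms by (cases "i < j") (auto simp: brk_word_def min_def max_def)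
qed

lemma brk_bar_D_eq_word:
  assumes "2 \<le> n"
  shows "brk_bar_D 1 t n i j = prod_list (map t (brk_bar_word TypeD n i j))"
  using assms
  by (simp add: brk_bar_D_def brk_bar_word_def Let_def up_def down_def mult.assoc Suc_diff_Suc
    numeral_2_eq_2
      del: upt_Suc)

lemma brk_bar_B_eq_word:
  assumes "2 \<le> n"
  shows "brk_bar_B 1 t n i j = prod_list (map t (brk_bar_word TypeB n i j))"
  using assms
  by (simp add: brk_bar_B_def brk_bar_word_def Let_def up_def down_def mult.assoc Suc_diff_Suc
    numeral_2_eq_2
      del: upt_Suc)

lemma brk_single_eq_word:
  assumes "1 \<le> n"
  shows "brk_single 1 t n i = prod_list (map t (brk_single_word n i))"
  using assms
  by (simp add: brk_single_def brk_single_word_def up_def down_def mult.assoc del: upt_Suc)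

lemma swap_refl_commute: "swap_refl i j = swap_refl j i"
  by (simp add: swap_refl_def transpose_commute)

lemma swap_neg_refl_commute: "1 \<le> i \<Longrightarrow> 1 \<le> j \<Longrightarrow> i \<noteq> j \<Longrightarrow> swap_neg_refl i j = swap_neg_refl j i"
  by (auto simp: fun_eq_iff swap_neg_refl_apply)

context
  fixes T :: weyl_type and n :: nat
  assumes adm: "admissible T n"
begin

text \<open>For \<open>a < b\<close> the outer run fixes e_a and carries e_{a+1} to e_b, so it
  conjugates the simple reflection at \<open>a\<close> into the swap of \<open>a\<close> and
  \<open>b\<close>.\<close>

lemma brk_word:
  assumes i: "i \<in> {1..n}" and j: "j \<in> {1..n}" and ij: "i \<noteq> j"
  shows "set (brk_word i j) \<subseteq> nodes T n" "foldr (sref T n) (brk_word i j) = swap_refl i j"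
proof -
  have *: "set (rev [a + 1..<b] @ [a] @ [a + 1..<b]) \<subseteq> nodes T n \<and>
      foldr (sref T n) (rev [a + 1..<b] @ [a] @ [a + 1..<b]) = swap_refl a b"
    if ab: "1 \<le> a" "a < b" "b \<le> n" for a b
  proof
    let ?l = "rev [a + 1..<b]"
    have l: "set ?l \<subseteq> nodes T n" using ab by (auto intro: node_if)
    show "set (?l @ [a] @ [a + 1..<b]) \<subseteq> nodes T n" using ab by (auto intro: node_if)
    have "foldr (sref T n) (?l @ [a] @ rev ?l) = swap_refl a b"
    proof (rule foldr_sref_conjugate[OF adm l])
      show "foldr (sref T n) [a] = swap_refl a (a + 1)"
        using ab by (auto simp: sref_def)
      have "foldr (sref T n) ?l (int a) = int a"
      proof (cases "b = a + 1")
        case False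
        then show ?thesis
          using ab by (intro foldr_sref_par_nodes[OF adm]) (auto simp: par_nodes_def intro: node_if)
      qed simp
      then show "foldr (sref T n) ?l (swap_refl a (a + 1) y)
        = swap_refl a b (foldr (sref T n) ?l y)" for y
        using ab foldr_sref_desc[OF adm, of "a + 1" b]
        by (intro conjugate_swap_refl[OF adm inj_foldr_sref[OF adm l] foldr_sref_uminus[OF adm
          l]]) auto
    qed
    then show "foldr (sref T n) (?l @ [a] @ [a + 1..<b]) = swap_refl a b" by simp
  qed
  show "set (brk_word i j) \<subseteq> nodes T n" "foldr (sref T n) (brk_word i j) = swap_refl i j"
    using *[of i j] *[of j i] i j ij swap_refl_commute[of i j]
    unfolding brk_word_def Let_def by (cases "i < j"; simp add: min_def max_def)+
qed

text \<open>The middle part is the negative swap of \<open>n - 1\<close> and \<open>n\<close>: a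
  simple reflection in type D, the conjugate of the ordinary swap by node \<open>n\<close> in type
  B. The outer part carries e_n to e_b and e_{n-1} to e_a.\<close>

lemma brk_bar_word:
  assumes T: "T = TypeB \<or> T = TypeD" and i: "i \<in> {1..n}" and j: "j \<in> {1..n}" and ij: "i \<noteq> j"
  shows "set (brk_bar_word T n i j) \<subseteq> nodes T n" "foldr (sref T n) (brk_bar_word T n i j)
    = swap_neg_refl i j"
proof -
  define c where "c = (if T = TypeD then [n] else [n, n - 1, n])"
  have n: "2 \<le> n" using T adm by auto
  have *: "set (([b..<n] @ [a..<n - 1]) @ c @ rev ([b..<n] @ [a..<n - 1])) \<subseteq> nodes T n \<and>
      foldr (sref T n) (([b..<n] @ [a..<n - 1]) @ c @ rev ([b..<n] @ [a..<n - 1]))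
        = swap_neg_refl a b"
    if ab: "1 \<le> a" "a < b" "b \<le> n" for a b
  proof
    let ?l = "[b..<n] @ [a..<n - 1]"
    have nodes: "nodes T n = {1..n}" using T by auto
    have l: "set ?l \<subseteq> nodes T n" using ab by (auto simp: nodes)
    show "set (?l @ c @ rev ?l) \<subseteq> nodes T n" using ab n by (auto simp: nodes c_def)
    show "foldr (sref T n) (?l @ c @ rev ?l) = swap_neg_refl a b"
    proof (rule foldr_sref_conjugate[OF adm l])
      show "foldr (sref T n) c = swap_neg_refl (n - 1) n"
      proof (cases "T = TypeD")
        case True
        then show ?thesis by (auto simp: c_def sref_def)
      next
        case False
        define p where "p = n - 1"
        have p: "p < n" "1 \<le> p" "int n = int p + 1" using n by (auto simp: p_def)
        have "sref T n n (sref T n p (sref T n n y)) = swap_neg_refl p n y" for y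
        proof -
          have 1: "sref T n n x = (if x = int p + 1 \<or> x = - int p - 1 then - x else x)" for x
            using False T p by (auto simp: sref_def sign_refl_apply)
          have 2: "sref T n p x = (if x = int p then int p + 1 else if x = int p + 1 then int p
            else if x = - int p then - int p - 1 else if x = - int p - 1 then - int p else x)" for x
            using p by (simp add: sref_def swap_refl_apply)
          have 3: "swap_neg_refl p n x = (if x = int p then - int p - 1 else if x
            = int p + 1 then - int p
            else if x = - int p then int p + 1 else if x = - int p - 1 then int p else x)" for x
            using p by (simp add: swap_neg_refl_apply)
          have "y = int p \<or> y = - int p \<or> y = int p + 1 \<or> y = - int p - 1 \<or>
            y \<notin> {int p, - int p, int p + 1, - int p - 1}" by blast
          then show ?thesis
            by (elim disjE; use p(2) in \<open>simp add: 1 2 3\<close>)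
        qed
        then show ?thesis using False by (simp add: c_def p_def fun_eq_iff)
      qed
      have "foldr (sref T n) [a..<n - 1] (int n) = int n"
        by (rule foldr_fixes[OF adm]) (use ab in \<open>auto simp: sref_def swap_refl_apply\<close>)
      moreover have "foldr (sref T n) [b..<n] (int a) = int a"
        by (rule foldr_fixes[OF adm]) (use ab in \<open>auto simp: sref_def swap_refl_apply\<close>)
      ultimately have "foldr (sref T n) ?l (int n) = int b" "foldr (sref T n) ?l (int (n - 1))
        = int a"
        using ab foldr_sref_asc[OF adm, of b n] foldr_sref_asc[OF adm, of a "n - 1"] by auto
      then show "foldr (sref T n) ?l (swap_neg_refl (n - 1) n y)
        = swap_neg_refl a b (foldr (sref T n) ?l y)" for y
        using ab n
        by (intro conjugate_swap_neg_refl[OF adm inj_foldr_sref[OF adm l] foldr_sref_uminus[OF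
          adm l]]) auto
    qed
  qed
  show "set (brk_bar_word T n i j) \<subseteq> nodes T n" "foldr (sref T n) (brk_bar_word T n i j)
    = swap_neg_refl i j"
    using *[of i j] *[of j i] i j ij swap_neg_refl_commute[of i j]
    unfolding brk_bar_word_def Let_def c_def by (cases "i < j"; simp add: min_def max_def)+
qed

lemma brk_single_word:
  assumes T: "T = TypeB" and i: "i \<in> {1..n}"
  shows "set (brk_single_word n i) \<subseteq> nodes T n" "foldr (sref T n) (brk_single_word n i)
    = sign_refl i"
proof -
  let ?l = "[i..<n]"
  have l: "set ?l \<subseteq> nodes T n" using T i by auto
  show "set (brk_single_word n i) \<subseteq> nodes T n" using T i by (auto simp: brk_single_word_def)
  show "foldr (sref T n) (brk_single_word n i) = sign_refl i"
    unfolding brk_single_word_def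
  proof (rule foldr_sref_conjugate[OF adm l])
    show "foldr (sref T n) [n] = sign_refl n" using T by (auto simp: sref_def)
    show "foldr (sref T n) ?l (sign_refl n y) = sign_refl i (foldr (sref T n) ?l y)" for y
      using i foldr_sref_asc[OF adm, of i n]
      by (intro conjugate_sign_refl[OF adm inj_foldr_sref[OF adm l] foldr_sref_uminus[OF adm l]])
        auto
  qed
qed

end

section \<open>The specialization \<open>z = 1\<close>\<close>

lemma cherednik_gens_iff:
  "CX i \<in> cherednik_gens T n \<longleftrightarrow> 1 \<le> i \<and> i \<le> n" "CY i \<in> cherednik_gens T n \<longleftrightarrow> 1 \<le> i \<and> i \<le> n"
  "CW \<sigma> \<in> cherednik_gens T n \<longleftrightarrow> \<sigma> \<in> weyl_group T n"
  by (auto simp: cherednik_gens_def)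

lemma weyl_group_range:
  assumes "\<sigma> \<in> weyl_group T n" "i \<in> {1..n}"
  shows "\<sigma> (int i) \<noteq> 0" "\<bar>\<sigma> (int i)\<bar> \<le> int n"
  using signed_perms_range[OF weyl_group_signed_perms[OF assms(1)], of "int i"] assms(2) by auto

lemma signed_ext_closed:
  assumes "\<And>k. k \<in> {1..n} \<Longrightarrow> f k \<in> carrier (free_algebra G)" "a \<noteq> 0" "\<bar>a\<bar> \<le> int n"
  shows "signed_ext f a \<in> carrier (free_algebra G)"
proof -
  have "nat \<bar>a\<bar> \<in> {1..n}" using assms(2,3) by auto
  then have "f (nat \<bar>a\<bar>) \<in> carrier (free_algebra G)" by (rule assms(1))
  then show ?thesis by (auto simp: signed_ext_def abs_if intro!: free_algebra_closed)
qed

lemma cherednik_rel_closed: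
  assumes adm: "admissible T n"
  shows "relators (cherednik_rel T n u v) \<subseteq> carrier (free_algebra (cherednik_gens T n))"
proof (rule relators_subset)
  let ?C = "carrier (free_algebra (cherednik_gens T n))"
  note closed = free_algebra_closed free_algebra_sum_closed free_algebra_comm_closed
  note W = id_weyl_group weyl_group_comp weyl_group_inv[OF adm] swap_refl_weyl_group
    swap_neg_refl_weyl_group sign_refl_weyl_group
  fix l r assume "cherednik_rel T n u v l r"
  then show "l \<in> ?C \<and> r \<in> ?C"
  proof (induction rule: cherednik_rel.induct)
    case (wx \<sigma> i)
    moreover have "signed_ext cx (\<sigma> (int i)) \<in> ?C"
      using weyl_group_range[OF wx]
        by (intro signed_ext_closed) (auto intro!: closed simp: cherednik_gens_iff)
    ultimately show ?case
      using W by (auto intro!: closed simp: cherednik_gens_iff simp del: weyl_group.simps)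
  next
    case (wy \<sigma> i)
    moreover have "signed_ext cy (\<sigma> (int i)) \<in> ?C"
      using weyl_group_range[OF wy]
        by (intro signed_ext_closed) (auto intro!: closed simp: cherednik_gens_iff)
    ultimately show ?case
      using W by (auto intro!: closed simp: cherednik_gens_iff simp del: weyl_group.simps)
  qed (intro conjI closed; auto simp: cherednik_gens_iff intro!: W simp del: weyl_group.simps)+
qed

definition cherednik_ideal_gens :: "weyl_type \<Rightarrow> nat \<Rightarrow> complex \<Rightarrow> complex \<Rightarrow> cherednik_gen ncpoly
  set" where
  "cherednik_ideal_gens T n u v = gen ` (- cherednik_gens T n) \<union> relators (cherednik_rel T n u v)"

text \<open>Indices that are not nodes must be sent to zero explicitly: in types B and D,
  \<open>sref T n i\<close> with \<open>i > n\<close> is an element of the group.\<close>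

fun cover_to_cherednik_gen :: "weyl_type \<Rightarrow> nat \<Rightarrow> cover_gen \<Rightarrow> cherednik_gen ncpoly" where
  "cover_to_cherednik_gen T n (VX i) = cx i"
| "cover_to_cherednik_gen T n (VY i) = cy i"
| "cover_to_cherednik_gen T n (VT i) = (if i \<in> nodes T n then cw (sref T n i) else 0)"
| "cover_to_cherednik_gen T n VZ = 1"

text \<open>The value zero discards the meaningless \<open>weyl_word\<close> of a function outside
  the group.\<close>

fun cherednik_to_cover_gen :: "weyl_type \<Rightarrow> nat \<Rightarrow> cherednik_gen \<Rightarrow> cover_gen ncpoly" where
  "cherednik_to_cover_gen T n (CX i) = vx i"
| "cherednik_to_cover_gen T n (CY i) = vy i"
| "cherednik_to_cover_gen T n (CW \<sigma>) =
    (if \<sigma> \<in> weyl_group T n then prod_list (map vt (weyl_word T n \<sigma>)) else 0)"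

section \<open>From the covering algebra at z = 1 to the Cherednik algebra\<close>

context
  fixes T :: weyl_type and n :: nat and u v :: complex and Y
  assumes adm: "admissible T n"
  defines "Y \<equiv> cherednik_ideal_gens T n u v"
begin

lemma cherednik_eqm: "cherednik_rel T n u v l r \<Longrightarrow> eqm Y l r"
  by (rule eqm_relator[of "cherednik_rel T n u v"]) (auto simp: Y_def cherednik_ideal_gens_def)

lemma cherednik_word:
  assumes "set w \<subseteq> nodes T n"
  shows "eqm Y (prod_list (map (\<lambda>i. cw (sref T n i)) w)) (cw (foldr (sref T n) w))"
  using assms
proof (induction w)
  case Nil
  show ?case using eqm_sym[OF cherednik_eqm[OF cherednik_rel.w_one]] by (simp add: id_def)
next
  case (Cons i w)
  have "eqm Y (cw (sref T n i) * cw (foldr (sref T n) w)) (cw (sref T n i \<circ> foldr (sref T n) w))"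
    using Cons.prems
    by (intro cherednik_eqm cherednik_rel.w_mult sref_weyl_group foldr_sref_weyl_group adm) auto
  then show ?case
    using Cons eqm_trans[OF eqm_mult[OF eqm_refl]] by (simp add: comp_def)
qed

text \<open>The Cherednik relations conjugate a letter, whereas the covering relations move it past
  a generator.\<close>

lemma cherednik_conj:
  assumes \<sigma>: "\<sigma> \<in> weyl_group T n" and conj: "eqm Y (cw \<sigma> * a * cw (inv_into UNIV \<sigma>)) b"
  shows "eqm Y (cw \<sigma> * a) (b * cw \<sigma>)"
proof -
  have "inv_into UNIV \<sigma> \<circ> \<sigma> = id"
    using weyl_group_signed_perms[OF \<sigma>]
      by (intro inv_o_cancel) (auto simp: inj_def signed_perms_inj)
  then have inv: "eqm Y (cw (inv_into UNIV \<sigma>) * cw \<sigma>) 1"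
    using cherednik_eqm[OF cherednik_rel.w_mult[OF weyl_group_inv[OF adm \<sigma>] \<sigma>]]
      cherednik_eqm[OF cherednik_rel.w_one] eqm_trans by fastforce
  have "eqm Y (cw \<sigma> * a * 1) (cw \<sigma> * a * (cw (inv_into UNIV \<sigma>) * cw \<sigma>))"
    by (intro eqm_mult eqm_refl eqm_sym[OF inv])
  also have "eqm Y \<dots> (b * cw \<sigma>)"
    using eqm_mult[OF conj eqm_refl[of Y "cw \<sigma>"]] by (simp add: mult.assoc)
  finally show ?thesis by simp
qed

lemma cherednik_cw_cx:
  assumes "i \<in> nodes T n" "k \<in> {1..n}"
  shows "eqm Y (cw (sref T n i) * cx k) (signed_ext cx (sref T n i (int k)) * cw (sref T n i))"
    and "eqm Y (cw (sref T n i) * cy k) (signed_ext cy (sref T n i (int k)) * cw (sref T n i))"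
  using cherednik_rel.wx[OF sref_weyl_group[OF adm assms(1)] assms(2)]
    cherednik_rel.wy[OF sref_weyl_group[OF adm assms(1)] assms(2)]
  by (auto intro!: cherednik_conj sref_weyl_group[OF adm assms(1)] intro: cherednik_eqm simp del:
    weyl_group.simps)

abbreviation (input) "\<phi> \<equiv> subst (cover_to_cherednik_gen T n)"

lemma cherednik_word_subst:
  assumes "set w \<subseteq> nodes T n"
  shows "eqm Y (prod_list (map (\<lambda>i. \<phi> (vt i)) w)) (cw (foldr (sref T n) w))"
proof -
  have "map (\<lambda>i. \<phi> (vt i)) w = map (\<lambda>i. cw (sref T n i)) w" using assms by auto
  then show ?thesis using cherednik_word[OF assms] by (simp only:)
qed

lemma cherednik_words_eq:
  assumes "set w \<subseteq> nodes T n" "set w' \<subseteq> nodes T n" "\<And>k. foldr (sref T n) w k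
    = foldr (sref T n) w' k"
  shows "eqm Y (prod_list (map (\<lambda>i. \<phi> (vt i)) w)) (prod_list (map (\<lambda>i. \<phi> (vt i)) w'))"
proof -
  have "foldr (sref T n) w' = foldr (sref T n) w" using assms(3) by (simp add: fun_eq_iff)
  then show ?thesis
    using eqm_trans[OF cherednik_word_subst[OF assms(1)] eqm_sym] cherednik_word_subst[OF
      assms(2)] by simp
qed

lemma cherednik_brk:
  assumes "i \<in> {1..n}" "j \<in> {1..n}" "i \<noteq> j"
  shows "eqm Y (brk 1 (\<lambda>i. \<phi> (vt i)) i j) (cw (swap_refl i j))"
  using cherednik_word_subst[OF brk_word(1)[OF adm assms]] assms
  by (simp add: brk_eq_word brk_word(2)[OF adm assms])

lemma cherednik_brk_bar_D:
  assumes "T = TypeD" "i \<in> {1..n}" "j \<in> {1..n}" "i \<noteq> j"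
  shows "eqm Y (brk_bar_D 1 (\<lambda>i. \<phi> (vt i)) n i j) (cw (swap_neg_refl i j))"
  using cherednik_word_subst[OF brk_bar_word(1)[OF adm _ assms(2-4)]] assms adm
    brk_bar_word(2)[OF adm _ assms(2-4)]
  by (simp add: brk_bar_D_eq_word)

lemma cherednik_brk_bar_B:
  assumes "T = TypeB" "i \<in> {1..n}" "j \<in> {1..n}" "i \<noteq> j"
  shows "eqm Y (brk_bar_B 1 (\<lambda>i. \<phi> (vt i)) n i j) (cw (swap_neg_refl i j))"
  using cherednik_word_subst[OF brk_bar_word(1)[OF adm _ assms(2-4)]] assms adm
    brk_bar_word(2)[OF adm _ assms(2-4)]
  by (simp add: brk_bar_B_eq_word)

lemma cherednik_brk_single:
  assumes "T = TypeB" "i \<in> {1..n}"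
  shows "eqm Y (brk_single 1 (\<lambda>i. \<phi> (vt i)) n i) (cw (sign_refl i))"
proof -
  have "1 \<le> n" using assms(2) by simp
  then show ?thesis
    using cherednik_word_subst[OF brk_single_word(1)[OF adm assms]]
    by (simp only: brk_single_eq_word brk_single_word(2)[OF adm assms])
qed

text \<open>At z = 1 each relation equates two words with the same product in the group, and the
  multiplication table reduces both to one group letter.\<close>

lemma cover_to_cherednik_weyl_rel:
  assumes "cover_weyl_rel T n l r"
  shows "eqm Y (\<phi> l) (\<phi> r)"
proof -
  note hom = alg_hom_rules[OF alg_hom_subst]
  note cox = coxeter_actionD[OF sref_coxeter_action[OF adm]]
  have n: "T = TypeB \<Longrightarrow> 2 \<le> n" "T = TypeD \<Longrightarrow> 4 \<le> n" using adm by auto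
  have words: "eqm Y (prod_list (map (\<lambda>i. \<phi> (vt i)) w)) (prod_list (map (\<lambda>i. \<phi> (vt i)) w'))"
    if "set w \<subseteq> nodes T n" "set w' \<subseteq> nodes T n" "\<And>k. foldr (sref T n) w k
      = foldr (sref T n) w' k" for w w'
    by (rule cherednik_words_eq[OF that])
  have z: "\<phi> vz = 1" by simp
  from assms show ?thesis
  proof (cases rule: cover_weyl_rel.cases)
    case z_sq
    then show ?thesis by (simp add: hom)
  next
    case (sq i)
    then show ?thesis using words[of "[i, i]" "[]"] cox(1)[of i]
      by (simp only: hom power2_eq_square list.map prod_list.Cons prod_list.Nil mult_1_right) simp
  next
    case (braid i)
    then show ?thesis using words[of "[i, i + 1, i]" "[i + 1, i, i + 1]"] cox(2)[of i]
      by (simp only: hom list.map prod_list.Cons prod_list.Nil mult_1_right mult.assoc) (simp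
        add: node_if)
  next
    case (far i j)
    have "foldr (sref T n) [i, j] k = foldr (sref T n) [j, i] k" for k
      using cox(3)[of i j k] cox(3)[of j i k] far by (cases "i < j") auto
    then show ?thesis using far words[of "[i, j]" "[j, i]"]
      by (simp only: hom z list.map prod_list.Cons prod_list.Nil mult_1_right mult_1_left
        mult.assoc) (simp add: node_if)
  next
    case (B_far i)
    then show ?thesis using words[of "[i, n]" "[n, i]"] cox(4)[of i] n
      by (simp only: hom z list.map prod_list.Cons prod_list.Nil mult_1_right mult_1_left
        mult.assoc) simp
  next
    case B_braid
    then show ?thesis using words[of "[n - 1, n, n - 1, n]" "[n, n - 1, n, n - 1]"] cox(5) n
      by (simp only: hom z list.map prod_list.Cons prod_list.Nil mult_1_right mult_1_left
        mult.assoc power2_eq_square) simp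
  next
    case D_braid
    then show ?thesis using words[of "[n - 2, n, n - 2]" "[n, n - 2, n]"] cox(7) n
      by (simp only: hom z list.map prod_list.Cons prod_list.Nil mult_1_right mult_1_left
        mult.assoc) simp
  next
    case (D_far i)
    then show ?thesis using words[of "[i, n]" "[n, i]"] cox(6)[of i] n
      by (simp only: hom z list.map prod_list.Cons prod_list.Nil mult_1_right mult_1_left
        mult.assoc) simp
  qed
qed

lemma cover_to_cherednik_rel:
  assumes "cover_rel T n u v l r"
  shows "eqm Y (\<phi> l) (\<phi> r)"
proof -
  note hom = alg_hom_rules[OF alg_hom_subst]
  have n: "T = TypeB \<Longrightarrow> 2 \<le> n" "T = TypeD \<Longrightarrow> 4 \<le> n" using adm by auto
  have nn: "n \<in> nodes T n" if "T = TypeB \<or> T = TypeD" using that n by auto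
  note s = sref_apply[OF adm]
  have sB: "sref T n n (int k) = (if k = n then - int n else int k)" if "T = TypeB" for k
    unfolding s[OF nn[OF disjI1[OF that]]] using that by simp
  have sD: "sref T n n (int n) = 1 - int n" if "T = TypeD"
    unfolding s[OF nn[OF disjI2[OF that]]] using that by simp
  have sD': "sref T n n (int k) = int k" if "T = TypeD" "k \<noteq> n" "k \<noteq> n - 1" for k
    unfolding s[OF nn[OF disjI2[OF that(1)]]] using that n(2) by auto
  have vt: "eqm Y (\<phi> (vt i * vx k)) (signed_ext cx (sref T n i (int k)) * \<phi> (vt i))"
    "eqm Y (\<phi> (vt i * vy k)) (signed_ext cy (sref T n i (int k)) * \<phi> (vt i))"
    if "i \<in> nodes T n" "k \<in> {1..n}" for i k
    using cherednik_cw_cx[OF that] that(1) by (simp_all add: hom)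
  \<comment> \<open>Both index orders occur: \<open>swap_refl i j\<close> in the off-diagonal
    relations, \<open>swap_refl k i\<close> in the diagonal sums.\<close>
  have refl:
    "eqm Y (cw (swap_refl i k)) (brk 1 (\<lambda>i. \<phi> (vt i)) i k)"
    "eqm Y (cw (swap_refl k i)) (brk 1 (\<lambda>i. \<phi> (vt i)) i k)"
    if "i \<in> {1..n}" "k \<in> {1..n} - {i}" for i k
    using eqm_sym[OF cherednik_brk, of i k] that by (auto simp: swap_refl_commute[of i])
  have refl_D:
    "eqm Y (cw (swap_neg_refl i k)) (brk_bar_D 1 (\<lambda>i. \<phi> (vt i)) n i k)"
    "eqm Y (cw (swap_neg_refl k i)) (brk_bar_D 1 (\<lambda>i. \<phi> (vt i)) n i k)"
    if "T = TypeD" "i \<in> {1..n}" "k \<in> {1..n} - {i}" for i k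
    using eqm_sym[OF cherednik_brk_bar_D[OF that(1)], of i k] that(2,3) swap_neg_refl_commute[of
      i k] by auto
  have refl_B:
    "eqm Y (cw (swap_neg_refl i k)) (brk_bar_B 1 (\<lambda>i. \<phi> (vt i)) n i k)"
    "eqm Y (cw (swap_neg_refl k i)) (brk_bar_B 1 (\<lambda>i. \<phi> (vt i)) n i k)"
    if "T = TypeB" "i \<in> {1..n}" "k \<in> {1..n} - {i}" for i k
    using eqm_sym[OF cherednik_brk_bar_B[OF that(1)], of i k] that(2,3) swap_neg_refl_commute[of
      i k] by auto
  note congs = eqm_mult eqm_refl eqm_diff eqm_add eqm_sum refl refl_D refl_B eqm_sym[OF
    cherednik_brk_single]
  from assms show ?thesis
  proof (cases rule: cover_rel.cases)
    case weyl
    then show ?thesis by (rule cover_to_cherednik_weyl_rel)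
  next
    case (z_central g)
    then show ?thesis by (simp add: hom)
  next
    case (xx i j)
    then show ?thesis using cherednik_eqm[OF cherednik_rel.xx[of i n j]] by (simp add: hom)
  next
    case (yy i j)
    then show ?thesis using cherednik_eqm[OF cherednik_rel.yy[of i n j]] by (simp add: hom)
  next
    case (tx_far i j)
    then show ?thesis using vt(1)[of i j] by (simp add: hom node_if s signed_ext_def)
  next
    case (ty_far i j)
    then show ?thesis using vt(2)[of i j] by (simp add: hom node_if s signed_ext_def)
  next
    case (tx i)
    then show ?thesis
      using vt(1)[of i "i + 1"]
      by (simp add: hom node_if s signed_ext_def)
  next
    case (ty i)
    then show ?thesis
      using vt(2)[of i "i + 1"]
      by (simp add: hom node_if s signed_ext_def)
  next
    case (A_off i j)
    have "eqm Y (comm (cy j) (cx i)) (scal u * brk 1 (\<lambda>i. \<phi> (vt i)) i j)"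
      by (rule eqm_trans[OF cherednik_eqm[OF cherednik_rel.A_off]]; (intro congs)?; use A_off in
        auto)
    then show ?thesis by (simp add: A_off hom)
  next
    case (A_diag i)
    have "eqm Y (comm (cy i) (cx i)) (- scal u * (\<Sum>k\<in>{1..n} - {i}. brk 1 (\<lambda>i. \<phi> (vt i)) i k))"
      by (rule eqm_trans[OF cherednik_eqm[OF cherednik_rel.A_diag]]; (intro congs)?; use A_diag
        in auto)
    then show ?thesis by (simp add: A_diag hom)
  next
    case (D_tx_far j)
    then show ?thesis using vt(1)[of n j] nn sD'[of j] by (auto simp: hom signed_ext_def)
  next
    case (D_ty_far j)
    then show ?thesis using vt(2)[of n j] nn sD'[of j] by (auto simp: hom signed_ext_def)
  next
    case D_tx
    then show ?thesis using vt(1)[of n n] nn n sD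
      by (auto simp: hom signed_ext_def nat_diff_distrib)
  next
    case D_ty
    then show ?thesis using vt(2)[of n n] nn n sD
      by (auto simp: hom signed_ext_def nat_diff_distrib)
  next
    case (D_off i j)
    have "eqm Y (comm (cy j) (cx i))
        (scal u * (brk 1 (\<lambda>i. \<phi> (vt i)) i j - brk_bar_D 1 (\<lambda>i. \<phi> (vt i)) n i j))"
      by (rule eqm_trans[OF cherednik_eqm[OF cherednik_rel.D_off]]; (intro congs)?; use D_off in
        auto)
    then show ?thesis by (simp add: D_off hom)
  next
    case (D_diag i)
    have "eqm Y (comm (cy i) (cx i))
        (- scal u * (\<Sum>k\<in>{1..n} - {i}. brk 1 (\<lambda>i. \<phi> (vt i)) i k + brk_bar_D 1 (\<lambda>i. \<phi> (vt i)) n i k))"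
      by (rule eqm_trans[OF cherednik_eqm[OF cherednik_rel.D_diag]]; (intro congs)?; use D_diag
        in auto)
    then show ?thesis by (simp add: D_diag hom)
  next
    case (B_tx_far j)
    then show ?thesis using vt(1)[of n j] nn sB[of j] by (auto simp: hom signed_ext_def)
  next
    case (B_ty_far j)
    then show ?thesis using vt(2)[of n j] nn sB[of j] by (auto simp: hom signed_ext_def)
  next
    case B_tx
    then show ?thesis using vt(1)[of n n] nn n sB[of n] by (auto simp: hom signed_ext_def)
  next
    case B_ty
    then show ?thesis using vt(2)[of n n] nn n sB[of n] by (auto simp: hom signed_ext_def)
  next
    case (B_off i j)
    have "eqm Y (comm (cy j) (cx i))
        (scal u * (brk 1 (\<lambda>i. \<phi> (vt i)) i j - brk_bar_B 1 (\<lambda>i. \<phi> (vt i)) n i j))"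
      by (rule eqm_trans[OF cherednik_eqm[OF cherednik_rel.B_off]]; (intro congs)?; use B_off in
        auto)
    then show ?thesis by (simp add: B_off hom)
  next
    case (B_diag i)
    have "eqm Y (comm (cy i) (cx i))
        (- scal u * (\<Sum>k\<in>{1..n} - {i}. brk 1 (\<lambda>i. \<phi> (vt i)) i k + brk_bar_B 1 (\<lambda>i. \<phi> (vt i)) n i k)
          - scal v * brk_single 1 (\<lambda>i. \<phi> (vt i)) n i)"
      by (rule eqm_trans[OF cherednik_eqm[OF cherednik_rel.B_diag]]; (intro congs)?; use B_diag
        in auto)
    then show ?thesis by (simp add: B_diag hom)
  qed
qed

end

section \<open>From the Cherednik algebra to the covering algebra at z = 1\<close>

context
  fixes T :: weyl_type and n :: nat and u v :: complex and X
  assumes adm: "admissible T n"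
  defines "X \<equiv> cover_ideal_gens T n u v 1"
begin

lemma cover_one_eqm: "cover_rel T n u v l r \<Longrightarrow> eqm X l r"
  unfolding X_def by (rule cover_eqm[OF adm])

lemma cover_one_z_mult: "eqm X l (vz * a * b) \<Longrightarrow> eqm X l (a * b)"
  using cover_z_mult[OF adm, of u v 1 l a b] by (simp add: X_def)

text \<open>This is the instance of the presentation theorem that matters: the covering generators
  acting on residue classes, with z replaced by 1.\<close>

lemma cover_one_coxeter_action: "coxeter_action T n (\<lambda>i. lact X (vt i))"
proof -
  note eqm = cover_one_eqm[OF cover_rel.weyl]
  have lact: "lact X a C = lact X b C" if "eqm X a b" for a b C
    using that by (simp add: eqm_iff_lact)
  show ?thesis
    unfolding coxeter_action_def
  proof (intro conjI allI ballI impI)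
    fix i C assume "i \<in> nodes T n"
    then show "lact X (vt i) (lact X (vt i) C) = C"
      using lact[OF eqm[OF cover_weyl_rel.sq[of i]]] by (simp add: lact_mult power2_eq_square)
  next
    fix i C assume "1 \<le> i \<and> i + 1 < n"
    then show "lact X (vt i) (lact X (vt (i + 1)) (lact X (vt i) C))
        = lact X (vt (i + 1)) (lact X (vt i) (lact X (vt (i + 1)) C))"
      using lact[OF eqm[OF cover_weyl_rel.braid[of i]]] by (simp add: lact_mult)
  next
    fix i j C assume "1 \<le> i \<and> i + 1 < j \<and> j < n"
    then show "lact X (vt i) (lact X (vt j) C) = lact X (vt j) (lact X (vt i) C)"
      using lact[OF cover_one_z_mult[OF eqm[OF cover_weyl_rel.far[of i n j]]]]
        by (simp add: lact_mult)
  next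
    fix i C assume "T = TypeB" "1 \<le> i \<and> i + 1 < n"
    moreover from this have "i \<le> n - 2" by auto
    ultimately show "lact X (vt i) (lact X (vt n) C) = lact X (vt n) (lact X (vt i) C)"
      using lact[OF cover_one_z_mult[OF eqm[OF cover_weyl_rel.B_far[of T i]]]]
        by (simp add: lact_mult)
  next
    fix C assume "T = TypeB"
    then have "eqm X ((vt (n - 1) * vt n) ^ 2) ((vt n * vt (n - 1)) ^ 2)"
      using cover_one_z_mult[of _ "(vt n * vt (n - 1)) ^ 2" 1] eqm[OF cover_weyl_rel.B_braid] by
        simp
    from lact[OF this, of C]
    show "lact X (vt (n - 1)) (lact X (vt n) (lact X (vt (n - 1)) (lact X (vt n) C)))
        = lact X (vt n) (lact X (vt (n - 1)) (lact X (vt n) (lact X (vt (n - 1)) C)))"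
      by (simp add: lact_mult power2_eq_square)
  next
    fix i C assume "T = TypeD" "1 \<le> i \<and> i < n \<and> i \<noteq> n - 2"
    then show "lact X (vt i) (lact X (vt n) C) = lact X (vt n) (lact X (vt i) C)"
      using lact[OF cover_one_z_mult[OF eqm[OF cover_weyl_rel.D_far[of T i]]]]
        by (simp add: lact_mult)
  next
    fix C assume "T = TypeD"
    then show "lact X (vt (n - 2)) (lact X (vt n) (lact X (vt (n - 2)) C))
        = lact X (vt n) (lact X (vt (n - 2)) (lact X (vt n) C))"
      using lact[OF eqm[OF cover_weyl_rel.D_braid]] by (simp add: lact_mult)
  qed
qed

lemma lact_prod_list: "lact X (prod_list (map f w)) C = foldr (\<lambda>i. lact X (f i)) w C"
  by (induction w) (simp_all add: lact_mult)

text \<open>The presentation theorem gives equal operators, and faithfulness of \<open>lact\<close>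
  turns them into congruent words.\<close>

lemma cover_one_words:
  assumes "set w \<subseteq> nodes T n" "set w' \<subseteq> nodes T n" "foldr (sref T n) w = foldr (sref T n) w'"
  shows "eqm X (prod_list (map vt w)) (prod_list (map vt w'))"
  using coxeter_presentation[OF adm cover_one_coxeter_action assms]
  by (simp add: eqm_iff_lact lact_prod_list)

text \<open>One uniform rule, with signs absorbed by \<open>signed_ext\<close>. The two cases that
  are not defining relations, \<open>k = i < n\<close> and \<open>k = n - 1\<close> for node
  \<open>n\<close> of type D, follow by multiplying with the involution.\<close>

lemma cover_one_vt:
  assumes i: "i \<in> nodes T n" and k: "k \<in> {1..n}"
  shows "eqm X (vt i * vx k) (signed_ext vx (sref T n i (int k)) * vt i)"
    and "eqm X (vt i * vy k) (signed_ext vy (sref T n i (int k)) * vt i)"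
proof -
  have sq: "eqm X (vt i ^ 2) 1"
    by (rule cover_one_eqm[OF cover_rel.weyl[OF cover_weyl_rel.sq[OF i]]])
  have n: "T = TypeB \<Longrightarrow> 2 \<le> n" "T = TypeD \<Longrightarrow> 4 \<le> n" using adm by auto
  have "0 < i" using i by (cases T) auto
  consider "i < n" "k = i" | "i < n" "k = i + 1" | "i < n" "k \<noteq> i" "k \<noteq> i + 1"
    | "T = TypeB" "i = n" "k = n" | "T = TypeB" "i = n" "k \<noteq> n"
    | "T = TypeD" "i = n" "k = n" | "T = TypeD" "i = n" "k = n - 1"
    | "T = TypeD" "i = n" "k \<noteq> n" "k \<noteq> n - 1"
    using i by (cases T) force+
  then have "eqm X (vt i * vx k) (signed_ext vx (sref T n i (int k)) * vt i) \<and>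
    eqm X (vt i * vy k) (signed_ext vy (sref T n i (int k)) * vt i)"
  proof cases
    case 1
    then show ?thesis
      using eqm_involution_swap[OF sq cover_one_z_mult[OF cover_one_eqm[OF cover_rel.tx[of i n]]]]
        eqm_involution_swap[OF sq cover_one_eqm[OF cover_rel.ty[of i n]]] \<open>0 < i\<close>
      by (simp add: sref_apply[OF adm i] signed_ext_def nat_add_distrib)
  next
    case 2
    then show ?thesis
      using cover_one_z_mult[OF cover_one_eqm[OF cover_rel.tx[of i n]]]
        cover_one_eqm[OF cover_rel.ty[of i n]] \<open>0 < i\<close>
      by (simp add: sref_apply[OF adm i] signed_ext_def)
  next
    case 3
    then show ?thesis
      using cover_one_z_mult[OF cover_one_eqm[OF cover_rel.tx_far[of i n k]]]
        cover_one_eqm[OF cover_rel.ty_far[of i n k]] \<open>0 < i\<close> k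
      by (simp add: sref_apply[OF adm i] signed_ext_def)
  next
    case 4
    then show ?thesis
      using cover_one_eqm[OF cover_rel.B_tx] cover_one_eqm[OF cover_rel.B_ty] n
      unfolding sref_apply[OF adm i] by (simp add: signed_ext_def)
  next
    case 5
    then show ?thesis
      using cover_one_z_mult[OF cover_one_eqm[OF cover_rel.B_tx_far[of T k n]]]
        cover_one_eqm[OF cover_rel.B_ty_far[of T k n]] k
      unfolding sref_apply[OF adm i] by (simp add: signed_ext_def)
  next
    case 6
    then have "nat (int n - 1) = n - 1" by simp
    with 6 show ?thesis
      using cover_one_eqm[OF cover_rel.D_tx] cover_one_eqm[OF cover_rel.D_ty] n
      unfolding sref_apply[OF adm i] by (simp add: signed_ext_def)
  next
    case 7
    then have "int k = int n - 1" using n by simp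
    with 7 show ?thesis
      using eqm_involution_swap_minus[OF sq, of "vx n" "vx k"] cover_one_eqm[OF cover_rel.D_tx]
        eqm_involution_swap_minus[OF sq, of "vy n" "vy k"] cover_one_eqm[OF cover_rel.D_ty] n
      unfolding sref_apply[OF adm i] by (simp add: signed_ext_def)
  next
    case 8
    then have "int k \<noteq> int n - 1" using n by auto
    with 8 show ?thesis
      using cover_one_z_mult[OF cover_one_eqm[OF cover_rel.D_tx_far[of T k n]]]
        cover_one_eqm[OF cover_rel.D_ty_far[of T k n]] k
      unfolding sref_apply[OF adm i] by (simp add: signed_ext_def)
  qed
  then show "eqm X (vt i * vx k) (signed_ext vx (sref T n i (int k)) * vt i)"
    "eqm X (vt i * vy k) (signed_ext vy (sref T n i (int k)) * vt i)" by auto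
qed

lemma signed_ext_uminus: "k \<noteq> 0 \<Longrightarrow> signed_ext f (- k) = - signed_ext f k"
  by (auto simp: signed_ext_def)

text \<open>The letter \<open>f k\<close> moves through the word for \<open>\<sigma>\<close> one
  generator at a time. The two words then cancel because their concatenation represents the
  identity.\<close>

lemma cover_one_word_conj:
  fixes f :: "nat \<Rightarrow> cover_gen ncpoly"
  assumes f: "\<And>i k. i \<in> nodes T n \<Longrightarrow> k \<in> {1..n} \<Longrightarrow>
      eqm X (vt i * f k) (signed_ext f (sref T n i (int k)) * vt i)"
    and \<sigma>: "\<sigma> \<in> weyl_group T n" and k: "k \<in> {1..n}"
  shows "eqm X (prod_list (map vt (weyl_word T n \<sigma>)) * f k * prod_list (map vt (weyl_word T n
    (inv_into UNIV \<sigma>))))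
    (signed_ext f (\<sigma> (int k)))"
proof -
  let ?w = "weyl_word T n \<sigma>" and ?w' = "weyl_word T n (inv_into UNIV \<sigma>)"
  \<comment> \<open>Intermediate images of \<open>k\<close> may be negative, so the rule has to be
    extended to signed indices.\<close>
  have f': "eqm X (vt i * signed_ext f a) (signed_ext f (sref T n i a) * vt i)"
    if i: "i \<in> nodes T n" and a: "a \<noteq> 0" "\<bar>a\<bar> \<le> int n" for i a
  proof (cases "a > 0")
    case True
    then have "nat a \<in> {1..n}" using a by auto
    then show ?thesis using f[OF i, of "nat a"] True by (simp add: signed_ext_def)
  next
    case False
    then have "nat (- a) \<in> {1..n}" using a by auto
    then have "eqm X (vt i * f (nat (- a))) (signed_ext f (sref T n i (- a)) * vt i)"
      using f[OF i, of "nat (- a)"] False by simp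
    moreover have "sref T n i a \<noteq> 0"
      using signed_perms_range[OF weyl_group_signed_perms[OF sref_weyl_group[OF adm i]] a] by simp
    ultimately have "eqm X (- (vt i * f (nat (- a)))) (signed_ext f (sref T n i a) * vt i)"
      using eqm_uminus by (fastforce simp: sref_uminus[OF adm i] signed_ext_uminus)
    then show ?thesis using False a by (simp add: signed_ext_def)
  qed
  have word: "eqm X (prod_list (map vt w) * f k) (signed_ext f (foldr (sref T n) w (int k)) *
    prod_list (map vt w))"
    if "set w \<subseteq> nodes T n" for w
    using that
  proof (induction w)
    case Nil
    then show ?case by (simp add: signed_ext_def)
  next
    case (Cons i w)
    let ?a = "foldr (sref T n) w (int k)"
    have "foldr (sref T n) w \<in> weyl_group T n"
      using Cons.prems by (intro foldr_sref_weyl_group adm) auto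
    note a = weyl_group_range[OF this k]
    have "eqm X (vt i * (prod_list (map vt w) * f k)) (vt i * (signed_ext f ?a * prod_list (map
      vt w)))"
      using Cons by (intro eqm_mult[OF eqm_refl]) auto
    also have "vt i * (signed_ext f ?a * prod_list (map vt w))
      = (vt i * signed_ext f ?a) * prod_list (map vt w)"
      by (simp add: mult.assoc)
    also have "eqm X \<dots> (signed_ext f (sref T n i ?a) * vt i * prod_list (map vt w))"
      using Cons.prems a by (intro eqm_mult[OF f' eqm_refl]) auto
    finally show ?case by (simp add: mult.assoc)
  qed
  note w = weyl_word[OF adm \<sigma>] and w' = weyl_word[OF adm weyl_group_inv[OF adm \<sigma>]]
  have "bij \<sigma>"
    using weyl_group_signed_perms[OF \<sigma>] by (auto simp: signed_perms_def permutes_bij)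
  then have "eqm X (prod_list (map vt (?w @ ?w'))) (prod_list (map vt []))"
    using w w' by (intro cover_one_words) (auto simp: fun_eq_iff bij_is_surj surj_f_inv_f)
  then have inv: "eqm X (prod_list (map vt ?w) * prod_list (map vt ?w')) 1" by simp
  have "eqm X (prod_list (map vt ?w) * f k * prod_list (map vt ?w'))
      (signed_ext f (\<sigma> (int k)) * prod_list (map vt ?w) * prod_list (map vt ?w'))"
    using word[OF w(1)] w(2) by (intro eqm_mult[OF _ eqm_refl]) auto
  also have "\<dots> = signed_ext f (\<sigma> (int k)) * (prod_list (map vt ?w) * prod_list (map vt ?w'))"
    by (simp add: mult.assoc)
  also have "eqm X \<dots> (signed_ext f (\<sigma> (int k)) * 1)"
    by (rule eqm_mult[OF eqm_refl inv])
  finally show ?thesis by simp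
qed

abbreviation (input) "\<psi> \<equiv> subst (cherednik_to_cover_gen T n)"

text \<open>Any convenient word for \<open>\<sigma>\<close> may replace the chosen one, notably the
  explicit words of the brackets.\<close>

lemma cover_one_word_cw:
  assumes "set w \<subseteq> nodes T n" "foldr (sref T n) w = \<sigma>"
  shows "eqm X (prod_list (map vt w)) (\<psi> (cw \<sigma>))"
proof -
  have "\<sigma> \<in> weyl_group T n" using foldr_sref_weyl_group[OF adm assms(1)] assms(2) by simp
  then show ?thesis
    using cover_one_words[OF assms(1) weyl_word(1)[OF adm]] assms(2) weyl_word(2)[OF adm] by simp
qed

lemma cover_one_brk:
  assumes "i \<in> {1..n}" "j \<in> {1..n}" "i \<noteq> j"
  shows "eqm X (brk 1 vt i j) (\<psi> (cw (swap_refl i j)))"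
  using cover_one_word_cw[OF brk_word[OF adm assms]] assms by (simp add: brk_eq_word)

lemma cover_one_brk_bar_D:
  assumes "T = TypeD" "i \<in> {1..n}" "j \<in> {1..n}" "i \<noteq> j"
  shows "eqm X (brk_bar_D 1 vt n i j) (\<psi> (cw (swap_neg_refl i j)))"
  using cover_one_word_cw[OF brk_bar_word[OF adm _ assms(2-4)]] assms(1) adm
  by (simp add: brk_bar_D_eq_word)

lemma cover_one_brk_bar_B:
  assumes "T = TypeB" "i \<in> {1..n}" "j \<in> {1..n}" "i \<noteq> j"
  shows "eqm X (brk_bar_B 1 vt n i j) (\<psi> (cw (swap_neg_refl i j)))"
  using cover_one_word_cw[OF brk_bar_word[OF adm _ assms(2-4)]] assms(1) adm
  by (simp add: brk_bar_B_eq_word)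

lemma cover_one_brk_single:
  assumes "T = TypeB" "i \<in> {1..n}"
  shows "eqm X (brk_single 1 vt n i) (\<psi> (cw (sign_refl i)))"
  using cover_one_word_cw[OF brk_single_word[OF adm assms]] assms adm
  by (simp add: brk_single_eq_word)

lemma cherednik_to_cover_rel:
  assumes "cherednik_rel T n u v l r"
  shows "eqm X (\<psi> l) (\<psi> r)"
proof -
  note hom = alg_hom_rules[OF alg_hom_subst]
  have W: "\<psi> (cw \<sigma>) = prod_list (map vt (weyl_word T n \<sigma>))" if "\<sigma> \<in> weyl_group T n" for \<sigma>
    using that by simp
  have refl:
    "eqm X (brk 1 vt i k) (\<psi> (cw (swap_refl i k)))" "eqm X (brk 1 vt i k) (\<psi> (cw (swap_refl k i)))"
    if "i \<in> {1..n}" "k \<in> {1..n} - {i}" for i k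
    using cover_one_brk[of i k] that by (auto simp: swap_refl_commute[of i] simp del: subst_gen)
  have refl_D:
    "eqm X (brk_bar_D 1 vt n i k) (\<psi> (cw (swap_neg_refl i k)))"
    "eqm X (brk_bar_D 1 vt n i k) (\<psi> (cw (swap_neg_refl k i)))"
    if "T = TypeD" "i \<in> {1..n}" "k \<in> {1..n} - {i}" for i k
    using cover_one_brk_bar_D[OF that(1), of i k] that(2,3) swap_neg_refl_commute[of i k]
    by (auto simp del: subst_gen)
  have refl_B:
    "eqm X (brk_bar_B 1 vt n i k) (\<psi> (cw (swap_neg_refl i k)))"
    "eqm X (brk_bar_B 1 vt n i k) (\<psi> (cw (swap_neg_refl k i)))"
    if "T = TypeB" "i \<in> {1..n}" "k \<in> {1..n} - {i}" for i k
    using cover_one_brk_bar_B[OF that(1), of i k] that(2,3) swap_neg_refl_commute[of i k]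
    by (auto simp del: subst_gen)
  note congs = eqm_mult eqm_refl eqm_diff eqm_add eqm_sum refl refl_D refl_B cover_one_brk_single
  have off: "eqm X (comm (vy j) (vx i)) c"
    if "eqm X (comm (vy j) (vx i)) b" "eqm X b c" for i j b c
    using that eqm_trans by blast
  from assms show ?thesis
  proof (cases rule: cherednik_rel.cases)
    case w_one
    have "eqm X (prod_list (map vt [])) (\<psi> (cw id))"
      by (rule cover_one_word_cw) auto
    then have "eqm X (\<psi> (cw id)) 1" using eqm_sym by (simp only: list.map prod_list.Nil)
    then show ?thesis unfolding w_one by (simp only: hom)
  next
    case (w_mult \<sigma> \<rho>)
    \<comment> \<open>The multiplication table is respected because the concatenated words form one
      of the many words for \<open>\<sigma> \<circ> \<rho>\<close>.\<close>
    have "eqm X (prod_list (map vt (weyl_word T n \<sigma> @ weyl_word T n \<rho>))) (\<psi> (cw (\<sigma> \<circ> \<rho>)))"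
      using w_mult weyl_word[OF adm] by (intro cover_one_word_cw) (auto simp: fun_eq_iff)
    then show ?thesis using w_mult W by (simp only: hom map_append prod_list.append)
  next
    case (xx i j)
    then show ?thesis
      using cover_one_z_mult[OF cover_one_eqm[OF cover_rel.xx[of i n j]]]
        by (cases "i = j") (simp_all add: hom)
  next
    case (yy i j)
    then show ?thesis
      using cover_one_eqm[OF cover_rel.yy[of i n j]] by (cases "i = j") (simp_all add: hom)
  next
    case (wx \<sigma> i)
    then show ?thesis
      using cover_one_word_conj[of vx, OF cover_one_vt(1) wx(3,4)] W weyl_group_inv[OF adm]
      by (simp only: hom subst_gen cherednik_to_cover_gen.simps if_True)
  next
    case (wy \<sigma> i)
    then show ?thesis
      using cover_one_word_conj[of vy, OF cover_one_vt(2) wy(3,4)] W weyl_group_inv[OF adm]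
      by (simp only: hom subst_gen cherednik_to_cover_gen.simps if_True)
  next
    case (A_off i j)
    have "eqm X (comm (vy j) (vx i)) (scal u * 1 * \<psi> (cw (swap_refl i j)))"
      by (rule off[OF cover_off(1)[OF adm, where \<epsilon> = 1 and u = u and v
        = v, folded X_def]]; (intro congs)?; use A_off in auto)
    then show ?thesis unfolding A_off(1,2) by (simp only: hom mult_1_right) simp
  next
    case (A_diag i)
    have "eqm X (comm (vy i) (vx i)) (- scal u * 1 * (\<Sum>k\<in>{1..n} - {i}. \<psi> (cw (swap_refl k i))))"
      by (rule off[OF cover_diag(1)[OF adm, where \<epsilon> = 1 and u = u and v
        = v, folded X_def]]; (intro congs)?; use A_diag in auto)
    then show ?thesis unfolding A_diag(1,2) by (simp only: hom mult_1_right) simp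
  next
    case (D_off i j)
    have "eqm X (comm (vy j) (vx i)) (scal u * 1 * (\<psi> (cw (swap_refl i j)) - \<psi> (cw (swap_neg_refl
      i j))))"
      by (rule off[OF cover_off(2)[OF adm, where \<epsilon> = 1 and u = u and v
        = v, folded X_def]]; (intro congs)?; use D_off in auto)
    then show ?thesis unfolding D_off(1,2) by (simp only: hom mult_1_right) simp
  next
    case (D_diag i)
    have "eqm X (comm (vy i) (vx i))
        (- scal u * 1 * (\<Sum>k\<in>{1..n} - {i}. \<psi> (cw (swap_refl k i)) + \<psi> (cw (swap_neg_refl k i))))"
      by (rule off[OF cover_diag(2)[OF adm, where \<epsilon> = 1 and u = u and v
        = v, folded X_def]]; (intro congs)?; use D_diag in auto)
    then show ?thesis unfolding D_diag(1,2) by (simp only: hom mult_1_right) simp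
  next
    case (B_off i j)
    have "eqm X (comm (vy j) (vx i)) (scal u * 1 * (\<psi> (cw (swap_refl i j)) - \<psi> (cw (swap_neg_refl
      i j))))"
      by (rule off[OF cover_off(3)[OF adm, where \<epsilon> = 1 and u = u and v
        = v, folded X_def]]; (intro congs)?; use B_off in auto)
    then show ?thesis unfolding B_off(1,2) by (simp only: hom mult_1_right) simp
  next
    case (B_diag i)
    have "eqm X (comm (vy i) (vx i))
        (- scal u * 1 * (\<Sum>k\<in>{1..n} - {i}. \<psi> (cw (swap_refl k i)) + \<psi> (cw (swap_neg_refl k i)))
          - scal v * 1 * \<psi> (cw (sign_refl i)))"
      by (rule off[OF cover_diag(3)[OF adm, where \<epsilon> = 1 and u = u and v
        = v, folded X_def]]; (intro congs)?; use B_diag in auto)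
    then show ?thesis unfolding B_diag(1,2) by (simp only: hom mult_1_right) simp
  qed
qed

end

theorem covering_one_iso:
  assumes adm: "admissible T n"
  shows "algebra_isomorphic
       (quot_algebra (covering_daha T n u v)
         (Idl\<^bsub>covering_daha T n u v\<^esub>
           {covering_z T n u v \<ominus>\<^bsub>covering_daha T n u v\<^esub> \<one>\<^bsub>covering_daha T n u v\<^esub>}))
       (cherednik_algebra T n u v)"
proof -
  let ?X = "cover_ideal_gens T n u v 1" and ?Y = "cherednik_ideal_gens T n u v"
  let ?\<phi> = "subst (cover_to_cherednik_gen T n)" and ?\<psi> = "subst (cherednik_to_cover_gen T n)"
  note hom = alg_hom_rules[OF alg_hom_subst]
  obtain \<pi> where \<pi>: "realizes (quot_algebra (covering_daha T n u v)
         (Idl\<^bsub>covering_daha T n u v\<^esub>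
           {covering_z T n u v \<ominus>\<^bsub>covering_daha T n u v\<^esub> \<one>\<^bsub>covering_daha T n u v\<^esub>})) \<pi> ?X"
    using realizes_covering_quotients(1)[OF adm] by blast
  show ?thesis
  proof (rule realizes_iso[OF \<pi> _ alg_hom_subst[of "cover_to_cherednik_gen T n"]
        alg_hom_subst[of "cherednik_to_cover_gen T n"]])
    show "realizes (cherednik_algebra T n u v)
        (\<lambda>p. presented_class (cherednik_gens T n) (cherednik_rel T n u v) (retract
          (cherednik_gens T n) p)) ?Y"
      unfolding cherednik_algebra_def cherednik_ideal_gens_def
      by (rule realizes_presented[OF cherednik_rel_closed[OF adm]])
  next
    fix x assume "x \<in> ?X"
    then consider g where "x = gen g" "g \<notin> cover_gens T n"
      | l r where "x = l - r" "cover_rel T n u v l r" | "x = vz - 1"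
      by (auto simp: cover_ideal_gens_def relators_def)
    then show "eqm ?Y (?\<phi> x) 0"
    proof cases
      case 1
      then show ?thesis
        by (cases g) (auto intro!: eqm_base simp: cover_gens_iff cherednik_ideal_gens_def
          cherednik_gens_iff)
    next
      case 2
      then show ?thesis
        using cover_to_cherednik_rel[OF adm] by (simp add: hom eqm_def)
    next
      case 3
      then show ?thesis by (simp add: hom)
    qed
  next
    fix y assume "y \<in> ?Y"
    then consider g where "y = gen g" "g \<notin> cherednik_gens T n"
      | l r where "y = l - r" "cherednik_rel T n u v l r"
      by (auto simp: cherednik_ideal_gens_def relators_def)
    then show "eqm ?X (?\<psi> y) 0"
    proof cases
      case 1
      then show ?thesis
        by (cases g) (auto intro!: eqm_base simp: cover_gens_iff cover_ideal_gens_def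
          cherednik_gens_iff)
    next
      case 2
      then show ?thesis
        using cherednik_to_cover_rel[OF adm] by (simp add: hom eqm_def)
    qed
  next
    fix g
    show "eqm ?X (?\<psi> (?\<phi> (gen g))) (gen g)"
    proof (cases g)
      \<comment> \<open>A node returns as the chosen word of its simple reflection, congruent to the
        one-letter word; for any other index both sides vanish.\<close>
      case (VT i)
      show ?thesis
      proof (cases "i \<in> nodes T n")
        case True
        then have "eqm ?X (prod_list (map vt [i])) (?\<psi> (cw (sref T n i)))"
          by (intro cover_one_word_cw[OF adm]) auto
        moreover have "?\<phi> (gen g) = cw (sref T n i)" using True VT by simp
        ultimately show ?thesis using VT eqm_sym
          by (simp only: list.map prod_list.Cons prod_list.Nil mult_1_right)
      next
        case False
        then have "eqm ?X (gen g) 0"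
          using VT by (intro eqm_base) (auto simp: cover_ideal_gens_def cover_gens_iff)
        then show ?thesis using False VT by (simp add: hom eqm_sym)
      qed
    next
      case VZ
      then show ?thesis using eqm_sym[OF cover_z[OF adm, of u v 1]] by (simp add: hom)
    qed simp_all
  next
    fix h
    show "eqm ?Y (?\<phi> (?\<psi> (gen h))) (gen h)"
    proof (cases h)
      case (CW \<sigma>)
      show ?thesis
      proof (cases "\<sigma> \<in> weyl_group T n")
        case True
        then show ?thesis
          using cherednik_word_subst[OF adm weyl_word(1)[OF adm True], of u v] weyl_word(2)[OF
            adm True] CW
          by (simp add: alg_hom_prod_list[OF alg_hom_subst] comp_def del: weyl_group.simps)
      next
        case False
        then have "eqm ?Y (gen h) 0"
          using CW by (intro eqm_base) (auto simp: cherednik_ideal_gens_def cherednik_gens_iff)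
        then show ?thesis using False CW by (simp add: hom eqm_sym del: weyl_group.simps)
      qed
    qed simp_all
  qed
qed

theorem proposition7p5:
  fixes T :: weyl_type and n :: nat and u v :: complex
  assumes "admissible T n"
  shows
    "algebra_isomorphic
       (quot_algebra (covering_daha T n u v)
         (Idl\<^bsub>covering_daha T n u v\<^esub>
           {covering_z T n u v \<ominus>\<^bsub>covering_daha T n u v\<^esub> \<one>\<^bsub>covering_daha T n u v\<^esub>}))
       (cherednik_algebra T n u v)
     \<and>
     algebra_isomorphic
       (quot_algebra (covering_daha T n u v)
         (Idl\<^bsub>covering_daha T n u v\<^esub>
           {covering_z T n u v \<oplus>\<^bsub>covering_daha T n u v\<^esub> \<one>\<^bsub>covering_daha T n u v\<^esub>}))
       (spin_daha T n u v)"
  using covering_one_iso[OF assms] covering_minus_one_iso[OF assms] by blast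

end
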